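(* Let $U=\{z:|z|<1\}$ and let $S$ denote the class of functions $w=f(z)$ that are regular (holomorphic) and univalent (schlicht) in $U$ and normalized by $f(0)=0$, $f'(0)=1$. Write $w=u+iv$. Let $f\in S$. Then: 1. $f(U)$ contains some vertical segment (a segment of a line $\operatorname{Re} w=\text{const}$) of length greater than $\pi/2$, except in the case $$f(z)=\frac12\ln\frac{1+z}{1-z}.$$ 2. If this segment lies on the line $\operatorname{Re} w=u_0$, then there exists a continuous curve $$L=\{w:\ w=u+iv(u),\ 0\le u\le u_0\ (\text{resp. } u_0\le u\le 0),\ v(0)=0\},$$ with $v$ a continuous real function, such that $L\subset f(U)$.
   Context: "Regular" means holomorphic; "schlicht" means univalent (injective). The logarithm in the exceptional function is the branch with value $0$ at $z=0$; this function maps $U$ onto the strip $\{|\operatorname{Im} w|<\pi/4\}$. *)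

theory Defs
  imports "HOL-Complex_Analysis.Complex_Analysis"
begin

definition schlicht_S :: "(complex \<Rightarrow> complex) \<Rightarrow> bool" where
  "schlicht_S f \<longleftrightarrow> f holomorphic_on ball 0 1 \<and> inj_on f (ball 0 1)
      \<and> f 0 = 0 \<and> deriv f 0 = 1"

end

(* Let g be the inverse of f on D = f(U), let psi = ln |tanh| be the corresponding potential of the
   strip |Im w| < pi/4, and suppose that no vertical segment over a reachable abscissa is longer than
   pi/2. Truncate the potential ln |g| near its pole and near the boundary of D and consider its
   Dirichlet energy in a half plane. On a vertical segment of length at most pi/2 a function that
   vanishes at the ends satisfies the Poincare-type inequality whose extremal is the vertical profile
   of psi; integrating over the reachable part of D and completing the square against the gradient of
   psi bounds the energy from below by its value for the strip plus the squared L^2 deviation of the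
   horizontal derivatives. Green's formula bounds the same energy from above. In the sum over the two
   half planes the contributions of the imaginary axis cancel, so the deviation is arbitrarily small
   when the truncation is removed. Hence Re (g'/g) is the horizontal derivative of psi near 0, which
   gives g(w) = tanh(w) exp(i mu w) on D with mu real. If mu is not 0, then |g| < 1 on a segment of the
   imaginary axis longer than pi/2, and that segment lies in D. So mu = 0, and f is the inverse of tanh. *)
theory Submission
  imports Defs
begin

subsection \<open>Iterated integrals over boxes\<close>

text \<open>With the pole truncated at depth \<open>L\<close>, both bounds for the energy of a half
  plane have the leading term \<open>pi * L\<close>. Apart from the edge term on the imaginary axis
  everything else must be small independently of \<open>L\<close>, so a bounded loss per vertical
  line is affordable only in a thin zone next to that axis. Two obstacles shape the argument. A
  section of length at most \<open>pi / 2\<close> may stick out of the strip, so the vertical flux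
  of psi is continued by constants beyond the strip and shifted by a locally constant amount on the
  section. Moreover, short sections are known only over abscissae that graphs reach, and cutting D
  at the last such abscissa would create jumps of the wrong sign. The set of points reached by
  graphs is used instead: it contains whole components of vertical sections of D, and moving away
  from the imaginary axis one leaves it only together with D. It may be entered anywhere, but there
  the sign of the potential helps. The normalization f'(0) = 1 makes g and tanh agree to first order
  at the pole; this is what equates the two leading terms.\<close>

definition bdd_meas :: "(real \<times> real \<Rightarrow> real) \<Rightarrow> real set \<Rightarrow> real set \<Rightarrow> bool" where
  "bdd_meas F A B \<longleftrightarrow> F \<in> borel_measurable borel \<and> (\<exists>c. \<forall>p\<in>A \<times> B. \<bar>F p\<bar> \<le> c)"

lemma bdd_meas_continuous:
  assumes "continuous_on ({a..b} \<times> {c..d}) F" "F \<in> borel_measurable borel"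
  shows "bdd_meas F {a..b} {c..d}"
proof -
  have "compact (F ` ({a..b} \<times> {c..d}))"
    by (intro compact_continuous_image assms(1) compact_Times compact_Icc)
  then obtain B where "\<forall>x\<in>F ` ({a..b} \<times> {c..d}). norm x \<le> B"
    using compact_imp_bounded bounded_iff by metis
  with assms(2) show ?thesis by (auto simp: bdd_meas_def)
qed

lemma bdd_meas_add: "bdd_meas F A B \<Longrightarrow> bdd_meas G A B \<Longrightarrow> bdd_meas (\<lambda>p. F p + G p) A B"
  unfolding bdd_meas_def
proof (elim conjE exE, intro conjI)
  fix c d assume "\<forall>p\<in>A \<times> B. \<bar>F p\<bar> \<le> c" "\<forall>p\<in>A \<times> B. \<bar>G p\<bar> \<le> d"
  then have "\<forall>p\<in>A \<times> B. \<bar>F p + G p\<bar> \<le> c + d"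
    by (metis abs_triangle_ineq add_mono order_trans)
  then show "\<exists>c. \<forall>p\<in>A \<times> B. \<bar>F p + G p\<bar> \<le> c" by blast
qed simp

lemma bdd_meas_mult: "bdd_meas F A B \<Longrightarrow> bdd_meas G A B \<Longrightarrow> bdd_meas (\<lambda>p. F p * G p) A B"
  unfolding bdd_meas_def
proof (elim conjE exE, intro conjI)
  fix c d assume "\<forall>p\<in>A \<times> B. \<bar>F p\<bar> \<le> c" "\<forall>p\<in>A \<times> B. \<bar>G p\<bar> \<le> d"
  then have "\<forall>p\<in>A \<times> B. \<bar>F p * G p\<bar> \<le> c * d"
    by (auto simp: abs_mult intro!: mult_mono intro: order_trans[OF abs_ge_zero])
  then show "\<exists>c. \<forall>p\<in>A \<times> B. \<bar>F p * G p\<bar> \<le> c" by blast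
qed simp

lemma bdd_meas_const: "bdd_meas (\<lambda>p. c) A B"
  by (auto simp: bdd_meas_def)

lemma bdd_meas_minus: "bdd_meas F A B \<Longrightarrow> bdd_meas (\<lambda>p. - F p) A B"
  by (auto simp: bdd_meas_def)

lemma bdd_meas_diff: "bdd_meas F A B \<Longrightarrow> bdd_meas G A B \<Longrightarrow> bdd_meas (\<lambda>p. F p - G p) A B"
  using bdd_meas_add[OF _ bdd_meas_minus] by fastforce

lemma bdd_meas_power2: "bdd_meas F A B \<Longrightarrow> bdd_meas (\<lambda>p. (F p)\<^sup>2) A B"
  by (simp add: power2_eq_square bdd_meas_mult)

text \<open>Indicators are the reason for working with bounded Borel functions instead of continuous
  ones: the reachable part of D enters the double integrals through its indicator. Boundedness is
  asked only on the box, because the strip potential is singular at its pole.\<close>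

lemma bdd_meas_indicator: "S \<in> sets borel \<Longrightarrow> bdd_meas (indicator S) A B"
  by (auto simp: bdd_meas_def split: split_indicator intro!: exI[of _ 1])

lemmas bdd_meas_intros = bdd_meas_add bdd_meas_mult bdd_meas_const bdd_meas_minus bdd_meas_diff
  bdd_meas_power2 bdd_meas_indicator

lemma bdd_meas_swap:
  assumes "bdd_meas F A B" shows "bdd_meas (\<lambda>p. F (snd p, fst p)) B A"
proof -
  have [measurable]: "F \<in> borel_measurable borel" using assms by (simp add: bdd_meas_def)
  have "(\<lambda>p::real \<times> real. (snd p, fst p)) \<in> borel_measurable borel"
    by (intro borel_measurable_continuous_onI continuous_intros)
  then have "(\<lambda>p. F (snd p, fst p)) \<in> borel_measurable borel"
    using measurable_compose by fastforce
  then show ?thesis using assms by (force simp: bdd_meas_def)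
qed

lemma set_integrable_bounded_Icc:
  fixes f :: "real \<Rightarrow> real"
  assumes [measurable]: "f \<in> borel_measurable borel" and "\<And>x. x \<in> {a..b} \<Longrightarrow> \<bar>f x\<bar> \<le> c"
  shows "set_integrable lborel {a..b} f"
  unfolding set_integrable_def
  by (rule integrableI_bounded_set[where A="{a..b}" and B=c])
    (use assms(2) in \<open>auto split: split_indicator simp: emeasure_lborel_Icc_eq\<close>)

lemma bdd_meas_section:
  assumes "bdd_meas F {a..b} {c..d}" "u \<in> {a..b}"
  shows "set_integrable lborel {c..d} (\<lambda>v. F (u, v))"
proof -
  have [measurable]: "F \<in> borel_measurable borel" using assms by (simp add: bdd_meas_def)
  obtain e where e: "\<And>p. p \<in> {a..b} \<times> {c..d} \<Longrightarrow> \<bar>F p\<bar> \<le> e" using assms(1) by (auto simp: bdd_meas_def)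
  have "(\<lambda>v. (u, v)) \<in> borel_measurable borel"
    by (intro borel_measurable_continuous_onI continuous_intros)
  then have "(\<lambda>v. F (u, v)) \<in> borel_measurable borel"
    using measurable_compose by fastforce
  then show ?thesis by (rule set_integrable_bounded_Icc[where c=e]) (use assms(2) e in auto)
qed

lemma bdd_meas_box_integrable:
  assumes "bdd_meas F {a..b} {c..d}"
  shows "integrable (lborel \<Otimes>\<^sub>M lborel) (\<lambda>p. indicator ({a..b} \<times> {c..d}) p * F p)"
proof -
  have [measurable]: "F \<in> borel_measurable borel" using assms by (simp add: bdd_meas_def)
  obtain e where e: "\<And>p. p \<in> {a..b} \<times> {c..d} \<Longrightarrow> \<bar>F p\<bar> \<le> e" using assms(1) by (auto simp: bdd_meas_def)
  have "{a..b} \<times> {c..d} \<in> sets (borel::(real\<times>real) measure)"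
    by (intro borel_closed closed_Times closed_atLeastAtMost)
  then show ?thesis unfolding lborel_prod
  proof (intro integrableI_bounded_set[where A="{a..b} \<times> {c..d}" and B=e])
    show "emeasure lborel ({a..b} \<times> {c..d}) < \<infinity>"
      by (intro emeasure_bounded_finite bounded_Times bounded_closed_interval)
  qed (use e in \<open>auto split: split_indicator\<close>)
qed

lemma bdd_meas_integral_fst:
  assumes "bdd_meas F {a..b} {c..d}"
  shows "set_integrable lborel {a..b} (\<lambda>u. LINT v:{c..d}|lborel. F (u, v))"
    and "(LINT u:{a..b}|lborel. LINT v:{c..d}|lborel. F (u, v))
          = (LINT v:{c..d}|lborel. LINT u:{a..b}|lborel. F (u, v))"
proof -
  let ?H = "\<lambda>p. indicator ({a..b} \<times> {c..d}) p * F p"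
  note int = bdd_meas_box_integrable[OF assms]
  have 1: "(\<integral>v. ?H (u, v) \<partial>lborel) = indicator {a..b} u *\<^sub>R (LINT v:{c..d}|lborel. F (u, v))" for u
    unfolding set_lebesgue_integral_def
    by (auto simp: indicator_times mult.assoc split: split_indicator)
  have 2: "(\<integral>u. ?H (u, v) \<partial>lborel) = indicator {c..d} v *\<^sub>R (LINT u:{a..b}|lborel. F (u, v))" for v
    unfolding set_lebesgue_integral_def
    by (auto simp: indicator_times ac_simps split: split_indicator)
  show "set_integrable lborel {a..b} (\<lambda>u. LINT v:{c..d}|lborel. F (u, v))"
    unfolding set_integrable_def 1[symmetric]
    by (rule lborel_pair.integrable_fst'[OF int])
  have "(\<integral>u. (\<integral>v. ?H (u, v) \<partial>lborel) \<partial>lborel) = (\<integral>v. (\<integral>u. ?H (u, v) \<partial>lborel) \<partial>lborel)"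
    using lborel_pair.Fubini_integral[of "\<lambda>u v. ?H (u, v)"] int by (simp add: case_prod_beta')
  then show "(LINT u:{a..b}|lborel. LINT v:{c..d}|lborel. F (u, v))
          = (LINT v:{c..d}|lborel. LINT u:{a..b}|lborel. F (u, v))"
    unfolding 1 2 by (simp add: set_lebesgue_integral_def)
qed

lemma bdd_meas_iterated_add:
  assumes "bdd_meas F {a..b} {c..d}" "bdd_meas G {a..b} {c..d}"
  shows "(LINT u:{a..b}|lborel. LINT v:{c..d}|lborel. F (u, v) + G (u, v))
    = (LINT u:{a..b}|lborel. LINT v:{c..d}|lborel. F (u, v))
      + (LINT u:{a..b}|lborel. LINT v:{c..d}|lborel. G (u, v))"
proof -
  have "(LINT u:{a..b}|lborel. LINT v:{c..d}|lborel. F (u, v) + G (u, v))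
    = (LINT u:{a..b}|lborel. (LINT v:{c..d}|lborel. F (u, v)) + (LINT v:{c..d}|lborel. G (u, v)))"
    by (intro set_lebesgue_integral_cong)
      (auto intro!: set_integral_add bdd_meas_section[OF assms(1)] bdd_meas_section[OF assms(2)])
  then show ?thesis
    by (simp add: set_integral_add bdd_meas_integral_fst(1) assms)
qed

lemma bdd_meas_iterated_mono:
  assumes "bdd_meas F {a..b} {c..d}" "bdd_meas G {a..b} {c..d}"
    and "\<And>u v. u \<in> {a..b} \<Longrightarrow> v \<in> {c..d} \<Longrightarrow> F (u, v) \<le> G (u, v)"
  shows "(LINT u:{a..b}|lborel. LINT v:{c..d}|lborel. F (u, v))
      \<le> (LINT u:{a..b}|lborel. LINT v:{c..d}|lborel. G (u, v))"
  by (intro set_integral_mono bdd_meas_integral_fst(1) assms bdd_meas_section[OF assms(1)] bdd_meas_section[OF assms(2)])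
    auto

lemma set_integral_FTC:
  fixes F f :: "real \<Rightarrow> real"
  assumes "a \<le> b" and "\<And>x. a \<le> x \<Longrightarrow> x \<le> b \<Longrightarrow> (F has_real_derivative f x) (at x within {a..b})"
    and "continuous_on {a..b} f"
  shows "(LINT x:{a..b}|lborel. f x) = F b - F a"
  unfolding set_lebesgue_integral_def
  by (rule integral_FTC_Icc) (use assms in \<open>auto simp: has_real_derivative_iff_has_vector_derivative\<close>)

lemma set_integral_Icc_split:
  fixes f :: "real \<Rightarrow> real"
  assumes "a \<le> b" "b \<le> c" "set_integrable lborel {a..c} f"
  shows "(LINT x:{a..c}|lborel. f x) = (LINT x:{a..b}|lborel. f x) + (LINT x:{b..c}|lborel. f x)"
proof -
  have "(LINT x:{a..c}|lborel. f x) = (LINT x:{a..b} \<union> {b<..c}|lborel. f x)"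
    using assms by (simp add: ivl_disj_un)
  also have "\<dots> = (LINT x:{a..b}|lborel. f x) + (LINT x:{b<..c}|lborel. f x)"
    by (intro set_integral_Un set_integrable_subset[OF assms(3)]) (use assms in auto)
  also have "(LINT x:{b<..c}|lborel. f x) = (LINT x:{b..c}|lborel. f x)"
  proof (rule set_integral_cong_set)
    show "set_borel_measurable lborel {b..c} f" "set_borel_measurable lborel {b<..c} f"
      using set_integrable_subset[OF assms(3), of "{b..c}"] set_integrable_subset[OF assms(3), of "{b<..c}"] assms(1,2)
      by (auto simp: set_integrable_def set_borel_measurable_def subset_iff)
    show "AE x in lborel. x \<in> {b..c} \<longleftrightarrow> x \<in> {b<..c}"
      using AE_lborel_singleton[of b] by eventually_elim auto
  qed
  finally show ?thesis .
qed

subsection \<open>The potential of the strip\<close>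

text \<open>In the strip \<open>\<bar>v\<bar> < pi / 4\<close> the function \<open>psi u v = ln (cmod (tanh (Complex u v)))\<close> is minus the
  Green function with pole at \<open>0\<close>.\<close>

definition strip_den :: "real \<Rightarrow> real \<Rightarrow> real" where
  "strip_den u v = (sinh (2 * u))\<^sup>2 + (sin (2 * v))\<^sup>2"

text \<open>Half the logarithm of
  \<open>(cosh (2 * u) - cos (2 * v)) / (cosh (2 * u) + cos (2 * v))\<close>, which is the square of
  the modulus of tanh.\<close>

definition psi :: "real \<Rightarrow> real \<Rightarrow> real" where
  "psi u v = - artanh (cos (2 * v) / cosh (2 * u))"

text \<open>The logarithmic derivative of tanh is \<open>2 / sinh (2 * w)\<close>:
  \<open>psi_u\<close> is its real part, \<open>psi_v\<close> minus its imaginary part, and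
  \<open>strip_den\<close> is the squared modulus of \<open>sinh (2 * w)\<close>.\<close>

definition psi_u :: "real \<Rightarrow> real \<Rightarrow> real" where
  "psi_u u v = 2 * sinh (2 * u) * cos (2 * v) / strip_den u v"

definition psi_v :: "real \<Rightarrow> real \<Rightarrow> real" where
  "psi_v u v = 2 * cosh (2 * u) * sin (2 * v) / strip_den u v"

definition psi_uu :: "real \<Rightarrow> real \<Rightarrow> real" where
  "psi_uu u v = 4 * cosh (2 * u) * cos (2 * v) * ((sin (2 * v))\<^sup>2 - (sinh (2 * u))\<^sup>2) / (strip_den u v)\<^sup>2"

lemma strip_den_pos: "u \<noteq> 0 \<Longrightarrow> strip_den u v > 0"
  by (auto simp: strip_den_def intro!: add_pos_nonneg)

lemma strip_den_eq: "strip_den u v = (cosh (2 * u))\<^sup>2 - (cos (2 * v))\<^sup>2"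
  using sin_cos_squared_add[of "2 * v"] cosh_square_eq[of "2 * u"] unfolding strip_den_def by linarith

lemma cos_div_cosh_bounds:
  assumes "u \<noteq> (0::real)"
  shows "\<bar>cos x / cosh (2 * u)\<bar> < 1"
proof -
  have "1\<^sup>2 < (cosh (2 * u))\<^sup>2" using assms by (simp add: cosh_square_eq)
  then have "1 < cosh (2 * u)" by (rule power2_less_imp_less) simp
  moreover have "\<bar>cos x\<bar> \<le> 1" by (rule abs_cos_le_one)
  ultimately have "\<bar>cos x\<bar> < cosh (2 * u)" by (rule le_less_trans[rotated])
  then show ?thesis by (simp add: abs_divide divide_less_eq_1)
qed

lemma psi_has_derivative_v:
  assumes "u \<noteq> 0" shows "((\<lambda>v. psi u v) has_real_derivative psi_v u v) (at v within A)"
proof -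
  have c: "cosh (2 * u) > 0" by simp
  have d: "(cosh (2 * u))\<^sup>2 - (cos (2 * v))\<^sup>2 \<noteq> 0"
    using strip_den_pos[OF assms, of v] by (simp add: strip_den_eq)
  have "1 - (cos (2 * v) / cosh (2 * u))\<^sup>2 = ((cosh (2 * u))\<^sup>2 - (cos (2 * v))\<^sup>2) / (cosh (2 * u))\<^sup>2"
    using c by (simp add: power_divide field_simps)
  moreover have "((\<lambda>v. cos (2 * v) / cosh (2 * u)) has_real_derivative - (2 * sin (2 * v)) / cosh (2 * u)) (at v within A)"
    using c by (auto intro!: derivative_eq_intros simp: power2_eq_square)
  from DERIV_chain2[OF artanh_real_has_field_derivative[OF cos_div_cosh_bounds[OF assms]] this]
  have "((\<lambda>v. artanh (cos (2 * v) / cosh (2 * u))) has_real_derivative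
      1 / (1 - (cos (2 * v) / cosh (2 * u))\<^sup>2) * (- (2 * sin (2 * v)) / cosh (2 * u))) (at v within A)" .
  ultimately have "((\<lambda>v. artanh (cos (2 * v) / cosh (2 * u))) has_real_derivative - psi_v u v) (at v within A)"
    unfolding psi_v_def strip_den_eq using c d by (simp add: power2_eq_square divide_simps mult_ac split: if_splits)
  from DERIV_minus[OF this] show ?thesis unfolding psi_def by simp
qed

lemma psi_has_derivative_u:
  assumes "u \<noteq> 0" shows "((\<lambda>u. psi u v) has_real_derivative psi_u u v) (at u within A)"
proof -
  have c: "cosh (2 * u) > 0" by simp
  have d: "(cosh (2 * u))\<^sup>2 - (cos (2 * v))\<^sup>2 \<noteq> 0"
    using strip_den_pos[OF assms, of v] by (simp add: strip_den_eq)
  have "1 - (cos (2 * v) / cosh (2 * u))\<^sup>2 = ((cosh (2 * u))\<^sup>2 - (cos (2 * v))\<^sup>2) / (cosh (2 * u))\<^sup>2"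
    using c by (simp add: power_divide field_simps)
  moreover have "((\<lambda>u. cos (2 * v) / cosh (2 * u)) has_real_derivative - (cos (2 * v) * (2 * sinh (2 * u))) / (cosh (2 * u))\<^sup>2) (at u within A)"
    using c by (auto intro!: derivative_eq_intros simp: power2_eq_square)
  from DERIV_chain2[OF artanh_real_has_field_derivative[OF cos_div_cosh_bounds[OF assms]] this]
  have "((\<lambda>u. artanh (cos (2 * v) / cosh (2 * u))) has_real_derivative
      1 / (1 - (cos (2 * v) / cosh (2 * u))\<^sup>2) * (- (cos (2 * v) * (2 * sinh (2 * u))) / (cosh (2 * u))\<^sup>2)) (at u within A)" .
  ultimately have "((\<lambda>u. artanh (cos (2 * v) / cosh (2 * u))) has_real_derivative - psi_u u v) (at u within A)"
    unfolding psi_u_def strip_den_eq using c d by (simp add: power2_eq_square divide_simps mult_ac split: if_splits)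
  from DERIV_minus[OF this] show ?thesis unfolding psi_def by simp
qed

lemma psi_u_has_derivative:
  assumes "u \<noteq> 0" shows "((\<lambda>u. psi_u u v) has_real_derivative psi_uu u v) (at u within A)"
proof -
  define D where "D = (\<lambda>u. (sinh (2 * u))\<^sup>2 + (sin (2 * v))\<^sup>2)"
  have d: "D u \<noteq> 0" using strip_den_pos[OF assms, of v] unfolding strip_den_def D_def by linarith
  have dD: "(D has_real_derivative 2 * sinh (2 * u) * (2 * cosh (2 * u))) (at u within A)"
    unfolding D_def by (auto intro!: derivative_eq_intros)
  have dN: "((\<lambda>u. 2 * sinh (2 * u) * cos (2 * v)) has_real_derivative 4 * cosh (2 * u) * cos (2 * v)) (at u within A)"
    by (auto intro!: derivative_eq_intros)
  have "(4 * cosh (2 * u) * cos (2 * v) * D u - 2 * sinh (2 * u) * cos (2 * v) * (2 * sinh (2 * u) * (2 * cosh (2 * u))))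
      / (D u * D u) = psi_uu u v"
    unfolding psi_uu_def strip_den_def D_def by (simp add: power2_eq_square algebra_simps)
  with DERIV_divide[OF dN dD d] show ?thesis unfolding psi_u_def strip_den_def D_def by simp
qed

text \<open>Together with the horizontal derivative of \<open>psi_u\<close> this is the harmonicity
  of \<open>psi\<close>. It lets vertical integrations by parts be traded for horizontal
  ones.\<close>

lemma psi_v_has_derivative:
  assumes "u \<noteq> 0" shows "((\<lambda>v. psi_v u v) has_real_derivative - psi_uu u v) (at v within A)"
proof -
  define D where "D = (\<lambda>v. (sinh (2 * u))\<^sup>2 + (sin (2 * v))\<^sup>2)"
  have d: "D v \<noteq> 0" using strip_den_pos[OF assms, of v] unfolding strip_den_def D_def by linarith
  have dD: "(D has_real_derivative 2 * sin (2 * v) * (2 * cos (2 * v))) (at v within A)"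
    unfolding D_def by (auto intro!: derivative_eq_intros)
  have dN: "((\<lambda>v. 2 * cosh (2 * u) * sin (2 * v)) has_real_derivative 4 * cosh (2 * u) * cos (2 * v)) (at v within A)"
    by (auto intro!: derivative_eq_intros)
  have "(4 * cosh (2 * u) * cos (2 * v) * D v - 2 * cosh (2 * u) * sin (2 * v) * (2 * sin (2 * v) * (2 * cos (2 * v))))
      / (D v * D v) = (4 * cosh (2 * u) * cos (2 * v) * ((sinh (2 * u))\<^sup>2 - (sin (2 * v))\<^sup>2)) / (D v * D v)"
    unfolding D_def by (simp add: power2_eq_square algebra_simps)
  also have "\<dots> = - psi_uu u v"
    unfolding psi_uu_def strip_den_def D_def
    by (simp only: minus_divide_left mult_minus_right[symmetric] minus_diff_eq power2_eq_square)
  finally show ?thesis using DERIV_divide[OF dN dD d] unfolding psi_v_def strip_den_def D_def by simp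
qed

lemma continuous_on_strip [continuous_intros]:
  fixes f g :: "'a::t2_space \<Rightarrow> real"
  assumes "continuous_on A f" "continuous_on A g" "\<And>x. x \<in> A \<Longrightarrow> f x \<noteq> 0"
  shows "continuous_on A (\<lambda>x. psi (f x) (g x))"
    and "continuous_on A (\<lambda>x. psi_u (f x) (g x))"
    and "continuous_on A (\<lambda>x. psi_v (f x) (g x))"
    and "continuous_on A (\<lambda>x. psi_uu (f x) (g x))"
proof -
  have *: "strip_den (f x) (g x) \<noteq> 0" if "x \<in> A" for x
    using strip_den_pos[OF assms(3)[OF that], of "g x"] by simp
  have ch: "continuous_on A (\<lambda>x. cosh (2 * f x))" "continuous_on A (\<lambda>x. sinh (2 * f x))"
    unfolding cosh_field_def sinh_field_def by (intro continuous_intros assms; simp)+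
  have tr: "continuous_on A (\<lambda>x. cos (2 * g x))" "continuous_on A (\<lambda>x. sin (2 * g x))"
    by (intro continuous_on_cos continuous_on_sin continuous_on_mult_left assms)+
  have D: "continuous_on A (\<lambda>x. strip_den (f x) (g x))"
    unfolding strip_den_def by (intro continuous_on_add continuous_on_power ch tr)
  show "continuous_on A (\<lambda>x. psi_u (f x) (g x))"
    unfolding psi_u_def by (intro continuous_on_divide continuous_on_mult continuous_on_const ch tr D ballI *)
  show "continuous_on A (\<lambda>x. psi_v (f x) (g x))"
    unfolding psi_v_def by (intro continuous_on_divide continuous_on_mult continuous_on_const ch tr D ballI *)
  show "continuous_on A (\<lambda>x. psi_uu (f x) (g x))"
    unfolding psi_uu_def
    by (intro continuous_on_divide continuous_on_mult continuous_on_diff continuous_on_power continuous_on_const ch tr D)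
      (use * in auto)
  have "continuous_on A (\<lambda>x. artanh (cos (2 * g x) / cosh (2 * f x)))"
  proof (rule continuous_on_compose2[of "{-1<..<1}" artanh])
    show "continuous_on {- 1<..<1::real} artanh"
      by (rule DERIV_continuous_on[OF artanh_real_has_field_derivative]) auto
    show "continuous_on A (\<lambda>x. cos (2 * g x) / cosh (2 * f x))"
      by (intro continuous_intros ch assms) simp
  qed (use cos_div_cosh_bounds[OF assms(3)] in \<open>auto simp: abs_less_iff simp del: abs_divide\<close>)
  then show "continuous_on A (\<lambda>x. psi (f x) (g x))"
    unfolding psi_def by (intro continuous_intros)
qed

lemma measurable_strip:
  "(\<lambda>p. psi (fst p) (snd p)) \<in> borel_measurable (borel :: (real \<times> real) measure)"
  "(\<lambda>p. psi_u (fst p) (snd p)) \<in> borel_measurable (borel :: (real \<times> real) measure)"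
  "(\<lambda>p. psi_v (fst p) (snd p)) \<in> borel_measurable (borel :: (real \<times> real) measure)"
  "(\<lambda>p. psi_uu (fst p) (snd p)) \<in> borel_measurable (borel :: (real \<times> real) measure)"
  unfolding psi_def psi_u_def psi_v_def psi_uu_def strip_den_def artanh_def cosh_field_def sinh_field_def borel_prod[symmetric]
  by measurable

lemma cos_double_nonneg: "\<bar>v\<bar> \<le> pi / 4 \<Longrightarrow> cos (2 * v) \<ge> 0"
  by (intro cos_ge_zero) auto

lemma psi_u_nonneg: "u > 0 \<Longrightarrow> \<bar>v\<bar> \<le> pi / 4 \<Longrightarrow> psi_u u v \<ge> 0"
  using strip_den_pos[of u v] cos_double_nonneg[of v] by (auto simp: psi_u_def)

lemma psi_quarter: "psi u (pi / 4) = 0" "psi u (- (pi / 4)) = 0"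
  by (simp_all add: psi_def)

lemma psi_v_quarter:
  assumes "u \<noteq> 0"
  shows "psi_v u (pi / 4) = 2 / cosh (2 * u)" "psi_v u (- (pi / 4)) = - (2 / cosh (2 * u))"
  by (simp_all add: psi_v_def strip_den_eq power2_eq_square)

lemma artanh_ge_self:
  assumes "0 \<le> (x::real)" "x < 1" shows "x \<le> artanh x"
proof -
  have "(\<lambda>x. artanh x - x) 0 \<le> (\<lambda>x. artanh x - x) x"
  proof (rule DERIV_nonneg_imp_nondecreasing[OF assms(1)])
    fix y assume y: "0 \<le> y" "y \<le> x"
    then have y2: "y\<^sup>2 < 1" using assms by (simp add: power_less_one_iff abs_square_less_1)
    then show "\<exists>z. ((\<lambda>x. artanh x - x) has_real_derivative z) (at y) \<and> z \<ge> 0"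
      using y assms by (intro exI[of _ "1 / (1 - y\<^sup>2) - 1"]) (auto intro!: derivative_eq_intros simp: field_simps)
  qed
  then show ?thesis by simp
qed

text \<open>From \<open>x \<le> artanh x\<close>. With this bound the comparison at a cut point of a
  section no longer depends on \<open>u\<close>: the hyperbolic cosine occurs only in a common
  factor.\<close>

lemma psi_le:
  assumes "u \<noteq> 0" "\<bar>v\<bar> \<le> pi / 4"
  shows "psi u v \<le> - (cos (2 * v) / cosh (2 * u))"
  unfolding psi_def using artanh_ge_self[of "cos (2 * v) / cosh (2 * u)"] cos_double_nonneg[OF assms(2)]
    cos_div_cosh_bounds[OF assms(1), of "2 * v"] by auto

lemma psi_nonpos: "u \<noteq> 0 \<Longrightarrow> \<bar>v\<bar> \<le> pi / 4 \<Longrightarrow> psi u v \<le> 0"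
  by (rule order_trans[OF psi_le]) (auto simp: cos_double_nonneg)

text \<open>The flux of the pole through a vertical segment. For \<open>0 < d < pi / 2\<close> it
  tends to \<open>pi\<close> as \<open>u\<close> tends to 0, half of the total flux
  \<open>2 * pi\<close> of a logarithmic pole.\<close>

lemma psi_u_integral:
  assumes "u > 0" "0 \<le> d"
  shows "(LINT v:{-d..d}|lborel. psi_u u v) = 2 * arctan (sin (2 * d) / sinh (2 * u))"
proof -
  define S where "S = sinh (2 * u)"
  have s: "S > 0" using assms by (simp add: S_def)
  have "((\<lambda>v. arctan (sin (2 * v) / S)) has_real_derivative psi_u u v) (at v within {-d..d})" for v
  proof -
    have "((\<lambda>v. arctan (sin (2 * v) / S)) has_real_derivative
        inverse (1 + (sin (2 * v) / S)\<^sup>2) * (2 * cos (2 * v) / S)) (at v within {-d..d})"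
      using s by (auto intro!: derivative_eq_intros)
    also have "1 + (sin (2 * v) / S)\<^sup>2 = (S\<^sup>2 + (sin (2 * v))\<^sup>2) / S\<^sup>2"
      using s by (simp add: power_divide add_divide_distrib)
    also have "inverse \<dots> * (2 * cos (2 * v) / S) = psi_u u v"
      unfolding psi_u_def strip_den_def S_def[symmetric] using s by (simp add: power2_eq_square)
    finally show ?thesis .
  qed
  moreover have "continuous_on {-d..d} (psi_u u)"
    using assms(1) by (intro continuous_intros) auto
  ultimately show ?thesis using assms
    by (subst set_integral_FTC[where F="\<lambda>v. arctan (sin (2 * v) / S)"]) (auto simp: arctan_minus S_def)
qed

subsection \<open>The inequality on a vertical line\<close>

text \<open>The vertical component of the gradient of \<open>psi\<close>, continued by its edge
  values, because sections of the domain may leave the strip. The continuation is continuous in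
  \<open>v\<close> and constant on each outer side, so it adds no source there.\<close>

definition flux_v :: "real \<Rightarrow> real \<Rightarrow> real" where
  "flux_v u v = (if v > pi / 4 then 2 / cosh (2 * u) else if v < - (pi / 4) then - (2 / cosh (2 * u)) else psi_v u v)"

lemma continuous_flux_v:
  assumes "u \<noteq> 0" shows "continuous_on A (flux_v u)"
proof -
  have "continuous_on UNIV (\<lambda>v. psi_v u (max (- (pi / 4)) (min (pi / 4) v)))"
    by (intro continuous_intros) (use assms in auto)
  moreover have "psi_v u (max (- (pi / 4)) (min (pi / 4) v)) = flux_v u v" for v
  proof -
    consider "v > pi / 4" | "v < - (pi / 4)" | "- (pi / 4) \<le> v" "v \<le> pi / 4" by linarith
    then show ?thesis
    proof cases
      case 1
      then have "min (pi / 4) v = pi / 4" "max (- (pi / 4)) (pi / 4) = pi / 4" using pi_gt_zero by (auto simp: max_def)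
      with 1 show ?thesis using psi_v_quarter[OF assms] by (simp add: flux_v_def)
    next
      case 2
      then have "v < pi / 4" using pi_gt_zero by linarith
      with 2 have "min (pi / 4) v = v" "max (- (pi / 4)) v = - (pi / 4)" by (auto simp: max_def min_def)
      with 2 \<open>v < pi / 4\<close> show ?thesis using psi_v_quarter[OF assms] by (auto simp: flux_v_def)
    qed (auto simp: flux_v_def)
  qed
  ultimately have "continuous_on UNIV (flux_v u)" by simp
  then show ?thesis by (rule continuous_on_subset) simp
qed

lemma flux_v_outside:
  assumes "u \<noteq> 0"
  shows "v \<ge> pi / 4 \<Longrightarrow> flux_v u v = 2 / cosh (2 * u)" "v \<le> - (pi / 4) \<Longrightarrow> flux_v u v = - (2 / cosh (2 * u))"
proof -
  have "flux_v u (pi / 4) = 2 / cosh (2 * u)" "flux_v u (- (pi / 4)) = - (2 / cosh (2 * u))"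
    using psi_v_quarter[OF assms] by (auto simp: flux_v_def)
  moreover have "flux_v u v = 2 / cosh (2 * u)" if "v > pi / 4" using that by (simp add: flux_v_def)
  moreover have "flux_v u v = - (2 / cosh (2 * u))" if "v < - (pi / 4)"
  proof -
    have "\<not> v > pi / 4" using that pi_gt_zero by linarith
    then show ?thesis using that by (simp add: flux_v_def)
  qed
  ultimately show "v \<ge> pi / 4 \<Longrightarrow> flux_v u v = 2 / cosh (2 * u)" "v \<le> - (pi / 4) \<Longrightarrow> flux_v u v = - (2 / cosh (2 * u))"
    by (metis order_le_less)+
qed

text \<open>Inside the strip an integration by parts leaves boundary terms at \<open>pi / 4\<close>
  and \<open>- (pi / 4)\<close>. Outside, where the flux is constant, integrating \<open>y'\<close>
  up to the zeros of \<open>y\<close> at \<open>M\<close> and \<open>-M\<close> gives the same terms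
  with the opposite sign. The interior term that survives is later combined with the horizontal
  direction.\<close>

lemma line_parts:
  assumes u: "u \<noteq> 0" and M: "pi / 4 \<le> M"
    and y: "\<And>v. (y has_real_derivative y' v) (at v)" and cy: "continuous_on UNIV y'"
    and z: "\<And>v. \<bar>v\<bar> \<ge> M \<Longrightarrow> y v = 0"
  shows "(LINT v:{-M..M}|lborel. flux_v u v * y' v) = (LINT v:{- (pi / 4)..pi / 4}|lborel. psi_uu u v * y v)"
proof -
  let ?p = "pi / 4" and ?m = "2 / cosh (2 * u)"
  have p: "0 < ?p" by simp
  have zM: "y M = 0" "y (-M) = 0" using z[of M] z[of "-M"] M p by linarith+
  have y0: "(y has_real_derivative y' v) (at v within A)" for v A
    using y by (rule has_field_derivative_at_within)
  have cy': "continuous_on A y'" and cyy: "continuous_on A y" for A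
    using continuous_on_subset[OF cy] DERIV_continuous_on[OF y0] by auto
  have int: "set_integrable lborel {a..b} (\<lambda>v. flux_v u v * y' v)" for a b
    by (intro borel_integrable_atLeastAtMost' continuous_intros continuous_flux_v u cy')
  have "(LINT v:{-M..M}|lborel. flux_v u v * y' v) = (LINT v:{-M..-?p}|lborel. flux_v u v * y' v)
     + ((LINT v:{-?p..?p}|lborel. flux_v u v * y' v) + (LINT v:{?p..M}|lborel. flux_v u v * y' v))"
  proof -
    have "-M \<le> -?p" "-?p \<le> M" "-?p \<le> ?p" using M p by linarith+
    then show ?thesis
      using set_integral_Icc_split[of "-M" "-?p" M, OF _ _ int] set_integral_Icc_split[of "-?p" ?p M, OF _ M int]
      by linarith
  qed
  also have "(LINT v:{-M..-?p}|lborel. flux_v u v * y' v) = (LINT v:{-M..-?p}|lborel. - ?m * y' v)"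
    by (intro set_lebesgue_integral_cong) (simp_all add: flux_v_outside(2)[OF u])
  also have "\<dots> = - ?m * y (- ?p)"
    using M zM set_integral_FTC[of "-M" "-?p" "\<lambda>v. - ?m * y v", OF _ DERIV_cmult[OF y0] continuous_on_mult_left[OF cy']] by simp
  also have "(LINT v:{?p..M}|lborel. flux_v u v * y' v) = (LINT v:{?p..M}|lborel. ?m * y' v)"
    by (intro set_lebesgue_integral_cong) (simp_all add: flux_v_outside(1)[OF u])
  also have "\<dots> = - ?m * y ?p"
    using M zM set_integral_FTC[of ?p M "\<lambda>v. ?m * y v", OF _ DERIV_cmult[OF y0] continuous_on_mult_left[OF cy']] by simp
  also have "(LINT v:{-?p..?p}|lborel. flux_v u v * y' v)
      = (LINT v:{-?p..?p}|lborel. (psi_v u v * y' v + - psi_uu u v * y v) + psi_uu u v * y v)"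
    by (intro set_lebesgue_integral_cong) (auto simp: flux_v_def)
  also have "\<dots> = (LINT v:{-?p..?p}|lborel. psi_v u v * y' v + - psi_uu u v * y v)
      + (LINT v:{-?p..?p}|lborel. psi_uu u v * y v)"
    by (intro set_integral_add borel_integrable_atLeastAtMost' continuous_intros cy' cyy) (use u in auto)
  also have "(LINT v:{-?p..?p}|lborel. psi_v u v * y' v + - psi_uu u v * y v)
      = psi_v u ?p * y ?p - psi_v u (-?p) * y (-?p)"
  proof (rule set_integral_FTC)
    fix x
    show "((\<lambda>v. psi_v u v * y v) has_real_derivative psi_v u x * y' x + - psi_uu u x * y x) (at x within {-?p..?p})"
      using DERIV_mult[OF psi_v_has_derivative[OF u] y0] by (simp add: algebra_simps)
  next
    show "continuous_on {-?p..?p} (\<lambda>v. psi_v u v * y' v + - psi_uu u v * y v)"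
      by (intro continuous_intros cy' cyy) (use u in auto)
  qed simp
  finally show ?thesis using psi_v_quarter[OF u] by simp
qed

text \<open>Expand the square of \<open>y' - (flux_v u - s)\<close>. The integral of
  \<open>s * y'\<close> is 0: \<open>s\<close> is constant near each point of \<open>H\<close> and
  \<open>y\<close> vanishes near each point off \<open>H\<close>, so \<open>s * y\<close> is
  continuously differentiable and zero at both ends. Hence \<open>s\<close> may be chosen freely on
  each component of \<open>H\<close> to make the remainder \<open>R\<close> small.\<close>

lemma line_test:
  assumes u: "u \<noteq> 0"
    and y: "\<And>v. (y has_real_derivative y' v) (at v)" and cy: "continuous_on UNIV y'"
    and z: "\<And>v. \<bar>v\<bar> \<ge> M \<Longrightarrow> y v = 0" and M: "0 \<le> M"
    and off: "\<And>v. v \<notin> H \<Longrightarrow> \<exists>e>0. \<forall>x. \<bar>x - v\<bar> < e \<longrightarrow> y x = 0"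
    and loc: "\<And>v. v \<in> H \<Longrightarrow> \<exists>e>0. \<forall>x. \<bar>x - v\<bar> < e \<longrightarrow> s x = s v"
    and R: "integrable lborel R" "\<And>v. R v \<ge> 0" "\<And>v. v \<in> H \<Longrightarrow> y' v \<noteq> 0 \<Longrightarrow> (flux_v u v - s v)\<^sup>2 \<le> R v"
  shows "(LINT v:{-M..M}|lborel. (y' v)\<^sup>2) \<ge> 2 * (LINT v:{-M..M}|lborel. flux_v u v * y' v) - (\<integral>v. R v \<partial>lborel)"
proof -
  have off': "\<exists>e>0. \<forall>x. \<bar>x - v\<bar> < e \<longrightarrow> y' x = 0" if vH: "v \<notin> H" for v
  proof -
    obtain e where e: "e > 0" "\<And>x. \<bar>x - v\<bar> < e \<Longrightarrow> y x = 0" using off[OF vH] by blast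
    have "y' x = 0" if "\<bar>x - v\<bar> < e" for x
    proof (rule DERIV_unique[OF y])
      show "(y has_real_derivative 0) (at x)"
      proof (rule has_field_derivative_transform_within_open[of "\<lambda>_. 0" _ _ "ball v e"])
        show "\<And>w. w \<in> ball v e \<Longrightarrow> 0 = y w" using e by (auto simp: dist_real_def abs_minus_commute)
      qed (use that in \<open>auto simp: dist_real_def abs_minus_commute\<close>)
    qed
    with e show ?thesis by auto
  qed
  have loc': "\<exists>e>0. \<forall>x\<in>ball v e. s x * y x = s v * y x \<and> s x * y' x = s v * y' x" for v
  proof (cases "v \<in> H")
    case True
    then obtain e where e: "e > 0" "\<And>x. \<bar>x - v\<bar> < e \<Longrightarrow> s x = s v" using loc by blast
    show ?thesis
    proof (intro exI[of _ e] conjI ballI e(1))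
      fix x assume "x \<in> ball v e"
      then have "s x = s v" by (intro e(2)) (simp add: dist_real_def abs_minus_commute)
      then show "s x * y x = s v * y x" "s x * y' x = s v * y' x" by (simp_all only:)
    qed
  next
    case False
    obtain e1 where "e1 > 0" "\<And>x. \<bar>x - v\<bar> < e1 \<Longrightarrow> y x = 0" using off[OF False] by blast
    moreover obtain e2 where "e2 > 0" "\<And>x. \<bar>x - v\<bar> < e2 \<Longrightarrow> y' x = 0" using off'[OF False] by blast
    ultimately show ?thesis by (intro exI[of _ "min e1 e2"]) (auto simp: dist_real_def abs_minus_commute)
  qed
  have d: "((\<lambda>x. s x * y x) has_real_derivative s v * y' v) (at v)" for v
  proof -
    obtain e where e: "e > 0" "\<forall>x\<in>ball v e. s x * y x = s v * y x"
      using loc'[of v] by blast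
    show ?thesis
      by (rule has_field_derivative_transform_within_open[OF DERIV_cmult[OF y] open_ball[of v e]])
        (simp add: e(1), rule sym, erule bspec[OF e(2)])
  qed
  have cs: "continuous_on A (\<lambda>x. s x * y' x)" for A
  proof -
    have "isCont (\<lambda>x. s x * y' x) v" for v
    proof -
      obtain e where e: "e > 0" "\<forall>x\<in>ball v e. s x * y' x = s v * y' x" using loc'[of v] by blast
      have "isCont (\<lambda>x. s v * y' x) v"
        using cy by (intro continuous_intros) (auto simp: continuous_on_eq_continuous_at)
      moreover have "\<forall>\<^sub>F x in nhds v. s x * y' x = s v * y' x"
        by (rule eventually_mono[OF eventually_nhds_in_open[OF open_ball] bspec[OF e(2)]]) (use e(1) in auto)
      ultimately show ?thesis by (simp only: isCont_cong)
    qed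
    then show ?thesis by (simp add: continuous_at_imp_continuous_on)
  qed
  have c1: "continuous_on A y'" for A using continuous_on_subset[OF cy] by auto
  have i1: "set_integrable lborel {-M..M} (\<lambda>v. (y' v)\<^sup>2)"
    "set_integrable lborel {-M..M} (\<lambda>v. flux_v u v * y' v)" "set_integrable lborel {-M..M} (\<lambda>v. s v * y' v)"
    by (intro borel_integrable_atLeastAtMost' continuous_intros continuous_flux_v u c1 cs)+
  have iR: "set_integrable lborel {-M..M} R"
    unfolding set_integrable_def by (rule integrable_mult_indicator[OF _ R(1)]) simp
  have zM: "y M = 0" "y (-M) = 0" using z[of M] z[of "-M"] M by simp_all
  have s0: "(LINT v:{-M..M}|lborel. s v * y' v) = 0"
    using M zM set_integral_FTC[of "-M" M "\<lambda>x. s x * y x", OF _ has_field_derivative_at_within[OF d] cs] by simp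
  have "2 * (LINT v:{-M..M}|lborel. flux_v u v * y' v) - (LINT v:{-M..M}|lborel. R v)
      = (LINT v:{-M..M}|lborel. (2 * (flux_v u v * y' v) - 2 * (s v * y' v)) - R v)"
    using i1 iR s0 by (simp add: set_integral_diff)
  also have "\<dots> \<le> (LINT v:{-M..M}|lborel. (y' v)\<^sup>2)"
  proof (intro set_integral_mono)
    fix v
    show "2 * (flux_v u v * y' v) - 2 * (s v * y' v) - R v \<le> (y' v)\<^sup>2"
    proof (cases "y' v = 0")
      case False
      have "v \<in> H"
      proof (rule ccontr)
        assume "v \<notin> H"
        then obtain e where "e > 0" "\<And>x. \<bar>x - v\<bar> < e \<Longrightarrow> y' x = 0" using off' by blast
        then show False using False by auto
      qed
      then have "(flux_v u v - s v)\<^sup>2 \<le> R v" using R(3) False by blast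
      moreover have "0 \<le> (y' v - (flux_v u v - s v))\<^sup>2" by simp
      ultimately show ?thesis by (simp add: power2_eq_square algebra_simps)
    qed (use R(2) in auto)
  qed (use i1 iR in auto)
  moreover have "(LINT v:{-M..M}|lborel. R v) \<le> (\<integral>v. R v \<partial>lborel)"
    unfolding set_lebesgue_integral_def
    by (intro integral_mono R(1) iR[unfolded set_integrable_def]) (simp add: R(2) split: split_indicator)
  ultimately show ?thesis by linarith
qed

section \<open>Short sections that leave the strip\<close>

lemma leaf_interval:
  fixes x :: real
  assumes "open H" and short: "\<And>a b. {a..b} \<subseteq> H \<Longrightarrow> b - a \<le> pi / 2"
  obtains a b where "a \<le> x" "x \<le> b" "a \<notin> H" "b \<notin> H" "{a<..<b} \<subseteq> H" "b - a \<le> pi / 2"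
proof -
  have cl: "closed (- H)" using assms(1) by (simp add: closed_def)
  define A where "A = - H \<inter> {..x}"
  define B where "B = - H \<inter> {x..}"
  \<comment> \<open>An interval of length 2 does not fit into \<open>H\<close>, so there are points
    off \<open>H\<close> on both sides of \<open>x\<close>; the nearest ones serve as
    \<open>a\<close> and \<open>b\<close>.\<close>
  have p: "pi / 2 < 2" using pi_less_4 by simp
  have "A \<noteq> {}" using short[of "x - 2" x] p by (fastforce simp: A_def)
  have "B \<noteq> {}" using short[of x "x + 2"] p by (fastforce simp: B_def)
  have "closed A" "closed B" unfolding A_def B_def by (intro closed_Int cl closed_atMost closed_atLeast)+
  have bA: "bdd_above A" and bB: "bdd_below B" by (auto simp: A_def B_def)
  define a b where "a = Sup A" and "b = Inf B"
  have "a \<in> A" unfolding a_def by (rule closed_contains_Sup) fact+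
  have "b \<in> B" unfolding b_def by (rule closed_contains_Inf) fact+
  have sub: "{a<..<b} \<subseteq> H"
  proof
    fix v assume v: "v \<in> {a<..<b}"
    show "v \<in> H"
    proof (rule ccontr)
      assume "v \<notin> H"
      then have "v \<in> A \<or> v \<in> B" by (auto simp: A_def B_def)
      then show False using v cSup_upper[OF _ bA, of v] cInf_lower[OF _ bB, of v] by (auto simp: a_def b_def)
    qed
  qed
  have "b - a \<le> pi / 2"
  proof (rule field_le_epsilon)
    fix e :: real assume "e > 0"
    then have "{a + e / 2..b - e / 2} \<subseteq> H" using sub by auto
    from short[OF this] show "b - a \<le> pi / 2 + e" by simp
  qed
  then show thesis using \<open>a \<in> A\<close> \<open>b \<in> B\<close> sub by (intro that[of a b]) (auto simp: A_def B_def)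
qed

lemma integral_indicator_Icc:
  fixes f :: "real \<Rightarrow> real"
  assumes "continuous_on {a..b} f"
  shows "integrable lborel (\<lambda>v. indicator {a..b} v * f v)"
    and "(\<integral>v. indicator {a..b} v * f v \<partial>lborel) = (LINT v:{a..b}|lborel. f v)"
  using borel_integrable_atLeastAtMost'[OF assms]
  by (simp_all add: set_integrable_def set_lebesgue_integral_def)

text \<open>Expanding the square of \<open>psi_v\<close> minus a constant leaves, besides the square
  of \<open>psi_v\<close>, such an affine integrand; its integral is explicit in the end values of
  \<open>psi\<close>.\<close>

lemma psi_v_affine_integral:
  assumes "u \<noteq> 0" "a \<le> b"
  shows "(LINT v:{a..b}|lborel. k + l * psi_v u v) = k * (b - a) + l * (psi u b - psi u a)"
proof -
  have "(LINT v:{a..b}|lborel. k + l * psi_v u v) = (k * b + l * psi u b) - (k * a + l * psi u a)"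
  proof (rule set_integral_FTC[OF assms(2)])
    fix x show "((\<lambda>v. k * v + l * psi u v) has_real_derivative k + l * psi_v u x) (at x within {a..b})"
      using DERIV_add[OF DERIV_cmult[OF DERIV_ident] DERIV_cmult[OF psi_has_derivative_v[OF assms(1)]]] by simp
  next
    show "continuous_on {a..b} (\<lambda>x. k + l * psi_v u x)" by (intro continuous_intros) (use assms in auto)
  qed
  then show ?thesis by (simp add: algebra_simps)
qed

text \<open>It shows that subtracting the edge flux between a cut point \<open>a\<close> and the
  strip edge costs nothing: the length \<open>pi / 4 - a\<close> is paid for by the value of
  \<open>psi\<close> at \<open>a\<close>. With \<open>x = pi / 2 - 2 * a\<close> the claim is
  \<open>x / 2 \<le> sin x\<close>, which the cubic Taylor bound gives.\<close>

lemma quarter_minus_le_cos: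
  assumes "0 \<le> a" "a \<le> pi / 4" shows "pi / 4 - a \<le> cos (2 * a)"
proof -
  define x where "x = pi / 2 - 2 * a"
  have x: "0 \<le> x" "x \<le> pi / 2" using assms by (auto simp: x_def)
  have "\<bar>sin x - x\<bar> \<le> inverse (fact 3) * \<bar>x\<bar> ^ 3"
    using Maclaurin_sin_bound[of x 3] by (simp add: numeral_3_eq_3 sin_coeff_def)
  then have "\<bar>sin x - x\<bar> \<le> x ^ 3 / 6" using x by (simp add: fact_numeral)
  then have "x - x ^ 3 / 6 \<le> sin x" by linarith
  moreover have "x ^ 3 \<le> 3 * x"
  proof -
    have "x\<^sup>2 \<le> (8 / 5)\<^sup>2" using x pi_approx(2) by (intro power_mono) auto
    then have "x\<^sup>2 \<le> 3" by (simp add: power2_eq_square)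
    from mult_right_mono[OF this x(1)] show ?thesis by (simp add: power3_eq_cube power2_eq_square)
  qed
  ultimately have "x / 2 \<le> sin x" by linarith
  then show ?thesis unfolding x_def by (simp add: sin_diff)
qed

text \<open>The balance of a section that overhangs the upper strip edge, divided by the square of
  the edge flux: \<open>e\<close> and \<open>- (1 + e) * sin (2 * e)\<close> come from the lower cut
  point, the third term is the price of the shift by \<open>e\<close> inside the strip, the last
  that of the mismatch \<open>1 - e\<close> on an overhang of length \<open>e\<close>. With shift 0
  the sum would be \<open>2 * e - sin (2 * e) > 0\<close>; a shift proportional to \<open>e\<close>
  makes the quadratic term negative.\<close>

lemma low_leaf_polynomial:
  assumes "0 \<le> e" "e \<le> pi / 4"
  shows "e - (1 + e) * sin (2 * e) + e\<^sup>2 * (pi / 2 - e) + (1 - e)\<^sup>2 * e \<le> 0"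
proof -
  have e: "e \<le> 4 / 5" using assms pi_approx(2) by simp
  have "\<bar>sin (2 * e) - 2 * e\<bar> \<le> inverse (fact 3) * \<bar>2 * e\<bar> ^ 3"
    using Maclaurin_sin_bound[of "2 * e" 3] by (simp add: numeral_3_eq_3 sin_coeff_def)
  then have "\<bar>sin (2 * e) - 2 * e\<bar> \<le> 4 / 3 * e ^ 3" using assms by (simp add: fact_numeral power_mult_distrib)
  then have "2 * e - 4 / 3 * e ^ 3 \<le> sin (2 * e)" by linarith
  from mult_left_mono[OF this, of "1 + e"] assms
  have "(1 + e) * (2 * e - 4 / 3 * e ^ 3) \<le> (1 + e) * sin (2 * e)" by simp
  then have 1: "2 * e + 2 * e\<^sup>2 - 4 / 3 * (e ^ 3 + e ^ 4) \<le> sin (2 * e) + e * sin (2 * e)"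
    by (simp add: algebra_simps add_divide_distrib power2_eq_square power3_eq_cube power4_eq_xxxx)
  have 2: "e\<^sup>2 * pi \<le> e\<^sup>2 * (16 / 5)" using pi_approx(2) by (intro mult_left_mono) auto
  have 3: "e ^ 3 + e ^ 4 \<le> 9 / 5 * e\<^sup>2"
  proof -
    have "e * e \<le> 4 / 5 * (4 / 5)" using e assms by (intro mult_mono) auto
    then have "e\<^sup>2 * (e + e * e) \<le> e\<^sup>2 * (9 / 5)" using e by (intro mult_left_mono) auto
    then show ?thesis by (simp add: power2_eq_square power3_eq_cube power4_eq_xxxx algebra_simps)
  qed
  have 4: "e - (1 + e) * sin (2 * e) + e\<^sup>2 * (pi / 2 - e) + (1 - e)\<^sup>2 * e
      = 2 * e - (sin (2 * e) + e * sin (2 * e)) + e\<^sup>2 * pi / 2 - 2 * e\<^sup>2"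
    by (simp add: power2_eq_square algebra_simps)
  have "2 * e - s + p / 2 - 2 * x \<le> 0"
    if "2 * e + 2 * x - 4 / 3 * q \<le> s" "p \<le> x * (16 / 5)" "q \<le> 9 / 5 * x" for s p q x :: real
    using that by linarith
  from this[OF 1 2 3] show ?thesis unfolding 4 .
qed

text \<open>The parameter \<open>s\<close> is a locally constant shift of the vertical flux on the section \<open>H\<close>;
  it redistributes the flux between the two ends of a component of \<open>H\<close> that leaves the strip.\<close>

lemma line_energy_centered:
  assumes u: "u \<noteq> 0" and M: "0 \<le> M"
    and y: "\<And>v. (y has_real_derivative y' v) (at v)" "continuous_on UNIV y'" "\<And>v. \<bar>v\<bar> \<ge> M \<Longrightarrow> y v = 0"
    and off: "\<And>v. v \<notin> H \<Longrightarrow> \<exists>e>0. \<forall>x. \<bar>x - v\<bar> < e \<longrightarrow> y x = 0"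
    and a: "a \<notin> H" "0 \<le> a" "a \<le> pi / 4" and d: "d \<notin> H" "- (pi / 4) \<le> d" "d \<le> 0"
  shows "(LINT v:{-M..M}|lborel. (y' v)\<^sup>2) \<ge> 2 * (LINT v:{-M..M}|lborel. flux_v u v * y' v)
    - (LINT v:{- (pi / 4)..pi / 4}|lborel. (psi_v u v)\<^sup>2)"
proof -
  define m where "m = 2 / cosh (2 * u)"
  \<comment> \<open>The flux beyond the strip edges is \<open>m\<close> and \<open>- m\<close>, so
    nothing is left outside the strip after the shift. The change is felt only on
    \<open>[a, pi / 4]\<close> and on \<open>[- (pi / 4), d]\<close>.\<close>
  define s where "s = (\<lambda>v. if v > a then m else if v < d then - m else 0)"
  define R where "R = (\<lambda>v. indicator {- (pi / 4)..pi / 4} v * (psi_v u v)\<^sup>2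
     + indicator {a..pi / 4} v * (m\<^sup>2 + (- (2 * m)) * psi_v u v)
     + indicator {- (pi / 4)..d} v * (m\<^sup>2 + (2 * m) * psi_v u v))"
  have m: "m \<ge> 0" by (simp add: m_def)
  have c1: "continuous_on A (\<lambda>v. (psi_v u v)\<^sup>2)" "continuous_on A (\<lambda>v. k + l * psi_v u v)" for A k l
    by (intro continuous_intros; use u in auto)+
  have iR: "integrable lborel R"
    unfolding R_def by (intro Bochner_Integration.integrable_add integral_indicator_Icc(1) c1)
  have "(\<integral>v. R v \<partial>lborel) = (LINT v:{- (pi / 4)..pi / 4}|lborel. (psi_v u v)\<^sup>2)
      + (LINT v:{a..pi / 4}|lborel. m\<^sup>2 + (- (2 * m)) * psi_v u v) + (LINT v:{- (pi / 4)..d}|lborel. m\<^sup>2 + (2 * m) * psi_v u v)"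
    unfolding R_def
    by (simp only: Bochner_Integration.integral_add Bochner_Integration.integrable_add
        integral_indicator_Icc[OF c1(1)] integral_indicator_Icc[OF c1(2)])
  also have "(LINT v:{a..pi / 4}|lborel. m\<^sup>2 + (- (2 * m)) * psi_v u v) = m\<^sup>2 * (pi / 4 - a) + 2 * m * psi u a"
    using a by (subst psi_v_affine_integral[OF u]) (auto simp: psi_quarter)
  also have "\<dots> \<le> 0"
  proof -
    have "2 * m * psi u a \<le> 2 * m * (- (cos (2 * a) / cosh (2 * u)))"
      using a u m by (intro mult_left_mono psi_le) auto
    also have "\<dots> = - (m\<^sup>2 * cos (2 * a))" by (simp add: m_def power2_eq_square)
    finally show ?thesis using mult_left_mono[OF quarter_minus_le_cos[OF a(2,3)], of "m\<^sup>2"] by simp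
  qed
  also have "(LINT v:{- (pi / 4)..d}|lborel. m\<^sup>2 + (2 * m) * psi_v u v) = m\<^sup>2 * (d + pi / 4) + 2 * m * psi u d"
    using d by (subst psi_v_affine_integral[OF u]) (auto simp: psi_quarter)
  also have "\<dots> \<le> 0"
  proof -
    have "2 * m * psi u d \<le> 2 * m * (- (cos (2 * d) / cosh (2 * u)))"
      using d u m by (intro mult_left_mono psi_le) auto
    also have "\<dots> = - (m\<^sup>2 * cos (2 * d))" by (simp add: m_def power2_eq_square)
    finally show ?thesis using mult_left_mono[OF quarter_minus_le_cos[of "- d"], of "m\<^sup>2"] d by (simp add: add.commute)
  qed
  finally have R0: "(\<integral>v. R v \<partial>lborel) \<le> (LINT v:{- (pi / 4)..pi / 4}|lborel. (psi_v u v)\<^sup>2)" by simp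
  have sq: "m\<^sup>2 + (- (2 * m)) * q + q\<^sup>2 = (q - m)\<^sup>2" "m\<^sup>2 + (2 * m) * q + q\<^sup>2 = (q + m)\<^sup>2" for q
    by (simp_all add: power2_eq_square algebra_simps)
  have Rin: "R v = (psi_v u v)\<^sup>2 + (if a \<le> v then m\<^sup>2 + (- (2 * m)) * psi_v u v else 0)
      + (if v \<le> d then m\<^sup>2 + (2 * m) * psi_v u v else 0)" if "- (pi / 4) \<le> v" "v \<le> pi / 4" for v
    using that by (simp add: R_def indicator_def)
  have Rout: "R v = 0" if "\<not> (- (pi / 4) \<le> v \<and> v \<le> pi / 4)" for v
    using that a d by (auto simp: R_def indicator_def)
  have "(LINT v:{-M..M}|lborel. (y' v)\<^sup>2) \<ge> 2 * (LINT v:{-M..M}|lborel. flux_v u v * y' v) - (\<integral>v. R v \<partial>lborel)"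
  proof (rule line_test[where H=H and s=s, OF u y M off _ iR])
    fix v assume "v \<in> H"
    then have "v \<noteq> a" "v \<noteq> d" using a d by auto
    then show "\<exists>e>0. \<forall>x. \<bar>x - v\<bar> < e \<longrightarrow> s x = s v"
      by (intro exI[of _ "min \<bar>v - a\<bar> \<bar>v - d\<bar>"]) (auto simp: s_def)
  next
    fix v show "R v \<ge> 0"
    proof (cases "- (pi / 4) \<le> v \<and> v \<le> pi / 4")
      case True
      have p: "0 \<le> (psi_v u v)\<^sup>2 + (m\<^sup>2 + (- (2 * m)) * psi_v u v)" "0 \<le> (psi_v u v)\<^sup>2 + (m\<^sup>2 + (2 * m) * psi_v u v)"
        unfolding add.commute[of "(psi_v u v)\<^sup>2"] sq by simp_all
      show ?thesis unfolding Rin[OF conjunct1[OF True] conjunct2[OF True]]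
      proof -
        have "0 \<le> q + (if a \<le> v then k else 0) + (if v \<le> d then l else 0)"
          if "0 \<le> q + k" "0 \<le> q + l" "0 \<le> q + k + l" "0 \<le> q" for q k l :: real
          using that by auto
        from this[OF p] show "0 \<le> (psi_v u v)\<^sup>2 + (if a \<le> v then m\<^sup>2 + (- (2 * m)) * psi_v u v else 0)
            + (if v \<le> d then m\<^sup>2 + (2 * m) * psi_v u v else 0)" by simp
      qed
    qed (use Rout in auto)
  next
    fix v assume v: "v \<in> H" "y' v \<noteq> 0"
    then have ne: "v \<noteq> a" "v \<noteq> d" using a d by auto
    consider "v > pi / 4" | "v < - (pi / 4)" | "- (pi / 4) \<le> v" "v \<le> pi / 4" by linarith
    then show "(flux_v u v - s v)\<^sup>2 \<le> R v"
    proof cases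
      case 1
      then show ?thesis using a Rout[of v] flux_v_outside(1)[OF u, of v] by (simp add: s_def m_def)
    next
      case 2
      then show ?thesis using a d Rout[of v] flux_v_outside(2)[OF u, of v] by (simp add: s_def m_def)
    next
      case 3
      then have "flux_v u v = psi_v u v" by (simp add: flux_v_def)
      then show ?thesis using Rin[OF 3] ne a d sq[of "psi_v u v"] by (auto simp: s_def split: if_splits)
    qed
  qed
  with R0 show ?thesis by linarith
qed

text \<open>The points \<open>a\<close> and \<open>b\<close> bracket the upper strip edge, with
  \<open>a\<close> on or below the real axis. The bound on \<open>b - a\<close> forces
  \<open>a\<close> into the strip, at distance \<open>e\<close> from its lower edge, and limits the
  overhang above \<open>pi / 4\<close> to \<open>e\<close>. The mismatch between the edge flux and
  the shift on the overhang is balanced against the price of the shift inside the strip.\<close>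

lemma line_energy_low:
  assumes u: "u \<noteq> 0" and M: "0 \<le> M"
    and y: "\<And>v. (y has_real_derivative y' v) (at v)" "continuous_on UNIV y'" "\<And>v. \<bar>v\<bar> \<ge> M \<Longrightarrow> y v = 0"
    and off: "\<And>v. v \<notin> H \<Longrightarrow> \<exists>e>0. \<forall>x. \<bar>x - v\<bar> < e \<longrightarrow> y x = 0"
    and a: "a \<notin> H" "a \<le> 0" and b: "b \<notin> H" "pi / 4 \<le> b" "b - a \<le> pi / 2"
  shows "(LINT v:{-M..M}|lborel. (y' v)\<^sup>2) \<ge> 2 * (LINT v:{-M..M}|lborel. flux_v u v * y' v)
    - (LINT v:{- (pi / 4)..pi / 4}|lborel. (psi_v u v)\<^sup>2)"
proof -
  define m where "m = 2 / cosh (2 * u)"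
  define e where "e = a + pi / 4"
  have e: "0 \<le> e" "e \<le> pi / 4" using a b by (auto simp: e_def)
  have a': "- (pi / 4) \<le> a" "a \<le> pi / 4" using e a by (auto simp: e_def)
  \<comment> \<open>Below \<open>a\<close> and above \<open>b\<close> the shift cancels the constant
    outer flux. Between them \<open>e * m\<close> leaves \<open>(1 - e) * m\<close> on the overhang
    \<open>[pi / 4, b]\<close>.\<close>
  define s where "s = (\<lambda>v. if v < a then - m else if v < b then e * m else m)"
  define R where "R = (\<lambda>v. indicator {- (pi / 4)..pi / 4} v * (psi_v u v)\<^sup>2
     + indicator {a..pi / 4} v * ((e * m)\<^sup>2 + (- (2 * (e * m))) * psi_v u v)
     + indicator {- (pi / 4)..a} v * (m\<^sup>2 + (2 * m) * psi_v u v)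
     + indicator {pi / 4..b} v * ((1 - e) * m)\<^sup>2)"
  have m: "m \<ge> 0" by (simp add: m_def)
  have c1: "continuous_on A (\<lambda>v. (psi_v u v)\<^sup>2)" "continuous_on A (\<lambda>v. k + l * psi_v u v)" "continuous_on A (\<lambda>v::real. k)" for A k l
    by (intro continuous_intros; use u in auto)+
  have iR: "integrable lborel R"
    unfolding R_def by (intro Bochner_Integration.integrable_add integral_indicator_Icc(1) c1)
  have "(\<integral>v. R v \<partial>lborel) = (LINT v:{- (pi / 4)..pi / 4}|lborel. (psi_v u v)\<^sup>2)
      + (LINT v:{a..pi / 4}|lborel. (e * m)\<^sup>2 + (- (2 * (e * m))) * psi_v u v) + (LINT v:{- (pi / 4)..a}|lborel. m\<^sup>2 + (2 * m) * psi_v u v)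
      + (LINT v:{pi / 4..b}|lborel. ((1 - e) * m)\<^sup>2)"
    unfolding R_def
    by (simp only: Bochner_Integration.integral_add Bochner_Integration.integrable_add
        integral_indicator_Icc[OF c1(1)] integral_indicator_Icc[OF c1(2)] integral_indicator_Icc[OF c1(3)])
  also have "(LINT v:{a..pi / 4}|lborel. (e * m)\<^sup>2 + (- (2 * (e * m))) * psi_v u v) = (e * m)\<^sup>2 * (pi / 4 - a) + 2 * (e * m) * psi u a"
    using a' by (subst psi_v_affine_integral[OF u]) (auto simp: psi_quarter)
  also have "(LINT v:{- (pi / 4)..a}|lborel. m\<^sup>2 + (2 * m) * psi_v u v) = m\<^sup>2 * e + 2 * m * psi u a"
    using a' by (subst psi_v_affine_integral[OF u]) (auto simp: psi_quarter e_def)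
  also have "(LINT v:{pi / 4..b}|lborel. ((1 - e) * m)\<^sup>2) = ((1 - e) * m)\<^sup>2 * (b - pi / 4)"
    using b by (simp add: set_lebesgue_integral_def)
  also have "(LINT v:{- (pi / 4)..pi / 4}|lborel. (psi_v u v)\<^sup>2) + ((e * m)\<^sup>2 * (pi / 4 - a) + 2 * (e * m) * psi u a)
      + (m\<^sup>2 * e + 2 * m * psi u a) + ((1 - e) * m)\<^sup>2 * (b - pi / 4) \<le> (LINT v:{- (pi / 4)..pi / 4}|lborel. (psi_v u v)\<^sup>2)"
  proof -
    have "2 * m * (1 + e) * psi u a \<le> 2 * m * (1 + e) * (- (cos (2 * a) / cosh (2 * u)))"
      using a' e u m by (intro mult_left_mono psi_le) auto
    also have "\<dots> = - (m\<^sup>2 * ((1 + e) * sin (2 * e)))"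
    proof -
      have "sin (2 * e) = cos (2 * a)" by (simp add: e_def distrib_left sin_add)
      moreover have m2: "cos (2 * a) / cosh (2 * u) = m * cos (2 * a) / 2" by (simp add: m_def)
      ultimately show ?thesis unfolding m2 by (simp add: power2_eq_square)
    qed
    finally have 1: "2 * m * (1 + e) * psi u a \<le> - (m\<^sup>2 * ((1 + e) * sin (2 * e)))" .
    have "((1 - e) * m)\<^sup>2 * (b - pi / 4) \<le> ((1 - e) * m)\<^sup>2 * e"
      using b by (intro mult_left_mono) (auto simp: e_def)
    moreover have "m\<^sup>2 * (e - (1 + e) * sin (2 * e) + e\<^sup>2 * (pi / 2 - e) + (1 - e)\<^sup>2 * e) \<le> 0"
      by (intro mult_nonneg_nonpos low_leaf_polynomial e) simp
    then have "m\<^sup>2 * e - m\<^sup>2 * ((1 + e) * sin (2 * e)) + m\<^sup>2 * (e\<^sup>2 * (pi / 2 - e)) + m\<^sup>2 * ((1 - e)\<^sup>2 * e) \<le> 0"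
      by (simp only: distrib_left right_diff_distrib)
    moreover have "(e * m)\<^sup>2 * (pi / 4 - a) = m\<^sup>2 * (e\<^sup>2 * (pi / 2 - e))" "((1 - e) * m)\<^sup>2 * e = m\<^sup>2 * ((1 - e)\<^sup>2 * e)"
      by (simp_all add: e_def power_mult_distrib)
    moreover have "2 * (e * m) * psi u a + 2 * m * psi u a = 2 * m * (1 + e) * psi u a" by (simp add: algebra_simps)
    ultimately show ?thesis using 1 by linarith
  qed
  finally have R0: "(\<integral>v. R v \<partial>lborel) \<le> (LINT v:{- (pi / 4)..pi / 4}|lborel. (psi_v u v)\<^sup>2)" .
  have sq': "q\<^sup>2 + ((e * m)\<^sup>2 + (- (2 * (e * m))) * q) = (q - e * m)\<^sup>2"
    "q\<^sup>2 + (m\<^sup>2 + (2 * m) * q) = (q + m)\<^sup>2" for q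
    by (simp_all add: power2_eq_square algebra_simps)
  have Rin: "R v = (psi_v u v)\<^sup>2 + (if a \<le> v then (e * m)\<^sup>2 + (- (2 * (e * m))) * psi_v u v else 0)
      + (if v \<le> a then m\<^sup>2 + (2 * m) * psi_v u v else 0) + (if v = pi / 4 then ((1 - e) * m)\<^sup>2 else 0)"
    if "- (pi / 4) \<le> v" "v \<le> pi / 4" for v
    using that b by (auto simp: R_def indicator_def)
  have Rup: "R v = (if v \<le> b then ((1 - e) * m)\<^sup>2 else 0)" if "v > pi / 4" for v
    using that a' by (auto simp: R_def indicator_def)
  have Rlow: "R v = 0" if "v < - (pi / 4)" for v
    using that a' by (auto simp: R_def indicator_def)
  have "(LINT v:{-M..M}|lborel. (y' v)\<^sup>2) \<ge> 2 * (LINT v:{-M..M}|lborel. flux_v u v * y' v) - (\<integral>v. R v \<partial>lborel)"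
  proof (rule line_test[where H=H and s=s, OF u y M off _ iR])
    fix v assume "v \<in> H"
    then have "v \<noteq> a" "v \<noteq> b" using a b by auto
    then show "\<exists>e>0. \<forall>x. \<bar>x - v\<bar> < e \<longrightarrow> s x = s v"
      by (intro exI[of _ "min \<bar>v - a\<bar> \<bar>v - b\<bar>"]) (auto simp: s_def)
  next
    fix v show "R v \<ge> 0"
    proof -
      have *: "0 \<le> (psi_v u v)\<^sup>2" "0 \<le> (psi_v u v - e * m)\<^sup>2" "0 \<le> (psi_v u v + m)\<^sup>2" "0 \<le> m\<^sup>2"
        "0 \<le> ((1 - e) * m)\<^sup>2" "0 \<le> (e * m)\<^sup>2" by simp_all
      consider "v > pi / 4" | "v < - (pi / 4)" | "- (pi / 4) \<le> v" "v \<le> pi / 4" by linarith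
      then show ?thesis
      proof cases
        case 3
        have "0 \<le> (psi_v u v)\<^sup>2 + (if a \<le> v then (e * m)\<^sup>2 + (- (2 * (e * m))) * psi_v u v else 0)
          + (if v \<le> a then m\<^sup>2 + (2 * m) * psi_v u v else 0)"
        proof (cases "v = a")
          \<comment> \<open>At the common end point \<open>a\<close> both indicators contribute and
            no single perfect square appears; the sign of \<open>psi_v\<close> there takes its
            place.\<close>
          case True
          have "sin (2 * a) \<le> 0" using a a' sin_ge_zero[of "- (2 * a)"] by simp
          then have "psi_v u v \<le> 0"
            using strip_den_pos[OF u, of a] True by (auto simp: psi_v_def divide_le_0_iff mult_le_0_iff)
          then have "e * m * psi_v u v \<le> 0" using e m by (intro mult_nonneg_nonpos) auto
          moreover have "(psi_v u v)\<^sup>2 + (m\<^sup>2 + (2 * m) * psi_v u v) \<ge> 0"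
          proof -
            have "(psi_v u v)\<^sup>2 + (m\<^sup>2 + (2 * m) * psi_v u v) = (psi_v u v + m)\<^sup>2"
              by (simp add: power2_eq_square algebra_simps)
            then show ?thesis by simp
          qed
          ultimately have "0 \<le> (psi_v u v)\<^sup>2 + ((e * m)\<^sup>2 + (- (2 * (e * m))) * psi_v u v) + (m\<^sup>2 + (2 * m) * psi_v u v)"
          proof -
            have eq: "(- (2 * (e * m))) * psi_v u v = - (2 * (e * m * psi_v u v))" by simp
            show "e * m * psi_v u v \<le> 0 \<Longrightarrow> 0 \<le> (psi_v u v)\<^sup>2 + (m\<^sup>2 + (2 * m) * psi_v u v) \<Longrightarrow> ?thesis"
              unfolding eq using *(6) by linarith
          qed
          then show ?thesis using True by simp
        next
          case False
          from False have "a \<le> v \<and> \<not> v \<le> a \<or> v \<le> a \<and> \<not> a \<le> v" by linarith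
          then show ?thesis
            by (elim disjE conjE) (simp_all only: if_True if_False add_0_right sq' zero_le_power2)
        qed
        then show ?thesis using Rin[OF 3] * by simp
      qed (use Rup Rlow * in auto)
    qed
  next
    fix v assume v: "v \<in> H" "y' v \<noteq> 0"
    then have ne: "v \<noteq> a" "v \<noteq> b" using a b by auto
    consider "v > pi / 4" | "v < - (pi / 4)" | "- (pi / 4) \<le> v" "v \<le> pi / 4" by linarith
    then show "(flux_v u v - s v)\<^sup>2 \<le> R v"
    proof cases
      case 1
      have "m - e * m = (1 - e) * m" by (simp add: algebra_simps)
      have fl: "flux_v u v = m" using 1 flux_v_outside(1)[OF u, of v] by (simp add: m_def)
      have av: "\<not> v < a" using 1 a' by linarith
      show ?thesis
      proof (cases "v < b")
        case True
        then show ?thesis using fl av Rup[OF 1] \<open>m - e * m = (1 - e) * m\<close> by (simp add: s_def)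
      next
        case False
        then show ?thesis using fl av Rup[OF 1] ne by (simp add: s_def)
      qed
    next
      case 2
      then show ?thesis using a' Rlow[of v] flux_v_outside(2)[OF u, of v] by (simp add: s_def m_def)
    next
      case 3
      then have "flux_v u v = psi_v u v" by (simp add: flux_v_def)
      moreover have "(psi_v u v - s v)\<^sup>2 \<le> R v"
      proof (cases "v < a")
        case True
        then have "\<not> a \<le> v" "v \<le> a" "v \<noteq> pi / 4" "s v = - m" using a' by (auto simp: s_def)
        then show ?thesis unfolding Rin[OF 3] by (simp only: if_True if_False add_0_right sq') simp
      next
        case False
        with ne 3 b have av: "a \<le> v" "\<not> v \<le> a" "v < b" by linarith+
        then have "s v = e * m" by (simp add: s_def)
        then show ?thesis unfolding Rin[OF 3] using av by (simp only: if_True if_False add_0_right sq') simp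
      qed
      ultimately show ?thesis by simp
    qed
  qed
  with R0 show ?thesis by linarith
qed

lemma set_integral_Icc_reflect:
  fixes f :: "real \<Rightarrow> real"
  shows "(LINT v:{-M..M}|lborel. f (- v)) = (LINT v:{-M..M}|lborel. f v)"
proof -
  have "(LINT v:{-M..M}|lborel. f v) = (\<integral>v. indicator {-M..M} (- v) * f (- v) \<partial>lborel)"
    unfolding set_lebesgue_integral_def
    using lborel_integral_real_affine[of "-1" "\<lambda>v. indicator {-M..M} v * f v" 0] by simp
  also have "\<dots> = (LINT v:{-M..M}|lborel. f (- v))"
    unfolding set_lebesgue_integral_def by (intro Bochner_Integration.integral_cong) (auto simp: indicator_def)
  finally show ?thesis ..
qed

lemma flux_v_minus: "flux_v u (- v) = - flux_v u v"
proof -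
  consider "v > pi / 4" "\<not> v < - (pi / 4)" | "v < - (pi / 4)" "\<not> v > pi / 4" | "- (pi / 4) \<le> v" "v \<le> pi / 4"
    using pi_gt_zero by linarith
  then show ?thesis by cases (simp_all add: flux_v_def psi_v_def strip_den_def minus_less_iff less_minus_iff)
qed

text \<open>The gaps of \<open>H\<close> next to the two strip edges decide. If the interval around
  the upper edge reaches down to the real axis, or the one around the lower edge reaches up to it,
  the one-sided estimate applies, in the second case after a reflection. Otherwise the upper and the
  lower half of the strip section each contain a point off \<open>H\<close>, and the symmetric
  estimate applies.\<close>

lemma line_energy:
  assumes u: "u \<noteq> 0" and M: "0 \<le> M"
    and y: "\<And>v. (y has_real_derivative y' v) (at v)" "continuous_on UNIV y'" "\<And>v. \<bar>v\<bar> \<ge> M \<Longrightarrow> y v = 0"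
    and off: "\<And>v. v \<notin> H \<Longrightarrow> \<exists>e>0. \<forall>x. \<bar>x - v\<bar> < e \<longrightarrow> y x = 0"
    and H: "open H" and short: "\<And>a b. {a..b} \<subseteq> H \<Longrightarrow> b - a \<le> pi / 2"
  shows "(LINT v:{-M..M}|lborel. (y' v)\<^sup>2) \<ge> 2 * (LINT v:{-M..M}|lborel. flux_v u v * y' v)
    - (LINT v:{- (pi / 4)..pi / 4}|lborel. (psi_v u v)\<^sup>2)"
proof -
  obtain a b where ab: "a \<le> pi / 4" "pi / 4 \<le> b" "a \<notin> H" "b \<notin> H" "b - a \<le> pi / 2"
    using leaf_interval[OF H short] by metis
  obtain c d where cd: "c \<le> - (pi / 4)" "- (pi / 4) \<le> d" "c \<notin> H" "d \<notin> H" "d - c \<le> pi / 2"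
    using leaf_interval[OF H short] by metis
  consider "a \<le> 0" | "d \<ge> 0" | "0 \<le> a" "d \<le> 0" by linarith
  then show ?thesis
  proof cases
    case 1
    then show ?thesis using line_energy_low[OF u M y off, of H a b] ab by blast
  next
    case 2
    define H' where "H' = {v. - v \<in> H}"
    have "(LINT v:{-M..M}|lborel. (- y' (- v))\<^sup>2) \<ge> 2 * (LINT v:{-M..M}|lborel. flux_v u v * - y' (- v))
      - (LINT v:{- (pi / 4)..pi / 4}|lborel. (psi_v u v)\<^sup>2)"
    proof (rule line_energy_low[where H=H' and a="- d" and b="- c" and y="\<lambda>v. y (- v)", OF u M])
      show "((\<lambda>v. y (- v)) has_real_derivative - y' (- v)) (at v)" for v
        using DERIV_chain2[OF y(1) DERIV_minus[OF DERIV_ident], of v UNIV] by simp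
      show "continuous_on UNIV (\<lambda>v. - y' (- v))"
        by (intro continuous_intros continuous_on_compose2[OF y(2)]) auto
      show "M \<le> \<bar>v\<bar> \<Longrightarrow> y (- v) = 0" for v using y(3) by simp
      show "\<exists>e>0. \<forall>x. \<bar>x - v\<bar> < e \<longrightarrow> y (- x) = 0" if v: "v \<notin> H'" for v
      proof -
        obtain e where e: "e > 0" "\<And>x. \<bar>x - (- v)\<bar> < e \<Longrightarrow> y x = 0" using off[of "- v"] v by (auto simp: H'_def)
        then have "y (- x) = 0" if "\<bar>x - v\<bar> < e" for x using that by (intro e(2)) linarith
        with e(1) show ?thesis by blast
      qed
    qed (use cd 2 in \<open>auto simp: H'_def\<close>)
    moreover have "(LINT v:{-M..M}|lborel. flux_v u v * - y' (- v)) = (LINT v:{-M..M}|lborel. flux_v u v * y' v)"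
      using set_integral_Icc_reflect[of M "\<lambda>v. flux_v u v * y' v"] by (simp add: flux_v_minus)
    moreover have "(LINT v:{-M..M}|lborel. (- y' (- v))\<^sup>2) = (LINT v:{-M..M}|lborel. (y' v)\<^sup>2)"
      using set_integral_Icc_reflect[of M "\<lambda>v. (y' v)\<^sup>2"] by simp
    ultimately show ?thesis by simp
  next
    case 3
    then show ?thesis using line_energy_centered[OF u M y off, of H a d] ab cd by blast
  qed
qed

text \<open>Near the pole the weight \<open>phi\<close> cuts off the energy of the strip; there a bounded loss is affordable.\<close>

lemma line_energy_cutoff:
  assumes u: "u \<noteq> 0" and M: "0 \<le> M"
    and y: "\<And>v. (y has_real_derivative y' v) (at v)" "continuous_on UNIV y'" "\<And>v. \<bar>v\<bar> \<ge> M \<Longrightarrow> y v = 0"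
    and off: "\<And>v. v \<notin> H \<Longrightarrow> \<exists>e>0. \<forall>x. \<bar>x - v\<bar> < e \<longrightarrow> y x = 0"
    and H: "open H" and short: "\<And>a b. {a..b} \<subseteq> H \<Longrightarrow> b - a \<le> pi / 2"
    and phi: "continuous_on UNIV phi" "\<And>v. v \<in> H \<Longrightarrow> \<bar>v\<bar> \<le> pi / 4 \<Longrightarrow> y' v \<noteq> 0 \<Longrightarrow> phi v = 1"
  shows "(LINT v:{-M..M}|lborel. (y' v)\<^sup>2) \<ge> 2 * (LINT v:{-M..M}|lborel. flux_v u v * y' v)
    - (LINT v:{- (pi / 4)..pi / 4}|lborel. (phi v)\<^sup>2 * (psi_v u v)\<^sup>2) - 4 * pi"
proof -
  obtain a b where ab: "a \<le> pi / 4" "pi / 4 \<le> b" "a \<notin> H" "b \<notin> H" "b - a \<le> pi / 2"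
    using leaf_interval[OF H short] by metis
  obtain c d where cd: "c \<le> - (pi / 4)" "- (pi / 4) \<le> d" "c \<notin> H" "d \<notin> H" "d - c \<le> pi / 2"
    using leaf_interval[OF H short] by metis
  define m where "m = 2 / cosh (2 * u)"
  have m: "0 \<le> m" "m \<le> 2" using cosh_real_ge_1[of "2 * u"] by (auto simp: m_def field_simps)
  \<comment> \<open>Here \<open>s\<close> is 0 on the whole strip section, where the cut-off square
    leaves no room for a shift. On the overhangs, each of length at most \<open>pi / 2\<close>, the
    flux of size at most 2 stays as it is, which costs at most \<open>2 * pi\<close> per
    side.\<close>
  define s where "s = (\<lambda>v. if v > b then m else if v < c then - m else 0)"
  define R where "R = (\<lambda>v. indicator {- (pi / 4)..pi / 4} v * ((phi v)\<^sup>2 * (psi_v u v)\<^sup>2)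
     + indicator {pi / 4..b} v * m\<^sup>2 + indicator {c..- (pi / 4)} v * m\<^sup>2)"
  have c1: "continuous_on A (\<lambda>v. (phi v)\<^sup>2 * (psi_v u v)\<^sup>2)" "continuous_on A (\<lambda>v::real. k)" for A k
    by (intro continuous_intros continuous_on_subset[OF phi(1)]; use u in auto)+
  have iR: "integrable lborel R"
    unfolding R_def by (intro Bochner_Integration.integrable_add integral_indicator_Icc(1) c1)
  have "(\<integral>v. R v \<partial>lborel) = (LINT v:{- (pi / 4)..pi / 4}|lborel. (phi v)\<^sup>2 * (psi_v u v)\<^sup>2)
      + (LINT v:{pi / 4..b}|lborel. m\<^sup>2) + (LINT v:{c..- (pi / 4)}|lborel. m\<^sup>2)"
    unfolding R_def
    by (simp only: Bochner_Integration.integral_add Bochner_Integration.integrable_add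
        integral_indicator_Icc[OF c1(1)] integral_indicator_Icc[OF c1(2)])
  also have "\<dots> \<le> (LINT v:{- (pi / 4)..pi / 4}|lborel. (phi v)\<^sup>2 * (psi_v u v)\<^sup>2) + 4 * (pi / 2) + 4 * (pi / 2)"
  proof (intro add_mono order_refl)
    have m4: "m\<^sup>2 \<le> 4" using power_mono[OF m(2,1), of 2] by simp
    have "(LINT v:{pi / 4..b}|lborel. m\<^sup>2) = m\<^sup>2 * (b - pi / 4)"
      using ab by (simp add: set_lebesgue_integral_def)
    also have "\<dots> \<le> 4 * (pi / 2)" using ab m4 by (intro mult_mono) auto
    finally show "(LINT v:{pi / 4..b}|lborel. m\<^sup>2) \<le> 4 * (pi / 2)" .
    have "(LINT v:{c..- (pi / 4)}|lborel. m\<^sup>2) = m\<^sup>2 * (- (pi / 4) - c)"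
      using cd by (simp add: set_lebesgue_integral_def)
    also have "\<dots> \<le> 4 * (pi / 2)" using cd m4 by (intro mult_mono) auto
    finally show "(LINT v:{c..- (pi / 4)}|lborel. m\<^sup>2) \<le> 4 * (pi / 2)" .
  qed
  finally have R0: "(\<integral>v. R v \<partial>lborel) \<le> (LINT v:{- (pi / 4)..pi / 4}|lborel. (phi v)\<^sup>2 * (psi_v u v)\<^sup>2) + 4 * pi"
    by simp
  have Rpos: "R v \<ge> 0" for v by (auto simp: R_def indicator_def)
  have "(LINT v:{-M..M}|lborel. (y' v)\<^sup>2) \<ge> 2 * (LINT v:{-M..M}|lborel. flux_v u v * y' v) - (\<integral>v. R v \<partial>lborel)"
  proof (rule line_test[where H=H and s=s, OF u y M off _ iR])
    fix v assume "v \<in> H"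
    then have "v \<noteq> b" "v \<noteq> c" using ab cd by auto
    then show "\<exists>e>0. \<forall>x. \<bar>x - v\<bar> < e \<longrightarrow> s x = s v"
      by (intro exI[of _ "min \<bar>v - b\<bar> \<bar>v - c\<bar>"]) (auto simp: s_def)
  next
    fix v show "R v \<ge> 0" by (rule Rpos)
  next
    fix v assume v: "v \<in> H" "y' v \<noteq> 0"
    then have ne: "v \<noteq> b" "v \<noteq> c" using ab cd by auto
    have pos: "pi > 0" by simp
    consider "v > b" | "v < c" | "pi / 4 < v" "v < b" | "c < v" "v < - (pi / 4)" | "- (pi / 4) \<le> v" "v \<le> pi / 4"
      using ne by linarith
    then show "(flux_v u v - s v)\<^sup>2 \<le> R v"
    proof cases
      case 1
      then have "flux_v u v = m" using ab flux_v_outside(1)[OF u, of v] by (simp add: m_def)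
      then show ?thesis using 1 Rpos[of v] by (simp add: s_def)
    next
      case 2
      then have "\<not> v > b" using ab cd pos by linarith
      moreover have "flux_v u v = - m" using 2 cd flux_v_outside(2)[OF u, of v] by (simp add: m_def)
      ultimately show ?thesis using 2 Rpos[of v] by (simp add: s_def)
    next
      case 3
      then have "\<not> v < c" using cd pos by linarith
      moreover have "flux_v u v = m" using 3 flux_v_outside(1)[OF u, of v] by (simp add: m_def)
      ultimately show ?thesis using 3 by (auto simp: s_def R_def indicator_def)
    next
      case 4
      then have "\<not> v > b" using ab pos by linarith
      moreover have "flux_v u v = - m" using 4 flux_v_outside(2)[OF u, of v] by (simp add: m_def)
      ultimately show ?thesis using 4 by (auto simp: s_def R_def indicator_def)
    next
      case 5
      then have "\<not> v > b" "\<not> v < c" using ab cd by linarith+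
      moreover have "flux_v u v = psi_v u v" using 5 by (simp add: flux_v_def)
      moreover have "phi v = 1" using phi(2) v 5 by simp
      ultimately show ?thesis using 5 by (auto simp: s_def R_def indicator_def)
    qed
  qed
  with R0 show ?thesis by linarith
qed

subsection \<open>The inequality on a horizontal line\<close>

text \<open>Moving to the right one leaves \<open>G\<close> only together with \<open>D\<close>, where \<open>F\<close> vanishes, but \<open>G\<close> may be
  entered anywhere inside \<open>D\<close>. Since \<open>F \<le> 0\<close>, the jumps at the entrances have a favourable sign.\<close>

lemma right_closed_parts:
  fixes F F' :: "real \<Rightarrow> real"
  assumes ab: "0 < a" "a \<le> b" and F: "\<And>x. 0 < x \<Longrightarrow> (F has_real_derivative F' x) (at x)"
    and cF: "continuous_on {0<..} F'" "F' \<in> borel_measurable borel"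
    and neg: "\<And>x. 0 < x \<Longrightarrow> F x \<le> 0"
    and off: "\<And>x. x \<notin> D \<Longrightarrow> \<exists>e>0. \<forall>y. \<bar>y - x\<bar> < e \<longrightarrow> F y = 0"
    and D: "open D" and G: "open G" "G \<subseteq> D"
    and right: "\<And>x y. x \<in> G \<Longrightarrow> x \<le> y \<Longrightarrow> {x..y} \<subseteq> D \<Longrightarrow> y \<in> G"
  shows "indicator G b * F b - indicator G a * F a \<le> (LINT x:{a..b}|lborel. indicator G x * F' x)"
proof -
  have Fw: "(F has_real_derivative F' x) (at x within A)" if "0 < x" for x A
    using F[OF that] by (rule has_field_derivative_at_within)
  have cF': "continuous_on {p..q} F'" if "0 < p" for p q
    by (rule continuous_on_subset[OF cF(1)]) (use that in auto)
  have [measurable]: "F' \<in> borel_measurable borel" "G \<in> sets borel"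
    using cF G by auto
  have int: "set_integrable lborel {p..q} (\<lambda>x. indicator G x * F' x)" if "0 < p" for p q
  proof -
    have "set_integrable lborel {p..q} F'" by (intro borel_integrable_atLeastAtMost' cF' that)
    then show ?thesis unfolding set_integrable_def
      by (rule Bochner_Integration.integrable_bound) (auto split: split_indicator)
  qed
  define P where "P = (\<lambda>p q. 0 < p \<and> p \<le> q \<longrightarrow> indicator G q * F q - indicator G p * F p
      \<le> (LINT x:{p..q}|lborel. indicator G x * F' x))"
  \<comment> \<open>The inequality is additive over adjacent intervals, so it is enough to have it
    on short intervals around each point.\<close>
  have "P a b" using ab(2)
  proof (induction rule: Bolzano)
    case (trans p q r)
    then show ?case using set_integral_Icc_split[of p q r, OF _ _ int] by (auto simp: P_def)
  next
    case (local x)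
    show ?case
    proof (cases "x \<in> D")
      case False
      then obtain e where e: "e > 0" "\<And>y. \<bar>y - x\<bar> < e \<Longrightarrow> F y = 0" using off by blast
      have F0: "F' y = 0" if "\<bar>y - x\<bar> < e" "0 < y" for y
      proof (rule DERIV_unique[OF F[OF that(2)]])
        show "(F has_real_derivative 0) (at y)"
        proof (rule has_field_derivative_transform_within_open[of "\<lambda>_. 0" _ _ "ball x e"])
          show "\<And>w. w \<in> ball x e \<Longrightarrow> 0 = F w" using e by (auto simp: dist_real_def abs_minus_commute)
        qed (use that in \<open>auto simp: dist_real_def abs_minus_commute\<close>)
      qed
      have "P p q" if "p \<le> x" "x \<le> q" "q - p < e" for p q
      proof (cases "0 < p")
        case True
        have "(LINT y:{p..q}|lborel. indicator G y * F' y) = (LINT y:{p..q}|lborel. 0)"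
          by (intro set_lebesgue_integral_cong) (use that True in \<open>auto intro!: F0\<close>)
        moreover have "F p = 0" "F q = 0" using that by (auto intro!: e(2))
        ultimately show ?thesis by (simp add: P_def)
      qed (simp add: P_def)
      with e(1) show ?thesis by blast
    next
      case True
      then obtain e where e: "e > 0" "ball x e \<subseteq> D" using D open_contains_ball by blast
      have "P p q" if pq: "p \<le> x" "x \<le> q" "q - p < e" for p q
      proof (cases "0 < p")
        case p: True
        have sub: "{p..q} \<subseteq> D" using pq e(2) by (auto simp: subset_iff dist_real_def)
        have up: "y \<in> G \<Longrightarrow> p \<le> y \<Longrightarrow> y \<le> z \<Longrightarrow> z \<le> q \<Longrightarrow> z \<in> G" for y z
          by (rule right[of y z]) (use sub in auto)
        consider "q \<notin> G" | "p \<in> G" | "p \<notin> G" "q \<in> G" by blast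
        then show ?thesis
        proof cases
          case 1
          then have "(LINT y:{p..q}|lborel. indicator G y * F' y) = (LINT y:{p..q}|lborel. 0)"
            using up by (intro set_lebesgue_integral_cong) (auto simp: indicator_def)
          moreover have "p \<notin> G" using 1 up[of p q] pq by auto
          ultimately show ?thesis using 1 by (simp add: P_def)
        next
          case 2
          then have "(LINT y:{p..q}|lborel. indicator G y * F' y) = (LINT y:{p..q}|lborel. F' y)"
            using up by (intro set_lebesgue_integral_cong) (auto simp: indicator_def)
          also have "\<dots> = F q - F p" by (rule set_integral_FTC) (use pq p Fw cF' in auto)
          finally show ?thesis using 2 up[of p q] pq by (auto simp: P_def indicator_def)
        next
          case 3
          \<comment> \<open>The last point \<open>t\<close> of the interval off \<open>G\<close>:
            all points before it are off \<open>G\<close> as well, and integrating \<open>F'\<close>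
            from \<open>t\<close> on leaves the entrance term \<open>- F t\<close>, which is
            nonnegative.\<close>
          define S where "S = {p..q} - G"
          have "compact S" unfolding S_def using G by (intro compact_diff) auto
          moreover have "p \<in> S" using 3 pq by (auto simp: S_def)
          ultimately obtain t where t: "t \<in> S" "\<And>y. y \<in> S \<Longrightarrow> y \<le> t"
            using compact_attains_sup[of S] by auto
          have tq: "p \<le> t" "t \<le> q" "t \<notin> G" using t(1) by (auto simp: S_def)
          have "(LINT y:{p..q}|lborel. indicator G y * F' y)
              = (LINT y:{p..t}|lborel. indicator G y * F' y) + (LINT y:{t..q}|lborel. indicator G y * F' y)"
            by (rule set_integral_Icc_split[OF tq(1,2) int[OF p]])
          also have "(LINT y:{p..t}|lborel. indicator G y * F' y) = (LINT y:{p..t}|lborel. 0)"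
            using up[of _ t] tq by (intro set_lebesgue_integral_cong) (auto simp: indicator_def)
          also have "(LINT y:{t..q}|lborel. indicator G y * F' y) = (LINT y:{t..q}|lborel. F' y)"
          proof (rule set_lebesgue_integral_cong_AE)
            show "AE y\<in>{t..q} in lborel. indicator G y * F' y = F' y"
              using AE_lborel_singleton[of t]
            proof eventually_elim
              case (elim y)
              show ?case
              proof
                assume "y \<in> {t..q}"
                then have "y \<notin> S" using t(2)[of y] elim by auto
                then show "indicator G y * F' y = F' y" using \<open>y \<in> {t..q}\<close> tq by (auto simp: S_def)
              qed
            qed
          qed auto
          also have "\<dots> = F q - F t" by (rule set_integral_FTC) (use tq p Fw cF' in auto)
          finally show ?thesis using 3 neg[of t] p tq by (simp add: P_def)
        qed
      qed (simp add: P_def)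
      with e(1) show ?thesis by blast
    qed
  qed
  then show ?thesis using ab by (simp add: P_def)
qed

subsection \<open>The energy of the strip\<close>

lemma continuous_on_Complex_compose:
  fixes f :: "complex \<Rightarrow> 'b::topological_space"
  assumes "continuous_on UNIV f" "continuous_on A g" "continuous_on A h"
  shows "continuous_on A (\<lambda>x. f (Complex (g x) (h x)))"
  unfolding Complex_eq
  by (rule continuous_on_compose2[OF assms(1)]) (auto intro!: continuous_intros assms)

lemma bdd_meas_complex:
  assumes "continuous_on UNIV f"
  shows "bdd_meas (\<lambda>p. f (Complex (fst p) (snd p))) {a..b} {c..d}"
  by (intro bdd_meas_continuous borel_measurable_continuous_onI continuous_on_Complex_compose assms continuous_intros)

lemma bdd_meas_strip:
  assumes "0 < a"
  shows "bdd_meas (\<lambda>p. psi_u (fst p) (snd p)) {a..b} {c..d}" "bdd_meas (\<lambda>p. psi_v (fst p) (snd p)) {a..b} {c..d}"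
    "bdd_meas (\<lambda>p. psi_uu (fst p) (snd p)) {a..b} {c..d}"
    "continuous_on UNIV f \<Longrightarrow> bdd_meas (\<lambda>p. f (psi (fst p) (snd p))) {a..b} {c..d}"
proof -
  have nz: "\<And>x. x \<in> {a..b} \<times> {c..d} \<Longrightarrow> fst x \<noteq> 0" using assms by auto
  show "bdd_meas (\<lambda>p. psi_u (fst p) (snd p)) {a..b} {c..d}" "bdd_meas (\<lambda>p. psi_v (fst p) (snd p)) {a..b} {c..d}"
    "bdd_meas (\<lambda>p. psi_uu (fst p) (snd p)) {a..b} {c..d}"
    by (intro bdd_meas_continuous measurable_strip continuous_on_strip continuous_intros nz; assumption)+
  assume f: "continuous_on UNIV f"
  show "bdd_meas (\<lambda>p. f (psi (fst p) (snd p))) {a..b} {c..d}"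
  proof (rule bdd_meas_continuous)
    show "continuous_on ({a..b} \<times> {c..d}) (\<lambda>p. f (psi (fst p) (snd p)))"
      by (rule continuous_on_compose2[OF f]) (auto intro!: continuous_on_strip continuous_intros nz)
    show "(\<lambda>p. f (psi (fst p) (snd p))) \<in> borel_measurable borel"
      using measurable_compose[OF measurable_strip(1) borel_measurable_continuous_onI[OF f]] .
  qed
qed

text \<open>As \<open>psi\<close> is harmonic, the integrand is the divergence of the gradient of
  \<open>psi\<close> multiplied by \<open>P (psi u v)\<close>. There is no flux through the strip
  edges, where \<open>psi\<close> and hence this factor is 0. The right edge has a favourable sign,
  and the left edge gives at most \<open>c\<close> times the flux of the pole, which is at most
  \<open>pi\<close>.\<close>

lemma strip_energy_le:
  assumes ab: "0 < a" "a \<le> b" and phi: "continuous_on UNIV phi"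
    and P: "\<And>t. (P has_real_derivative (phi t)\<^sup>2) (at t)" "P 0 = 0" "\<And>t. t \<le> 0 \<Longrightarrow> - c \<le> P t \<and> P t \<le> 0" and c: "0 \<le> c"
  shows "(LINT u:{a..b}|lborel. LINT v:{- (pi / 4)..pi / 4}|lborel.
     (phi (psi u v))\<^sup>2 * ((psi_u u v)\<^sup>2 + (psi_v u v)\<^sup>2)) \<le> pi * c"
proof -
  let ?q = "pi / 4"
  have cP: "continuous_on UNIV P" by (rule DERIV_continuous_on) (auto intro: has_field_derivative_at_within P)
  define F1 where "F1 = (\<lambda>p. (phi (psi (fst p) (snd p)))\<^sup>2 * psi_u (fst p) (snd p) * psi_u (fst p) (snd p)
      + P (psi (fst p) (snd p)) * psi_uu (fst p) (snd p))"
  define F2 where "F2 = (\<lambda>p. (phi (psi (fst p) (snd p)))\<^sup>2 * psi_v (fst p) (snd p) * psi_v (fst p) (snd p)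
      + P (psi (fst p) (snd p)) * (- psi_uu (fst p) (snd p)))"
  have b1: "bdd_meas F1 {a..b} {-?q..?q}" and b2: "bdd_meas F2 {a..b} {-?q..?q}"
    unfolding F1_def F2_def by (intro bdd_meas_intros bdd_meas_strip ab phi cP)+
  have cphi: "continuous_on A (\<lambda>x. (phi (f x))\<^sup>2)" and cPf: "continuous_on A (\<lambda>x. P (f x))"
    if "continuous_on A f" for f and A :: "real set"
    by (intro continuous_intros continuous_on_compose2[OF phi] continuous_on_compose2[OF cP] that; simp)+
  have "(LINT u:{a..b}|lborel. LINT v:{-?q..?q}|lborel. (phi (psi u v))\<^sup>2 * ((psi_u u v)\<^sup>2 + (psi_v u v)\<^sup>2))
      = (LINT u:{a..b}|lborel. LINT v:{-?q..?q}|lborel. F1 (u, v) + F2 (u, v))"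
    by (simp add: F1_def F2_def power2_eq_square algebra_simps)
  also have "\<dots> = (LINT u:{a..b}|lborel. LINT v:{-?q..?q}|lborel. F1 (u, v))
      + (LINT u:{a..b}|lborel. LINT v:{-?q..?q}|lborel. F2 (u, v))"
    by (rule bdd_meas_iterated_add[OF b1 b2])
  also have "(LINT u:{a..b}|lborel. LINT v:{-?q..?q}|lborel. F2 (u, v)) = (LINT u:{a..b}|lborel. 0)"
  proof (intro set_lebesgue_integral_cong allI impI)
    fix u assume "u \<in> {a..b}"
    then have u: "u \<noteq> 0" using ab by auto
    have "(LINT v:{-?q..?q}|lborel. F2 (u, v)) = P (psi u ?q) * psi_v u ?q - P (psi u (-?q)) * psi_v u (-?q)"
    proof (rule set_integral_FTC)
      fix x show "((\<lambda>v. P (psi u v) * psi_v u v) has_real_derivative F2 (u, x)) (at x within {-?q..?q})"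
        using DERIV_mult[OF DERIV_chain2[OF P(1) psi_has_derivative_v[OF u]] psi_v_has_derivative[OF u]]
        by (simp add: F2_def algebra_simps)
    next
      show "continuous_on {-?q..?q} (\<lambda>x. F2 (u, x))" unfolding F2_def fst_conv snd_conv
        by (intro continuous_intros cphi cPf) (use u in auto)
    qed simp
    then show "(LINT v:{-?q..?q}|lborel. F2 (u, v)) = 0" using psi_quarter P(2) by simp
  qed simp
  also have "(LINT u:{a..b}|lborel. LINT v:{-?q..?q}|lborel. F1 (u, v)) = (LINT v:{-?q..?q}|lborel. LINT u:{a..b}|lborel. F1 (u, v))"
    by (rule bdd_meas_integral_fst(2)[OF b1])
  also have "\<dots> \<le> (LINT v:{-?q..?q}|lborel. c * psi_u a v)"
  proof (rule set_integral_mono)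
    show "set_integrable lborel {-?q..?q} (\<lambda>v. LINT u:{a..b}|lborel. F1 (u, v))"
      using bdd_meas_integral_fst(1)[OF bdd_meas_swap[OF b1]] by simp
    show "set_integrable lborel {-?q..?q} (\<lambda>v. c * psi_u a v)"
      by (intro borel_integrable_atLeastAtMost' continuous_intros) (use ab in auto)
    fix v assume v: "v \<in> {-?q..?q}"
    have "(LINT u:{a..b}|lborel. F1 (u, v)) = P (psi b v) * psi_u b v - P (psi a v) * psi_u a v"
    proof (rule set_integral_FTC[OF ab(2)])
      fix x assume "a \<le> x" "x \<le> b"
      then have x: "x \<noteq> 0" using ab by auto
      show "((\<lambda>u. P (psi u v) * psi_u u v) has_real_derivative F1 (x, v)) (at x within {a..b})"
        using DERIV_mult[OF DERIV_chain2[OF P(1) psi_has_derivative_u[OF x]] psi_u_has_derivative[OF x]]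
        by (simp add: F1_def algebra_simps)
    next
      show "continuous_on {a..b} (\<lambda>x. F1 (x, v))" unfolding F1_def fst_conv snd_conv
        by (intro continuous_intros cphi cPf) (use ab in auto)
    qed
    also have "\<dots> \<le> 0 + c * psi_u a v"
    proof -
      have v': "\<bar>v\<bar> \<le> ?q" using v unfolding atLeastAtMost_iff by linarith
      have b0: "0 < b" using ab by simp
      have "P (psi b v) * psi_u b v \<le> 0"
        using P(3)[OF psi_nonpos, of b v] psi_u_nonneg[OF b0 v'] b0 v' by (intro mult_nonpos_nonneg) auto
      moreover have "- P (psi a v) * psi_u a v \<le> c * psi_u a v"
        using P(3)[OF psi_nonpos, of a v] psi_u_nonneg[OF ab(1) v'] ab v' by (intro mult_right_mono) auto
      ultimately show ?thesis by simp
    qed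
    finally show "(LINT u:{a..b}|lborel. F1 (u, v)) \<le> c * psi_u a v" by simp
  qed
  also have "\<dots> = c * (2 * arctan (sin (2 * ?q) / sinh (2 * a)))"
    using psi_u_integral[OF ab(1), of ?q] by simp
  also have "\<dots> \<le> c * pi"
    using arctan_ubound[of "sin (2 * ?q) / sinh (2 * a)"] c by (intro mult_left_mono) linarith+
  finally show ?thesis by (simp add: mult.commute)
qed

subsection \<open>The lower bound for the energy in a half plane\<close>

text \<open>\<open>W\<close> is a truncated potential with plateau \<open>- c\<close> on the disc of
  radius \<open>d\<close>, and \<open>G\<close> the part of \<open>D\<close> that is counted.
  \<open>k\<close> is the depth down to which the strip potential is not cut off by
  \<open>phi\<close>, \<open>r\<close> the width of the zone in which the cut can matter,
  \<open>c'\<close> times \<open>pi\<close> the bound for the cut-off strip energy, and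
  \<open>h\<close> the left edge of the box of integration. The assumption \<open>cut\<close> keeps
  the gradient of \<open>W\<close> away from the region where \<open>phi\<close> differs from
  1.\<close>

locale right_half =
  fixes D G K :: "complex set" and W Wu Wv :: "complex \<Rightarrow> real" and phi P :: "real \<Rightarrow> real"
    and M d h r c c' k :: real
  assumes D: "open D" and G: "open G" "G \<subseteq> D"
    and leaf: "\<And>u y y'. Complex u y \<in> G \<Longrightarrow> (\<And>t. t \<in> closed_segment y y' \<Longrightarrow> Complex u t \<in> D) \<Longrightarrow> Complex u y' \<in> G"
    and right: "\<And>u u' y. Complex u y \<in> G \<Longrightarrow> u \<le> u' \<Longrightarrow> (\<And>t. t \<in> {u..u'} \<Longrightarrow> Complex t y \<in> D) \<Longrightarrow> Complex u' y \<in> G"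
    and short: "\<And>u a b. (\<And>t. t \<in> {a..b} \<Longrightarrow> Complex u t \<in> G) \<Longrightarrow> b - a \<le> pi / 2"
    and near: "\<And>w. cmod w < d \<Longrightarrow> 0 < Re w \<Longrightarrow> w \<in> G"
    and Wu: "\<And>u v. ((\<lambda>u. W (Complex u v)) has_real_derivative Wu (Complex u v)) (at u)"
    and Wv: "\<And>u v. ((\<lambda>v. W (Complex u v)) has_real_derivative Wv (Complex u v)) (at v)"
    and cont: "continuous_on UNIV W" "continuous_on UNIV Wu" "continuous_on UNIV Wv"
    and K: "compact K" "K \<subseteq> D" "\<And>w. w \<in> K \<Longrightarrow> \<bar>Re w\<bar> < M \<and> \<bar>Im w\<bar> < M" and M: "1 \<le> M"
    and supp: "\<And>w. w \<notin> K \<Longrightarrow> W w = 0"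
    and neg: "\<And>w. W w \<le> 0" and pole: "\<And>w. cmod w < d \<Longrightarrow> W w = - c" and c: "0 \<le> c" "0 < d"
    and phi: "continuous_on UNIV phi" "\<And>t. - k \<le> t \<Longrightarrow> phi t = 1"
    and P: "\<And>t. (P has_real_derivative (phi t)\<^sup>2) (at t)" "P 0 = 0" "\<And>t. t \<le> 0 \<Longrightarrow> - c' \<le> P t \<and> P t \<le> 0" "0 \<le> c'"
    and cut: "\<And>u v. Complex u v \<in> G \<Longrightarrow> \<bar>v\<bar> \<le> pi / 4 \<Longrightarrow> Wu (Complex u v) \<noteq> 0 \<or> Wv (Complex u v) \<noteq> 0 \<Longrightarrow> - k \<le> psi u v"
    and r: "0 < r" "\<And>u v. r \<le> u \<Longrightarrow> \<bar>v\<bar> \<le> pi / 4 \<Longrightarrow> - k \<le> psi u v"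
    and h: "0 < h" "h < M" "h \<le> d / 2" "d \<le> pi / 4"
begin

abbreviation "chi \<equiv> \<lambda>w. indicator G w :: real"

lemma zero_near: "w \<notin> D \<Longrightarrow> \<exists>e>0. \<forall>z. cmod (z - w) < e \<longrightarrow> W z = 0"
proof -
  assume "w \<notin> D"
  then have "w \<in> - K" using K by auto
  moreover have "open (- K)" using K(1) compact_imp_closed open_Compl by blast
  ultimately obtain e where "e > 0" "ball w e \<subseteq> - K" using open_contains_ball by blast
  then show ?thesis using supp
    by (intro exI[of _ e]) (auto simp: subset_iff dist_norm norm_minus_commute)
qed

lemma zero_far: "\<bar>v\<bar> \<ge> M \<Longrightarrow> W (Complex u v) = 0" "\<bar>u\<bar> \<ge> M \<Longrightarrow> W (Complex u v) = 0"
  using K(3) supp by force+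

lemma cmod_vertical: "cmod (Complex u x - Complex u v) = \<bar>x - v\<bar>" "cmod (Complex x v - Complex u v) = \<bar>x - u\<bar>"
  by (simp_all add: cmod_def)

lemma open_lines: "open A \<Longrightarrow> open {v. Complex u v \<in> A}" "open A \<Longrightarrow> open {u. Complex u v \<in> A}"
proof -
  assume A: "open A"
  have "continuous_on UNIV (\<lambda>v. Complex u v)" "continuous_on UNIV (\<lambda>u. Complex u v)"
    unfolding Complex_eq by (intro continuous_intros)+
  from this[THEN open_vimage[OF A]]
  show "open {v. Complex u v \<in> A}" "open {u. Complex u v \<in> A}" by (simp_all add: vimage_def)
qed

text \<open>A nearby point of \<open>G\<close> on the same vertical line, joined to the given point
  inside \<open>D\<close>, would put that point into \<open>G\<close>; near points off
  \<open>D\<close> the function \<open>W\<close> itself is zero. Hence multiplying by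
  \<open>chi\<close> does not spoil smoothness along vertical lines.\<close>

lemma off_leaf:
  assumes "Complex u v \<notin> G" shows "\<exists>e>0. \<forall>x. \<bar>x - v\<bar> < e \<longrightarrow> chi (Complex u x) * W (Complex u x) = 0"
proof (cases "Complex u v \<in> D")
  case True
  then obtain e where e: "e > 0" "ball (Complex u v) e \<subseteq> D" using D open_contains_ball by blast
  have "Complex u x \<notin> G" if x: "\<bar>x - v\<bar> < e" for x
  proof
    assume "Complex u x \<in> G"
    then have "Complex u v \<in> G"
    proof (rule leaf)
      fix t assume "t \<in> closed_segment x v"
      then have "\<bar>t - v\<bar> < e" using x by (auto simp: closed_segment_eq_real_ivl split: if_splits)
      then have "Complex u t \<in> ball (Complex u v) e"
        by (simp add: dist_norm norm_minus_commute[of "Complex u v"] cmod_vertical)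
      then show "Complex u t \<in> D" using e(2) by auto
    qed
    then show False using assms by simp
  qed
  then show ?thesis using e(1) by auto
next
  case False
  then obtain e where "e > 0" "\<And>z. cmod (z - Complex u v) < e \<Longrightarrow> W z = 0" using zero_near by blast
  then show ?thesis by (intro exI[of _ e]) (auto simp: cmod_vertical)
qed

lemma leaf_derivative:
  "((\<lambda>v. chi (Complex u v) * W (Complex u v)) has_real_derivative chi (Complex u v) * Wv (Complex u v)) (at v)"
proof (cases "Complex u v \<in> G")
  case True
  show ?thesis
    by (rule has_field_derivative_transform_within_open[OF _ open_lines(1)[OF G(1), of u]])
      (use True Wv in auto)
next
  case False
  then obtain e where e: "e > 0" "\<And>x. \<bar>x - v\<bar> < e \<Longrightarrow> chi (Complex u x) * W (Complex u x) = 0" using off_leaf by blast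
  have "((\<lambda>v. chi (Complex u v) * W (Complex u v)) has_real_derivative 0) (at v)"
    by (rule has_field_derivative_transform_within_open[of "\<lambda>_. 0" _ _ "ball v e"])
      (use e in \<open>auto simp: dist_real_def abs_minus_commute\<close>)
  then show ?thesis using False by simp
qed

lemma leaf_derivative_continuous: "continuous_on UNIV (\<lambda>v. chi (Complex u v) * Wv (Complex u v))"
proof -
  have "isCont (\<lambda>v. chi (Complex u v) * Wv (Complex u v)) v" for v
  proof (cases "Complex u v \<in> G")
    case True
    have "\<forall>\<^sub>F x in nhds v. Complex u x \<in> G"
      using eventually_nhds_in_open[OF open_lines(1)[OF G(1), of u], of v] True by simp
    then have "\<forall>\<^sub>F x in nhds v. chi (Complex u x) * Wv (Complex u x) = Wv (Complex u x)"
      by eventually_elim simp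
    moreover have "continuous_on UNIV (\<lambda>v. Wv (Complex u v))"
      by (rule continuous_on_Complex_compose[OF cont(3)]) (intro continuous_intros)+
    then have "isCont (\<lambda>v. Wv (Complex u v)) v" by (simp add: continuous_on_eq_continuous_at)
    ultimately show ?thesis by (simp only: isCont_cong)
  next
    case False
    then obtain e where e: "e > 0" "\<And>x. \<bar>x - v\<bar> < e \<Longrightarrow> chi (Complex u x) * W (Complex u x) = 0" using off_leaf by blast
    have "chi (Complex u x) * Wv (Complex u x) = 0" if "x \<in> ball v e" for x
    proof (rule DERIV_unique[OF leaf_derivative])
      show "((\<lambda>v. chi (Complex u v) * W (Complex u v)) has_real_derivative 0) (at x)"
        by (rule has_field_derivative_transform_within_open[of "\<lambda>_. 0" _ _ "ball v e"])
          (use e that in \<open>auto simp: dist_real_def abs_minus_commute\<close>)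
    qed
    then have "\<forall>\<^sub>F x in nhds v. chi (Complex u x) * Wv (Complex u x) = 0"
      by (intro eventually_mono[OF eventually_nhds_in_open[OF open_ball[of v e]]]) (use e(1) in auto)
    then show ?thesis by (simp only: isCont_cong) simp
  qed
  then show ?thesis by (simp add: continuous_at_imp_continuous_on)
qed

lemma pi_quarter_le_M: "pi / 4 \<le> M" using M pi_less_4 by simp

text \<open>For \<open>u < r\<close> the line may meet the region where \<open>phi\<close> cuts, and
  the version with loss \<open>4 * pi\<close> is used; for \<open>r \<le> u\<close> the cut is
  inactive on the strip section and the exact inequality applies.\<close>

lemma vertical_inequality:
  assumes u: "0 < u"
  shows "(LINT v:{-M..M}|lborel. (chi (Complex u v) * Wv (Complex u v))\<^sup>2)
    \<ge> 2 * (LINT v:{- (pi / 4)..pi / 4}|lborel. psi_uu u v * (chi (Complex u v) * W (Complex u v)))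
      - (LINT v:{- (pi / 4)..pi / 4}|lborel. (phi (psi u v))\<^sup>2 * (psi_v u v)\<^sup>2) - (if u < r then 4 * pi else 0)"
proof -
  let ?y = "\<lambda>v. chi (Complex u v) * W (Complex u v)" and ?y' = "\<lambda>v. chi (Complex u v) * Wv (Complex u v)"
  define H where "H = {v. Complex u v \<in> G}"
  have u0: "u \<noteq> 0" and M0: "0 \<le> M" using u M by auto
  have far: "\<bar>v\<bar> \<ge> M \<Longrightarrow> ?y v = 0" for v using zero_far by simp
  have off: "v \<notin> H \<Longrightarrow> \<exists>e>0. \<forall>x. \<bar>x - v\<bar> < e \<longrightarrow> ?y x = 0" for v
    using off_leaf by (simp add: H_def)
  have oH: "open H" unfolding H_def by (rule open_lines(1)[OF G(1)])
  have sh: "b - a \<le> pi / 2" if "{a..b} \<subseteq> H" for a b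
    by (rule short[of a b u]) (use that in \<open>auto simp: H_def\<close>)
  note parts = line_parts[OF u0 pi_quarter_le_M leaf_derivative[of u] leaf_derivative_continuous[of u] far]
  show ?thesis
  proof (cases "u < r")
    case True
    have "continuous_on UNIV (\<lambda>v. phi (psi u v))"
      by (rule continuous_on_compose2[OF phi(1)]) (auto intro!: continuous_intros simp: u0)
    moreover have "phi (psi u v) = 1" if "v \<in> H" "\<bar>v\<bar> \<le> pi / 4" "?y' v \<noteq> 0" for v
      using that cut[of u v] phi(2) by (auto simp: H_def)
    ultimately show ?thesis
      using line_energy_cutoff[where H=H and phi="\<lambda>v. phi (psi u v)", OF u0 M0 leaf_derivative[of u] leaf_derivative_continuous[of u] far off oH sh]
        parts True by simp
  next
    case False
    have "(LINT v:{- (pi / 4)..pi / 4}|lborel. (phi (psi u v))\<^sup>2 * (psi_v u v)\<^sup>2) = (LINT v:{- (pi / 4)..pi / 4}|lborel. (psi_v u v)\<^sup>2)"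
      by (intro set_lebesgue_integral_cong) (use False r(2)[of u] phi(2) in \<open>auto simp: abs_le_iff\<close>)
    then show ?thesis
      using line_energy[where H=H, OF u0 M0 leaf_derivative[of u] leaf_derivative_continuous[of u] far off oH sh] parts False by simp
  qed
qed

text \<open>The integrand is \<open>chi\<close> times the horizontal derivative of
  \<open>psi_u * W\<close>. On the strip section this product is nonpositive, as the treatment of
  the entrances requires, and it vanishes at \<open>M\<close>, so only the left edge
  remains.\<close>

lemma horizontal_inequality:
  assumes v: "\<bar>v\<bar> \<le> pi / 4"
  shows "(LINT u:{h..M}|lborel. chi (Complex u v) * (psi_u u v * Wu (Complex u v) + psi_uu u v * W (Complex u v)))
    \<ge> - (chi (Complex h v) * (psi_u h v * W (Complex h v)))"
proof -
  define F where "F = (\<lambda>u. psi_u u v * W (Complex u v))"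
  define F' where "F' = (\<lambda>u. psi_u u v * Wu (Complex u v) + psi_uu u v * W (Complex u v))"
  have cW: "continuous_on A (\<lambda>u. W (Complex u v))" "continuous_on A (\<lambda>u. Wu (Complex u v))" for A
    by (rule continuous_on_Complex_compose[OF cont(1)] continuous_on_Complex_compose[OF cont(2)]; intro continuous_intros)+
  have "indicator {u. Complex u v \<in> G} M * F M - indicator {u. Complex u v \<in> G} h * F h
     \<le> (LINT u:{h..M}|lborel. indicator {u. Complex u v \<in> G} u * F' u)"
  proof (rule right_closed_parts[where D="{u. Complex u v \<in> D}"])
    show "(F has_real_derivative F' x) (at x)" if "0 < x" for x
      unfolding F_def F'_def using that DERIV_mult[OF psi_u_has_derivative[of x v] Wu] by (simp add: algebra_simps)
    show "continuous_on {0<..} F'"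
      unfolding F'_def by (intro continuous_intros cW) auto
    have "(\<lambda>u. (u, v)) \<in> borel_measurable borel"
      by (intro borel_measurable_continuous_onI continuous_intros)
    from measurable_compose[OF this measurable_strip(2)] measurable_compose[OF this measurable_strip(4)]
    have [measurable]: "(\<lambda>u. psi_u u v) \<in> borel_measurable borel" "(\<lambda>u. psi_uu u v) \<in> borel_measurable borel" by simp_all
    have [measurable]: "(\<lambda>u. W (Complex u v)) \<in> borel_measurable borel" "(\<lambda>u. Wu (Complex u v)) \<in> borel_measurable borel"
      by (intro borel_measurable_continuous_onI cW)+
    show "F' \<in> borel_measurable borel" unfolding F'_def by measurable
    show "F x \<le> 0" if "0 < x" for x
      unfolding F_def using psi_u_nonneg[OF that v] neg by (intro mult_nonneg_nonpos) auto
    show "\<exists>e>0. \<forall>y. \<bar>y - x\<bar> < e \<longrightarrow> F y = 0" if xD: "x \<notin> {u. Complex u v \<in> D}" for x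
    proof -
      obtain e where "e > 0" "\<And>z. cmod (z - Complex x v) < e \<Longrightarrow> W z = 0" using zero_near xD by blast
      then show ?thesis by (intro exI[of _ e]) (auto simp: F_def cmod_vertical)
    qed
    show "0 < h" "h \<le> M" using h by auto
    show "open {u. Complex u v \<in> D}" "open {u. Complex u v \<in> G}" by (intro open_lines D G)+
    show "{u. Complex u v \<in> G} \<subseteq> {u. Complex u v \<in> D}" using G(2) by auto
    show "y \<in> {u. Complex u v \<in> G}" if "x \<in> {u. Complex u v \<in> G}" "x \<le> y" "{x..y} \<subseteq> {u. Complex u v \<in> D}" for x y
      using right[of x v y] that by (auto simp: subset_iff)
  qed
  moreover have "F M = 0" using zero_far(2)[of M v] M by (simp add: F_def)
  moreover have eq: "indicator {u. Complex u v \<in> G} u = chi (Complex u v)" for u by (simp add: indicator_def)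
  ultimately show ?thesis unfolding eq F_def F'_def by simp
qed

lemma chi_meas: "(\<lambda>p. indicator G (Complex (fst p) (snd p))) = (indicator {p. Complex (fst p) (snd p) \<in> G} :: real \<times> real \<Rightarrow> real)"
  "{p. Complex (fst p) (snd p) \<in> G} \<in> sets borel"
proof -
  have "open ((\<lambda>p. Complex (fst p) (snd p)) -` G)"
    unfolding Complex_eq by (intro open_vimage G continuous_intros)
  then show "{p. Complex (fst p) (snd p) \<in> G} \<in> sets borel" by (simp add: vimage_def)
qed (auto simp: fun_eq_iff indicator_def)

text \<open>Horizontally the square of \<open>Wu - psi_u\<close> is completed and kept only on
  \<open>B\<close>; vertically the line inequality is used. The mixed terms combine to the
  horizontal derivative of \<open>psi_u * W\<close>, and at the left edge the plateau
  \<open>- c\<close> meets the flux of the pole, which produces the term with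
  \<open>arctan\<close>.\<close>

lemma energy_lower_bound:
  assumes B: "B \<in> sets borel" "\<And>u v. (u, v) \<in> B \<Longrightarrow> Complex u v \<in> G \<and> - k \<le> psi u v"
  shows "(LINT u:{h..M}|lborel. LINT v:{-M..M}|lborel. (Wu (Complex u v))\<^sup>2 + (Wv (Complex u v))\<^sup>2)
     \<ge> 4 * c * arctan (sin (d / 2) / sinh (2 * h)) - pi * c' - 4 * pi * r
       + (LINT u:{h..M}|lborel. LINT v:{- (pi / 4)..pi / 4}|lborel. indicator B (u, v) * (Wu (Complex u v) - psi_u u v)\<^sup>2)"
proof -
  let ?q = "pi / 4"
  define X where "X = (\<lambda>p. indicator G (Complex (fst p) (snd p)) :: real)"
  define wu where "wu = (\<lambda>p. Wu (Complex (fst p) (snd p)))"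
  define wv where "wv = (\<lambda>p. Wv (Complex (fst p) (snd p)))"
  define w where "w = (\<lambda>p. W (Complex (fst p) (snd p)))"
  define pu where "pu = (\<lambda>p. psi_u (fst p) (snd p))"
  define pv where "pv = (\<lambda>p. psi_v (fst p) (snd p))"
  define puu where "puu = (\<lambda>p. psi_uu (fst p) (snd p))"
  define ph where "ph = (\<lambda>p. phi (psi (fst p) (snd p)))"
  note defs = X_def wu_def wv_def w_def pu_def pv_def puu_def ph_def
  have bm: "bdd_meas X {h..M} {s..t}" "bdd_meas wu {h..M} {s..t}" "bdd_meas wv {h..M} {s..t}"
    "bdd_meas w {h..M} {s..t}" "bdd_meas pu {h..M} {s..t}" "bdd_meas pv {h..M} {s..t}"
    "bdd_meas puu {h..M} {s..t}" "bdd_meas ph {h..M} {s..t}" "bdd_meas (indicator B) {h..M} {s..t}" for s t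
    unfolding defs chi_meas(1)
    by (intro bdd_meas_indicator chi_meas(2) bdd_meas_complex[OF cont(1)] bdd_meas_complex[OF cont(2)]
        bdd_meas_complex[OF cont(3)] bdd_meas_strip[OF h(1)] phi B)+
  define T1 where "T1 = (\<lambda>p. X p * (pu p * wu p + puu p * w p))"
  define T2 where "T2 = (\<lambda>p. (ph p)\<^sup>2 * ((pu p)\<^sup>2 + (pv p)\<^sup>2))"
  define T3 where "T3 = (\<lambda>p. indicator B p * (wu p - pu p)\<^sup>2)"
  have bT: "bdd_meas T1 {h..M} {s..t}" "bdd_meas T2 {h..M} {s..t}" "bdd_meas T3 {h..M} {s..t}" for s t
    unfolding T1_def T2_def T3_def by (intro bdd_meas_intros bm)+
  define T where "T = (\<lambda>p. 2 * T1 p + (- T2 p + T3 p))"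
  have bTT: "bdd_meas T {h..M} {s..t}" for s t
    unfolding T_def by (intro bdd_meas_intros bT)
  have bE: "bdd_meas (\<lambda>p. (wu p)\<^sup>2 + (wv p)\<^sup>2) {h..M} {s..t}" for s t
    by (intro bdd_meas_intros bm)
  define loss where "loss = (\<lambda>u. if u < r then 4 * pi else (0::real))"
  have iloss: "set_integrable lborel {h..M} loss"
    by (rule set_integrable_bounded_Icc[where c="4 * pi"]) (auto simp: loss_def)
  have inner: "(LINT v:{-?q..?q}|lborel. T (u, v)) - loss u \<le> (LINT v:{-M..M}|lborel. (wu (u, v))\<^sup>2 + (wv (u, v))\<^sup>2)"
    if u: "u \<in> {h..M}" for u
  proof -
    have u0: "0 < u" using u h by auto
    note sec = bdd_meas_section[OF _ u]
    have i: "set_integrable lborel {s..t} (\<lambda>v. (wu (u, v))\<^sup>2)" "set_integrable lborel {s..t} (\<lambda>v. (wv (u, v))\<^sup>2)"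
      "set_integrable lborel {s..t} (\<lambda>v. (X (u, v) * wv (u, v))\<^sup>2)"
      "set_integrable lborel {s..t} (\<lambda>v. puu (u, v) * (X (u, v) * w (u, v)))"
      "set_integrable lborel {s..t} (\<lambda>v. (ph (u, v))\<^sup>2 * (pv (u, v))\<^sup>2)"
      "set_integrable lborel {s..t} (\<lambda>v. 2 * (X (u, v) * (pu (u, v) * wu (u, v))) - (ph (u, v))\<^sup>2 * (pu (u, v))\<^sup>2 + T3 (u, v))" for s t
      by (rule sec, intro bdd_meas_intros bm bT)+
    define S1 where "S1 = (\<lambda>v. 2 * (X (u, v) * (pu (u, v) * wu (u, v))) - (ph (u, v))\<^sup>2 * (pu (u, v))\<^sup>2 + T3 (u, v))"
    have "(LINT v:{-?q..?q}|lborel. S1 v) \<le> (LINT v:{-?q..?q}|lborel. (wu (u, v))\<^sup>2)"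
    proof (rule set_integral_mono)
      fix v assume "v \<in> {-?q..?q}"
      then have v: "\<bar>v\<bar> \<le> ?q" unfolding atLeastAtMost_iff by linarith
      have sq: "(wu (u, v) - pu (u, v))\<^sup>2 = (wu (u, v))\<^sup>2 - 2 * (pu (u, v) * wu (u, v)) + (pu (u, v))\<^sup>2"
        by (simp add: power2_diff)
      show "S1 v \<le> (wu (u, v))\<^sup>2"
      proof (cases "Complex u v \<in> G")
        case False
        then have "X (u, v) = 0" "(u, v) \<notin> B" using B(2) by (auto simp: X_def)
        then have "S1 v = - ((ph (u, v))\<^sup>2 * (pu (u, v))\<^sup>2)" by (simp add: S1_def T3_def)
        then show ?thesis by (simp add: order_trans[of _ 0])
      next
        case True
        then have X1: "X (u, v) = 1" by (simp add: X_def)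
        show ?thesis
        proof (cases "- k \<le> psi u v")
          case True
          then have "ph (u, v) = 1" using phi(2) by (simp add: ph_def)
          then have "S1 v = 2 * (pu (u, v) * wu (u, v)) - (pu (u, v))\<^sup>2 + indicator B (u, v) * (wu (u, v) - pu (u, v))\<^sup>2"
            by (simp add: S1_def T3_def X1)
          moreover have "indicator B (u, v) * (wu (u, v) - pu (u, v))\<^sup>2 \<le> (wu (u, v) - pu (u, v))\<^sup>2"
            by (simp add: indicator_def)
          ultimately show ?thesis using sq by linarith
        next
          \<comment> \<open>Below the cut depth the gradient of \<open>W\<close> vanishes by
            \<open>cut\<close> and the point is not in \<open>B\<close>, so the value of
            \<open>phi\<close> there is irrelevant.\<close>
          case False
          then have "wu (u, v) = 0" "(u, v) \<notin> B" using cut[OF True v] B(2) by (auto simp: wu_def)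
          then show ?thesis by (simp add: S1_def T3_def)
        qed
      qed
    qed (use i in \<open>auto simp: S1_def\<close>)
    also have "\<dots> \<le> (LINT v:{-M..M}|lborel. (wu (u, v))\<^sup>2)"
      unfolding set_lebesgue_integral_def using i(1)[of "-?q" ?q] i(1)[of "-M" M] pi_quarter_le_M
      by (intro integral_mono) (auto simp: set_integrable_def split: split_indicator)
    finally have A1: "(LINT v:{-?q..?q}|lborel. S1 v) \<le> (LINT v:{-M..M}|lborel. (wu (u, v))\<^sup>2)" .
    have "(LINT v:{-M..M}|lborel. (X (u, v) * wv (u, v))\<^sup>2) \<le> (LINT v:{-M..M}|lborel. (wv (u, v))\<^sup>2)"
      by (intro set_integral_mono i) (auto simp: X_def indicator_def)
    moreover have "(LINT v:{-M..M}|lborel. (X (u, v) * wv (u, v))\<^sup>2)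
        \<ge> 2 * (LINT v:{-?q..?q}|lborel. puu (u, v) * (X (u, v) * w (u, v))) - (LINT v:{-?q..?q}|lborel. (ph (u, v))\<^sup>2 * (pv (u, v))\<^sup>2) - loss u"
      using vertical_inequality[OF u0] by (simp add: defs loss_def)
    moreover have "(LINT v:{-?q..?q}|lborel. T (u, v)) = (LINT v:{-?q..?q}|lborel. S1 v
        + (2 * (puu (u, v) * (X (u, v) * w (u, v))) - (ph (u, v))\<^sup>2 * (pv (u, v))\<^sup>2))"
      by (simp add: S1_def T_def T1_def T2_def algebra_simps)
    moreover have "\<dots> = (LINT v:{-?q..?q}|lborel. S1 v) + (2 * (LINT v:{-?q..?q}|lborel. puu (u, v) * (X (u, v) * w (u, v)))
        - (LINT v:{-?q..?q}|lborel. (ph (u, v))\<^sup>2 * (pv (u, v))\<^sup>2))"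
      using i unfolding S1_def by (subst set_integral_add) (auto simp: set_integral_diff)
    moreover have "(LINT v:{-M..M}|lborel. (wu (u, v))\<^sup>2 + (wv (u, v))\<^sup>2)
        = (LINT v:{-M..M}|lborel. (wu (u, v))\<^sup>2) + (LINT v:{-M..M}|lborel. (wv (u, v))\<^sup>2)"
      by (intro set_integral_add i)
    ultimately show ?thesis using A1 by linarith
  qed
  have "(LINT u:{h..M}|lborel. LINT v:{-?q..?q}|lborel. T (u, v)) - (LINT u:{h..M}|lborel. loss u)
      = (LINT u:{h..M}|lborel. (LINT v:{-?q..?q}|lborel. T (u, v)) - loss u)"
    by (intro set_integral_diff(2)[symmetric] bdd_meas_integral_fst(1) bTT iloss)
  also have "\<dots> \<le> (LINT u:{h..M}|lborel. LINT v:{-M..M}|lborel. (wu (u, v))\<^sup>2 + (wv (u, v))\<^sup>2)"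
    by (intro set_integral_mono set_integral_diff(1) bdd_meas_integral_fst(1)[OF bTT] bdd_meas_integral_fst(1)[OF bE] iloss inner)
  finally have main: "(LINT u:{h..M}|lborel. LINT v:{-?q..?q}|lborel. T (u, v)) - (LINT u:{h..M}|lborel. loss u)
      \<le> (LINT u:{h..M}|lborel. LINT v:{-M..M}|lborel. (wu (u, v))\<^sup>2 + (wv (u, v))\<^sup>2)" .
  have "(LINT u:{h..M}|lborel. loss u) \<le> (LINT u:{0..r}|lborel. 4 * pi)"
    unfolding set_lebesgue_integral_def
  proof (rule integral_mono)
    show "integrable lborel (\<lambda>u. indicator {h..M} u *\<^sub>R loss u)" using iloss by (simp add: set_integrable_def)
    show "integrable lborel (\<lambda>u. indicator {0..r} u *\<^sub>R (4 * pi))"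
      using borel_integrable_atLeastAtMost'[of 0 r "\<lambda>_. 4 * pi"] by (simp add: set_integrable_def)
  qed (use h in \<open>auto simp: loss_def split: split_indicator\<close>)
  also have "\<dots> = 4 * pi * r" using r by (simp add: set_lebesgue_integral_def)
  finally have L: "(LINT u:{h..M}|lborel. loss u) \<le> 4 * pi * r" .
  have TT: "(LINT u:{h..M}|lborel. LINT v:{-?q..?q}|lborel. T (u, v)) = 2 * (LINT u:{h..M}|lborel. LINT v:{-?q..?q}|lborel. T1 (u, v))
     + (- (LINT u:{h..M}|lborel. LINT v:{-?q..?q}|lborel. T2 (u, v)) + (LINT u:{h..M}|lborel. LINT v:{-?q..?q}|lborel. T3 (u, v)))"
    unfolding T_def
    by (subst bdd_meas_iterated_add, (intro bdd_meas_intros bT)+, subst bdd_meas_iterated_add, (intro bdd_meas_intros bT)+)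
      (simp add: set_lebesgue_integral_def)
  have E: "(LINT u:{h..M}|lborel. LINT v:{-?q..?q}|lborel. T2 (u, v)) \<le> pi * c'"
    using strip_energy_le[OF h(1) _ phi(1) P, of M] h by (simp add: T2_def defs)
  \<comment> \<open>A segment of half length \<open>d / 4\<close> at abscissa
    \<open>h \<le> d / 2\<close> stays inside the disc where \<open>W\<close> is \<open>- c\<close>.
    The rest of the left edge contributes with the right sign and is dropped.\<close>
  have sub: "{- (d / 4)..d / 4} \<subseteq> {-?q..?q}" using h c by auto
  have "2 * c * arctan (sin (d / 2) / sinh (2 * h)) = c * (LINT v:{- (d / 4)..d / 4}|lborel. psi_u h v)"
    using psi_u_integral[OF h(1), of "d / 4"] c by simp
  also have "\<dots> = (\<integral>v. indicator {- (d / 4)..d / 4} v * (c * psi_u h v) \<partial>lborel)"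
    by (simp add: set_lebesgue_integral_def mult.left_commute)
  also have "\<dots> \<le> (\<integral>v. indicator {-?q..?q} v * - (X (h, v) * (pu (h, v) * w (h, v))) \<partial>lborel)"
  proof (rule integral_mono)
    have "continuous_on {- (d / 4)..d / 4} (\<lambda>v. c * psi_u h v)" by (intro continuous_intros) (use h in auto)
    then show "integrable lborel (\<lambda>v. indicator {- (d / 4)..d / 4} v * (c * psi_u h v))"
      by (rule integral_indicator_Icc)
    have "set_integrable lborel {-?q..?q} (\<lambda>v. - (X (h, v) * (pu (h, v) * w (h, v))))"
      by (rule bdd_meas_section[of _ h M], intro bdd_meas_intros bm) (use h in auto)
    then show "integrable lborel (\<lambda>v. indicator {-?q..?q} v * - (X (h, v) * (pu (h, v) * w (h, v))))"
      by (simp add: set_integrable_def)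
    fix v
    show "indicator {- (d / 4)..d / 4} v * (c * psi_u h v) \<le> indicator {-?q..?q} v * - (X (h, v) * (pu (h, v) * w (h, v)))"
    proof (cases "v \<in> {-?q..?q}")
      case True
      then have v: "\<bar>v\<bar> \<le> ?q" unfolding atLeastAtMost_iff by linarith
      show ?thesis
      proof (cases "v \<in> {- (d / 4)..d / 4}")
        case vd: True
        have "cmod (Complex h v) \<le> \<bar>h\<bar> + \<bar>v\<bar>" using cmod_le[of "Complex h v"] by simp
        also have "\<dots> < d" using vd h c by auto
        finally have "cmod (Complex h v) < d" .
        then have "Complex h v \<in> G" "W (Complex h v) = - c" using near pole h by auto
        then show ?thesis using True vd by (simp add: X_def pu_def w_def)
      next
        case False
        have "psi_u h v * W (Complex h v) \<le> 0" using psi_u_nonneg[OF h(1) v] neg by (intro mult_nonneg_nonpos) auto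
        moreover have "indicator {- (d / 4)..d / 4} v = (0::real)" using False by (rule indicator_simps(2))
        ultimately show ?thesis using True by (simp add: X_def pu_def w_def split: split_indicator)
      qed
    qed (use sub in \<open>auto simp: indicator_def\<close>)
  qed
  also have "\<dots> = (LINT v:{-?q..?q}|lborel. - (X (h, v) * (pu (h, v) * w (h, v))))"
    by (simp add: set_lebesgue_integral_def)
  also have "\<dots> \<le> (LINT v:{-?q..?q}|lborel. LINT u:{h..M}|lborel. T1 (u, v))"
  proof (rule set_integral_mono)
    show "set_integrable lborel {-?q..?q} (\<lambda>v. - (X (h, v) * (pu (h, v) * w (h, v))))"
      by (rule bdd_meas_section[of _ h M], intro bdd_meas_intros bm) (use h in auto)
    show "set_integrable lborel {-?q..?q} (\<lambda>v. LINT u:{h..M}|lborel. T1 (u, v))"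
      using bdd_meas_integral_fst(1)[OF bdd_meas_swap[OF bT(1)]] by simp
    fix v assume "v \<in> {-?q..?q}"
    then have "\<bar>v\<bar> \<le> ?q" unfolding atLeastAtMost_iff by linarith
    from horizontal_inequality[OF this]
    show "- (X (h, v) * (pu (h, v) * w (h, v))) \<le> (LINT u:{h..M}|lborel. T1 (u, v))"
      by (simp add: T1_def defs)
  qed
  also have "\<dots> = (LINT u:{h..M}|lborel. LINT v:{-?q..?q}|lborel. T1 (u, v))"
    by (rule bdd_meas_integral_fst(2)[symmetric, OF bT(1)])
  finally have "4 * c * arctan (sin (d / 2) / sinh (2 * h)) \<le> 2 * (LINT u:{h..M}|lborel. LINT v:{-?q..?q}|lborel. T1 (u, v))"
    by simp
  with main L TT E show ?thesis by (simp add: T3_def defs)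
qed

end

subsection \<open>Truncated logarithmic potentials\<close>

lemma ln_cmod_has_derivative:
  assumes "(h has_vector_derivative h') (at t)" "h t \<noteq> 0"
  shows "((\<lambda>t. ln (cmod (h t))) has_real_derivative Re (h' / h t)) (at t)"
proof -
  have d: "((\<lambda>t. Re (h t)) has_real_derivative Re h') (at t)" "((\<lambda>t. Im (h t)) has_real_derivative Im h') (at t)"
    using assms(1) by (auto simp: has_real_derivative_iff_has_vector_derivative intro:
        bounded_linear.has_vector_derivative[OF bounded_linear_Re] bounded_linear.has_vector_derivative[OF bounded_linear_Im])
  define N where "N = (Re (h t))\<^sup>2 + (Im (h t))\<^sup>2"
  have N: "N > 0" using assms(2) by (simp add: N_def complex_eq_iff sum_power2_gt_zero_iff)
  have "((\<lambda>t. ln ((a t)\<^sup>2 + (b t)\<^sup>2) / 2) has_real_derivative (a t * a' + b t * b') / ((a t)\<^sup>2 + (b t)\<^sup>2)) (at t)"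
    if "(a has_real_derivative a') (at t)" "(b has_real_derivative b') (at t)" "0 < (a t)\<^sup>2 + (b t)\<^sup>2" for a b a' b'
  proof -
    define n where "n = (\<lambda>t. (a t)\<^sup>2 + (b t)\<^sup>2)"
    have "(n has_real_derivative 2 * (a t * a' + b t * b')) (at t)"
      unfolding n_def by (auto intro!: derivative_eq_intros that(1,2) simp: algebra_simps)
    moreover have "0 < n t" using that(3) by (simp add: n_def)
    ultimately have "((\<lambda>t. ln (n t) / 2) has_real_derivative (a t * a' + b t * b') / n t) (at t)"
      by (auto intro!: derivative_eq_intros simp: field_simps)
    then show ?thesis by (simp add: n_def)
  qed
  from this[OF d N[unfolded N_def]] have "((\<lambda>t. ln ((Re (h t))\<^sup>2 + (Im (h t))\<^sup>2) / 2) has_real_derivative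
     (Re (h t) * Re h' + Im (h t) * Im h') / N) (at t)" by (simp add: N_def)
  moreover have ln: "ln (cmod z) = ln ((Re z)\<^sup>2 + (Im z)\<^sup>2) / 2" for z
    by (cases "z = 0") (simp_all add: cmod_def ln_sqrt complex_eq_iff sum_power2_gt_zero_iff)
  moreover have re: "Re (h' / h t) = (Re (h t) * Re h' + Im (h t) * Im h') / N"
    by (simp add: Re_divide N_def mult.commute)
  ultimately show ?thesis unfolding ln re by simp
qed

lemma Complex_has_vector_derivative:
  "((\<lambda>u. Complex u v) has_vector_derivative 1) (at u)" "((\<lambda>v. Complex u v) has_vector_derivative \<i>) (at v)"
proof -
  have "((\<lambda>u. complex_of_real u + \<i> * complex_of_real v) has_vector_derivative 1) (at u)"
    by (auto intro!: derivative_eq_intros has_vector_derivative_of_real[of "\<lambda>x. x" 1, simplified])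
  then show "((\<lambda>u. Complex u v) has_vector_derivative 1) (at u)" by (simp add: Complex_eq)
  have "((\<lambda>v. complex_of_real u + \<i> * complex_of_real v) has_vector_derivative \<i>) (at v)"
    by (auto intro!: derivative_eq_intros has_vector_derivative_of_real[of "\<lambda>x. x" 1, simplified])
  then show "((\<lambda>v. Complex u v) has_vector_derivative \<i>) (at v)" by (simp add: Complex_eq)
qed

lemma holomorphic_line_derivative:
  assumes "(F has_field_derivative F') (at (Complex u v))"
  shows "((\<lambda>u. F (Complex u v)) has_vector_derivative F') (at u)" "((\<lambda>v. F (Complex u v)) has_vector_derivative \<i> * F') (at v)"
  using field_vector_diff_chain_at[OF Complex_has_vector_derivative(1) assms]
    field_vector_diff_chain_at[OF Complex_has_vector_derivative(2) assms]
  by (simp_all add: o_def)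

lemma antiderivative_exists:
  fixes p :: "real \<Rightarrow> real"
  assumes "continuous_on UNIV p" and z: "\<And>t. t \<le> a \<Longrightarrow> p t = 0"
  obtains P where "\<And>t. (P has_real_derivative p t) (at t)" "P b = 0"
proof
  \<comment> \<open>For \<open>t < a - 1\<close> the interval is empty and the integral 0, in
    agreement with the vanishing of \<open>p\<close> there; so this is an antiderivative on the
    whole line.\<close>
  define F where "F = (\<lambda>t. integral {a - 1..t} p)"
  have "(F has_real_derivative p t) (at t)" for t
  proof (cases "t \<le> a - 1 / 2")
    case True
    have "F s = 0" if "s < a" for s
    proof -
      have "integral {a - 1..s} p = integral {a - 1..s} (\<lambda>_. 0)" by (rule integral_cong) (use that z in auto)
      then show ?thesis by (simp add: F_def)
    qed
    then have "(F has_real_derivative 0) (at t)"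
      by (intro has_field_derivative_transform_within_open[of "\<lambda>_. 0" 0 t "{..<a}" F]) (use True in auto)
    then show ?thesis using True z by simp
  next
    case False
    have "(F has_real_derivative p t) (at t within {a - 1..t + 1})"
      unfolding F_def by (rule integral_has_real_derivative) (use False assms in \<open>auto intro: continuous_on_subset\<close>)
    moreover have "at t within {a - 1..t + 1} = at t" using False by (intro at_within_interior) auto
    ultimately show ?thesis by simp
  qed
  then show "((\<lambda>t. F t - F b) has_real_derivative p t) (at t)" for t
    using DERIV_diff[OF _ DERIV_const] by fastforce
qed simp

text \<open>\<open>g\<close> plays the role of the inverse of a univalent function with image \<open>D\<close>.\<close>

locale disc_chart =
  fixes D :: "complex set" and g :: "complex \<Rightarrow> complex"
  assumes D: "open D" "0 \<in> D" and hol: "g holomorphic_on D" and zero: "\<And>w. w \<in> D \<Longrightarrow> g w = 0 \<longleftrightarrow> w = 0"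
    and dg: "deriv g 0 = 1" and cpt: "\<And>s. s < 1 \<Longrightarrow> compact {w \<in> D. cmod (g w) \<le> s}"
begin

definition logd :: "complex \<Rightarrow> complex" where "logd w = deriv g w / g w"

text \<open>The maximum keeps the logarithm away from the zero of \<open>g\<close>. It is invisible
  elsewhere as soon as \<open>P\<close> is constant below \<open>- L\<close>.\<close>

definition pot :: "(real \<Rightarrow> real) \<Rightarrow> real \<Rightarrow> complex \<Rightarrow> real" where
  "pot P L w = (if w \<in> D then P (ln (max (cmod (g w)) (exp (- L)))) else 0)"

text \<open>The chain rule applied to \<open>ln (cmod (g w))\<close>, whose gradient is the complex
  conjugate of \<open>logd w\<close>; \<open>p\<close> stands for the derivative of
  \<open>P\<close>.\<close>

definition pot_u :: "(real \<Rightarrow> real) \<Rightarrow> complex \<Rightarrow> real" where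
  "pot_u p w = (if w \<in> D then p (ln (cmod (g w))) * Re (logd w) else 0)"

definition pot_v :: "(real \<Rightarrow> real) \<Rightarrow> complex \<Rightarrow> real" where
  "pot_v p w = (if w \<in> D then - p (ln (cmod (g w))) * Im (logd w) else 0)"

lemma cont_g: "continuous_on D g" using hol by (rule holomorphic_on_imp_continuous_on)

lemma g0: "g 0 = 0" using zero D by simp

lemma open_nonzero: "open (D - {0})" using D by auto

lemma logd_holomorphic: "logd holomorphic_on D - {0}"
  unfolding logd_def using zero
  by (intro holomorphic_intros holomorphic_deriv[OF holomorphic_on_subset[OF hol]] holomorphic_on_subset[OF hol] open_nonzero) auto

end

text \<open>The logarithmic potential is flattened below \<open>- L\<close>, near the pole, and made
  zero above \<open>- e\<close>, near the boundary of \<open>D\<close>. The composite thus has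
  compact support in \<open>D\<close> and extends by zero to the whole plane, whatever the boundary
  looks like.\<close>

locale profile = disc_chart +
  fixes p P :: "real \<Rightarrow> real" and L e :: real
  assumes p: "continuous_on UNIV p" "\<And>t. t \<le> - L \<Longrightarrow> p t = 0" "\<And>t. - e \<le> t \<Longrightarrow> p t = 0"
    and P: "\<And>t. (P has_real_derivative p t) (at t)" "\<And>t. - e \<le> t \<Longrightarrow> P t = 0" and Le: "0 < e" "e < L"
begin

definition "K = {w \<in> D. cmod (g w) \<le> exp (- e)}"

lemma K: "compact K" "K \<subseteq> D" "closed K"
  using cpt[of "exp (- e)"] Le by (auto simp: K_def intro: compact_imp_closed)

lemma P_const: "t \<le> - L \<Longrightarrow> P t = P (- L)"
proof -
  assume t: "t \<le> - L"
  have "\<exists>c. \<forall>x\<in>{t..- L}. P x = c"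
    by (rule has_field_derivative_zero_constant) (use t p(2) in \<open>auto intro: has_field_derivative_at_within DERIV_cong[OF P(1)]\<close>)
  then show ?thesis using t by force
qed

lemma off_K: "w \<notin> K \<Longrightarrow> pot P L w = 0" "w \<notin> K \<Longrightarrow> pot_u p w = 0" "w \<notin> K \<Longrightarrow> pot_v p w = 0"
proof -
  assume w: "w \<notin> K"
  have *: "- e < ln (cmod (g w))" "max (cmod (g w)) (exp (- L)) = cmod (g w)" if "w \<in> D"
  proof -
    have "exp (- e) < cmod (g w)" using w that by (auto simp: K_def)
    moreover have "exp (- L) < exp (- e)" using Le by simp
    ultimately show "max (cmod (g w)) (exp (- L)) = cmod (g w)" by linarith
    show "- e < ln (cmod (g w))" using \<open>exp (- e) < cmod (g w)\<close> by (metis exp_gt_zero less_trans ln_exp ln_less_cancel_iff)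
  qed
  then show "pot P L w = 0" "pot_u p w = 0" "pot_v p w = 0"
    using P(2) p(3) by (auto simp: pot_def pot_u_def pot_v_def less_imp_le)
qed

lemma pot_nonzero: "w \<in> D \<Longrightarrow> g w \<noteq> 0 \<Longrightarrow> pot P L w = P (ln (cmod (g w)))"
proof -
  assume w: "w \<in> D" "g w \<noteq> 0"
  show ?thesis
  proof (cases "exp (- L) \<le> cmod (g w)")
    case False
    then have "ln (cmod (g w)) \<le> - L" using w by (metis ln_exp ln_le_cancel_iff exp_gt_zero nle_le zero_less_norm_iff)
    then show ?thesis using w False P_const[of "ln (cmod (g w))"] by (simp add: pot_def max_def)
  qed (use w in \<open>auto simp: pot_def max_def\<close>)
qed

lemma small_g:
  assumes "w \<in> D" "cmod (g w) < exp (- L)"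
  shows "pot P L w = P (- L)" "pot_u p w = 0" "pot_v p w = 0"
proof -
  show "pot P L w = P (- L)" using assms by (simp add: pot_def max_def)
  have "p (ln (cmod (g w))) = 0"
  proof (cases "g w = 0")
    case False
    then have "ln (cmod (g w)) \<le> - L" using assms by (metis ln_exp ln_le_cancel_iff exp_gt_zero less_imp_le zero_less_norm_iff)
    then show ?thesis by (rule p(2))
  \<comment> \<open>At the zero of \<open>g\<close> the default value \<open>ln 0 = 0\<close> falls
    into the range where \<open>p\<close> vanishes.\<close>
  qed (use p(3)[of 0] Le in simp)
  then show "pot_u p w = 0" "pot_v p w = 0" by (auto simp: pot_u_def pot_v_def)
qed

text \<open>Smoothness of the potential is a local question. The cases are a regular point of
  \<open>D\<close>, a neighbourhood on the plateau around the pole, and a neighbourhood that misses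
  the support.\<close>

lemma local_cases:
  obtains "w \<in> D" "w \<noteq> 0" | S where "open S" "w \<in> S" "\<And>z. z \<in> S \<Longrightarrow> z \<in> D \<and> cmod (g z) < exp (- L)"
    | S where "open S" "w \<in> S" "\<And>z. z \<in> S \<Longrightarrow> z \<notin> K"
proof -
  consider "w \<in> D" "w \<noteq> 0" | "w = 0" | "w \<notin> D" using D by blast
  then show thesis
  proof cases
    case 2
    have "open (D \<inter> (\<lambda>z. cmod (g z)) -` {..<exp (- L)})"
      by (intro continuous_open_preimage D continuous_on_norm cont_g) simp
    then show thesis by (rule that(2)) (use 2 D g0 in auto)
  next
    case 3
    then show thesis using K by (intro that(3)[of "- K"]) (auto simp: open_Compl)
  qed (use that in blast)
qed

lemma pot_derivative:
  "((\<lambda>u. pot P L (Complex u v)) has_real_derivative pot_u p (Complex u v)) (at u)"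
  "((\<lambda>v. pot P L (Complex u v)) has_real_derivative pot_v p (Complex u v)) (at v)"
proof -
  have lines: "open {u. Complex u v \<in> S}" "open {v. Complex u v \<in> S}" if "open S" for S u v
  proof -
    have "continuous_on UNIV (\<lambda>v. Complex u v)" "continuous_on UNIV (\<lambda>u. Complex u v)"
      unfolding Complex_eq by (intro continuous_intros)+
    from this[THEN open_vimage[OF that]]
    show "open {u. Complex u v \<in> S}" "open {v. Complex u v \<in> S}" by (simp_all add: vimage_def)
  qed
  define w where "w = Complex u v"
  have const: "((\<lambda>u. pot P L (Complex u v)) has_real_derivative 0) (at u)" "((\<lambda>v. pot P L (Complex u v)) has_real_derivative 0) (at v)"
    if "open S" "w \<in> S" "\<And>z. z \<in> S \<Longrightarrow> pot P L z = k" for S k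
    by (rule has_field_derivative_transform_within_open[of "\<lambda>_. k" _ _ "{u. Complex u v \<in> S}"];
        use that lines in \<open>auto simp: w_def\<close>)
      (rule has_field_derivative_transform_within_open[of "\<lambda>_. k" _ _ "{v. Complex u v \<in> S}"];
        use that lines in \<open>auto simp: w_def\<close>)
  have "((\<lambda>u. pot P L (Complex u v)) has_real_derivative pot_u p w) (at u) \<and>
    ((\<lambda>v. pot P L (Complex u v)) has_real_derivative pot_v p w) (at v)"
  proof (cases rule: local_cases[of w])
    case 1
    then have nz: "g w \<noteq> 0" using zero by simp
    have "(g has_field_derivative deriv g w) (at w)"
      using hol D 1 by (auto intro: holomorphic_derivI)
    note hd = holomorphic_line_derivative[OF this[unfolded w_def]]
    note d1 = DERIV_chain2[OF P(1) ln_cmod_has_derivative[OF hd(1) nz[unfolded w_def]]]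
      and d2 = DERIV_chain2[OF P(1) ln_cmod_has_derivative[OF hd(2) nz[unfolded w_def]]]
    have eq: "pot P L z = P (ln (cmod (g z)))" if "z \<in> D - {0}" for z
      using that zero by (intro pot_nonzero) auto
    have "((\<lambda>u. pot P L (Complex u v)) has_real_derivative p (ln (cmod (g w))) * Re (logd w)) (at u)"
      by (rule has_field_derivative_transform_within_open[OF d1[folded w_def] lines(1)[OF open_nonzero, of v], folded w_def logd_def])
        (use 1 in \<open>auto simp: w_def eq logd_def\<close>)
    moreover have "Re (\<i> * deriv g w / g w) = - Im (logd w)" by (simp add: logd_def Im_divide Re_divide diff_divide_distrib)
    then have "((\<lambda>v. pot P L (Complex u v)) has_real_derivative p (ln (cmod (g w))) * - Im (logd w)) (at v)"
      using has_field_derivative_transform_within_open[OF d2[folded w_def] lines(2)[OF open_nonzero, of u]] 1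
      by (auto simp: w_def eq)
    ultimately show ?thesis using 1 by (simp add: pot_u_def pot_v_def)
  next
    case (2 S)
    then show ?thesis using const[of S "P (- L)"] small_g by metis
  next
    case (3 S)
    then show ?thesis using const[of S 0] off_K by metis
  qed
  then show "((\<lambda>u. pot P L (Complex u v)) has_real_derivative pot_u p (Complex u v)) (at u)"
    "((\<lambda>v. pot P L (Complex u v)) has_real_derivative pot_v p (Complex u v)) (at v)" by (simp_all add: w_def)
qed

lemma pot_continuous: "continuous_on UNIV (pot P L)" "continuous_on UNIV (pot_u p)" "continuous_on UNIV (pot_v p)"
proof -
  have cont: "isCont (pot P L) w \<and> isCont (pot_u p) w \<and> isCont (pot_v p) w" for w
  proof (cases rule: local_cases[of w])
    case 1
    have "continuous_on (D - {0}) (\<lambda>z. ln (cmod (g z)))"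
      using zero by (intro continuous_intros continuous_on_subset[OF cont_g]) auto
    from continuous_on_compose2[OF p(1) this]
    have c: "continuous_on (D - {0}) (\<lambda>z. p (ln (cmod (g z))))" "continuous_on (D - {0}) (\<lambda>z. P (ln (cmod (g z))))"
      using continuous_on_compose2[OF DERIV_continuous_on[of UNIV P p] \<open>continuous_on (D - {0}) (\<lambda>z. ln (cmod (g z)))\<close>] P(1)
      by auto
    have lc: "continuous_on (D - {0}) logd" by (rule holomorphic_on_imp_continuous_on[OF logd_holomorphic])
    have "continuous_on (D - {0}) (\<lambda>z. p (ln (cmod (g z))) * Re (logd z))"
      "continuous_on (D - {0}) (\<lambda>z. - p (ln (cmod (g z))) * Im (logd z))"
      by (intro continuous_on_mult continuous_on_minus c(1) continuous_on_Re continuous_on_Im lc)+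
    moreover have "pot_u p z = p (ln (cmod (g z))) * Re (logd z)" "pot_v p z = - p (ln (cmod (g z))) * Im (logd z)"
      "pot P L z = P (ln (cmod (g z)))" if "z \<in> D - {0}" for z
      using that zero by (auto simp: pot_u_def pot_v_def intro!: pot_nonzero)
    ultimately have "continuous_on (D - {0}) (pot_u p)" "continuous_on (D - {0}) (pot_v p)" "continuous_on (D - {0}) (pot P L)"
      using c(2) by (metis (no_types, lifting) continuous_on_cong)+
    then show ?thesis using 1 open_nonzero by (simp add: continuous_on_eq_continuous_at)
  next
    case (2 S)
    have ev: "\<forall>\<^sub>F z in nhds w. z \<in> S" by (rule eventually_nhds_in_open[OF 2(1,2)])
    have "\<forall>\<^sub>F z in nhds w. pot P L z = P (- L)" "\<forall>\<^sub>F z in nhds w. pot_u p z = 0" "\<forall>\<^sub>F z in nhds w. pot_v p z = 0"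
      by (rule eventually_mono[OF ev], use 2(3) small_g in blast)+
    from this[THEN isCont_cong] show ?thesis by simp
  next
    case (3 S)
    have ev: "\<forall>\<^sub>F z in nhds w. z \<in> S" by (rule eventually_nhds_in_open[OF 3(1,2)])
    have "\<forall>\<^sub>F z in nhds w. pot P L z = 0" "\<forall>\<^sub>F z in nhds w. pot_u p z = 0" "\<forall>\<^sub>F z in nhds w. pot_v p z = 0"
      by (rule eventually_mono[OF ev], use 3(3) off_K in blast)+
    from this[THEN isCont_cong] show ?thesis by simp
  qed
  then show "continuous_on UNIV (pot P L)" "continuous_on UNIV (pot_u p)" "continuous_on UNIV (pot_v p)"
    by (simp_all add: continuous_at_imp_continuous_on)
qed

end

subsection \<open>The upper bound for the energy\<close>

context disc_chart
begin

text \<open>The quotient of \<open>g w\<close> by \<open>w\<close> with the singularity at 0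
  removed, in the shape in which \<open>pole_lemma\<close> provides it. It has no zero in
  \<open>D\<close>, so its logarithmic derivative \<open>regd\<close> is \<open>logd\<close> without
  the pole \<open>1 / w\<close>.\<close>

definition g1 :: "complex \<Rightarrow> complex" where
  "g1 w = (if w = 0 then deriv g 0 else (g w - g 0) / (w - 0))"

lemma g1: "g1 holomorphic_on D" "\<And>w. g w = w * g1 w" "\<And>w. w \<in> D \<Longrightarrow> g1 w \<noteq> 0"
proof -
  show "g1 holomorphic_on D"
    using pole_lemma[OF hol, of 0] D unfolding g1_def by (simp add: interior_open)
  show "g w = w * g1 w" for w by (simp add: g1_def g0)
  show "g1 w \<noteq> 0" if "w \<in> D" for w using zero[OF that] by (auto simp: g1_def g0 dg)
qed

definition regd :: "complex \<Rightarrow> complex" where "regd w = deriv g1 w / g1 w"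

lemma regd_continuous: "continuous_on D regd"
  unfolding regd_def using g1
  by (intro holomorphic_on_imp_continuous_on holomorphic_intros holomorphic_deriv D) auto

lemma logd_eq: "w \<in> D \<Longrightarrow> w \<noteq> 0 \<Longrightarrow> logd w = 1 / w + regd w"
proof -
  assume w: "w \<in> D" "w \<noteq> 0"
  have "(g1 has_field_derivative deriv g1 w) (at w)" using g1(1) D w by (auto intro: holomorphic_derivI)
  then have "((\<lambda>w. w * g1 w) has_field_derivative g1 w + w * deriv g1 w) (at w)"
    by (auto intro!: derivative_eq_intros)
  moreover have "(\<lambda>w. w * g1 w) = g" using g1(2) by auto
  ultimately have "deriv g w = g1 w + w * deriv g1 w" by (simp add: DERIV_imp_deriv)
  then show ?thesis using w g1(3) by (simp add: logd_def regd_def g1(2) divide_simps)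
qed

end

context profile
begin

text \<open>The part of the flux density through a vertical line that does not come from the pole.
  Being continuous in the whole plane, it has the same edge integral in the limit from the right and
  from the left.\<close>

definition reg :: "complex \<Rightarrow> real" where "reg w = pot P L w * Re (regd w)"

lemma reg_continuous: "continuous_on UNIV reg"
proof -
  have "isCont reg w" for w
  proof (cases "w \<in> D")
    case True
    have "continuous_on D reg"
      unfolding reg_def by (intro continuous_intros regd_continuous continuous_on_subset[OF pot_continuous(1)]) auto
    then show ?thesis using True D by (simp add: continuous_on_eq_continuous_at)
  next
    case False
    then have "w \<in> - K" using K by auto
    then have "\<forall>\<^sub>F z in nhds w. z \<in> - K" using K(3) by (intro eventually_nhds_in_open) (auto simp: open_Compl)
    then have "\<forall>\<^sub>F z in nhds w. reg z = 0" by eventually_elim (simp add: reg_def off_K)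
    from isCont_cong[OF this] show ?thesis by simp
  qed
  then show ?thesis by (simp add: continuous_at_imp_continuous_on)
qed

text \<open>Green's formula: the integrand is the divergence of \<open>pot P L\<close> times the
  gradient of the harmonic function \<open>ln (cmod (g w))\<close>, and by compact support only the
  left edge counts. There the part \<open>1 / w\<close> of \<open>logd\<close> gives the Poisson
  kernel \<open>h / (h\<^sup>2 + v\<^sup>2)\<close> of mass at most \<open>pi\<close>, with weight
  at most \<open>c\<close>; the other part is the integral of \<open>reg\<close>, which is kept
  exactly.\<close>

lemma energy_upper_bound:
  assumes M: "\<And>w. w \<in> K \<Longrightarrow> \<bar>Re w\<bar> < M \<and> \<bar>Im w\<bar> < M" and h: "0 < h" "h < M"
    and c: "\<And>w. - c \<le> pot P L w" "0 \<le> c"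
  shows "(LINT u:{h..M}|lborel. LINT v:{-M..M}|lborel.
      pot_u p (Complex u v) * Re (logd (Complex u v)) - pot_v p (Complex u v) * Im (logd (Complex u v)))
     \<le> pi * c - (LINT v:{-M..M}|lborel. reg (Complex h v))"
proof -
  define F1 where "F1 = (\<lambda>w. pot P L w * Re (logd w))"
  define F2 where "F2 = (\<lambda>w. pot P L w * - Im (logd w))"
  define d1 where "d1 = (\<lambda>w. pot_u p w * Re (logd w) + pot P L w * Re (deriv logd w))"
  define d2 where "d2 = (\<lambda>w. pot_v p w * - Im (logd w) - pot P L w * Re (deriv logd w))"
  have near0: "\<forall>\<^sub>F z in nhds w. z \<in> - K" if "w \<notin> D" for w
    by (rule eventually_nhds_in_open) (use that K in \<open>auto simp: open_Compl\<close>)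
  have der: "((\<lambda>u. F1 (Complex u v)) has_real_derivative d1 (Complex u v)) (at u)"
    "((\<lambda>v. F2 (Complex u v)) has_real_derivative d2 (Complex u v)) (at v)" if "0 < u" for u v
  proof -
    define w where "w = Complex u v"
    have "((\<lambda>u. F1 (Complex u v)) has_real_derivative d1 w) (at u) \<and> ((\<lambda>v. F2 (Complex u v)) has_real_derivative d2 w) (at v)"
    proof (cases "w \<in> D")
      case True
      have w0: "w \<noteq> 0" using that by (auto simp: w_def complex_eq_iff)
      have "(logd has_field_derivative deriv logd w) (at w)"
        using True w0 by (intro holomorphic_derivI[OF logd_holomorphic open_nonzero]) auto
      note l = holomorphic_line_derivative[OF this[unfolded w_def]]
      have "((\<lambda>u. Re (logd (Complex u v))) has_real_derivative Re (deriv logd w)) (at u)"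
        "((\<lambda>v. - Im (logd (Complex u v))) has_real_derivative - Re (deriv logd w)) (at v)"
        using bounded_linear.has_vector_derivative[OF bounded_linear_Re l(1)]
          has_vector_derivative_minus[OF bounded_linear.has_vector_derivative[OF bounded_linear_Im l(2)]]
        by (simp_all add: has_real_derivative_iff_has_vector_derivative w_def)
      from DERIV_mult[OF pot_derivative(1) this(1)] DERIV_mult[OF pot_derivative(2) this(2)]
      show ?thesis unfolding F1_def F2_def d1_def d2_def w_def by (simp add: algebra_simps)
    next
      case False
      obtain S where S: "open S" "w \<in> S" "\<And>z. z \<in> S \<Longrightarrow> z \<notin> K"
        using near0[OF False] by (auto simp: eventually_nhds)
      have c: "continuous_on UNIV (\<lambda>v. Complex u v)" "continuous_on UNIV (\<lambda>u. Complex u v)"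
        unfolding Complex_eq by (intro continuous_intros)+
      have o: "open {u. Complex u v \<in> S}" "open {v. Complex u v \<in> S}"
        using c[THEN open_vimage[OF S(1)]] by (simp_all add: vimage_def)
      have "d1 w = 0" "d2 w = 0" using S off_K by (auto simp: d1_def d2_def)
      moreover have "((\<lambda>u. F1 (Complex u v)) has_real_derivative 0) (at u)"
        by (rule has_field_derivative_transform_within_open[OF DERIV_const[of 0] o(1)])
          (use S off_K in \<open>auto simp: w_def F1_def\<close>)
      moreover have "((\<lambda>v. F2 (Complex u v)) has_real_derivative 0) (at v)"
        by (rule has_field_derivative_transform_within_open[OF DERIV_const[of 0] o(2)])
          (use S off_K in \<open>auto simp: w_def F2_def\<close>)
      ultimately show ?thesis by simp
    qed
    then show "((\<lambda>u. F1 (Complex u v)) has_real_derivative d1 (Complex u v)) (at u)"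
      "((\<lambda>v. F2 (Complex u v)) has_real_derivative d2 (Complex u v)) (at v)" by (simp_all add: w_def)
  qed
  have cont: "continuous_on {w. 0 < Re w} d1" "continuous_on {w. 0 < Re w} d2"
  proof -
    have "isCont d1 w \<and> isCont d2 w" if "0 < Re w" for w
    proof (cases "w \<in> D")
      case True
      have "deriv logd holomorphic_on D - {0}" by (intro holomorphic_deriv logd_holomorphic open_nonzero)
      then have l: "continuous_on (D - {0}) (deriv logd)" "continuous_on (D - {0}) logd"
        using logd_holomorphic by (auto intro: holomorphic_on_imp_continuous_on)
      have q: "continuous_on (D - {0}) (pot P L)" "continuous_on (D - {0}) (pot_u p)" "continuous_on (D - {0}) (pot_v p)"
        using pot_continuous by (auto intro: continuous_on_subset)
      have "continuous_on (D - {0}) d1" unfolding d1_def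
        by (intro continuous_on_add continuous_on_mult q continuous_on_Re l)
      moreover have "continuous_on (D - {0}) d2" unfolding d2_def
        by (intro continuous_on_diff continuous_on_mult q continuous_on_minus continuous_on_Re continuous_on_Im l)
      ultimately show ?thesis using True that open_nonzero by (auto simp: continuous_on_eq_continuous_at)
    next
      case False
      have "\<forall>\<^sub>F z in nhds w. d1 z = 0" "\<forall>\<^sub>F z in nhds w. d2 z = 0"
        by (rule eventually_mono[OF near0[OF False]], use off_K in \<open>auto simp: d1_def d2_def\<close>)+
      from this[THEN isCont_cong] show ?thesis by simp
    qed
    then show "continuous_on {w. 0 < Re w} d1" "continuous_on {w. 0 < Re w} d2"
      by (auto intro!: continuous_at_imp_continuous_on)
  qed
  \<comment> \<open>Freezing the abscissa at \<open>h\<close> to the left of the box continues the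
    integrand continuously to the plane, away from the pole, and so settles measurability.\<close>
  define E1 where "E1 = (\<lambda>q::real \<times> real. d1 (Complex (max h (fst q)) (snd q)))"
  define E2 where "E2 = (\<lambda>q::real \<times> real. d2 (Complex (max h (fst q)) (snd q)))"
  have cE: "continuous_on UNIV E1" "continuous_on UNIV E2"
    unfolding E1_def E2_def Complex_eq
    by (rule continuous_on_compose2[OF cont(1)] continuous_on_compose2[OF cont(2)];
        use h in \<open>auto intro!: continuous_intros\<close>)+
  have bE: "bdd_meas E1 {h..M} {-M..M}" "bdd_meas E2 {h..M} {-M..M}"
    by (rule bdd_meas_continuous; use cE in \<open>auto intro: continuous_on_subset borel_measurable_continuous_onI\<close>)+
  have "(LINT u:{h..M}|lborel. LINT v:{-M..M}|lborel.
      pot_u p (Complex u v) * Re (logd (Complex u v)) - pot_v p (Complex u v) * Im (logd (Complex u v)))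
     = (LINT u:{h..M}|lborel. LINT v:{-M..M}|lborel. E1 (u, v) + E2 (u, v))"
    by (intro set_lebesgue_integral_cong allI impI) (auto simp: E1_def E2_def d1_def d2_def max_def)
  also have "\<dots> = (LINT u:{h..M}|lborel. LINT v:{-M..M}|lborel. E1 (u, v)) + (LINT u:{h..M}|lborel. LINT v:{-M..M}|lborel. E2 (u, v))"
    by (rule bdd_meas_iterated_add[OF bE])
  also have "(LINT u:{h..M}|lborel. LINT v:{-M..M}|lborel. E2 (u, v)) = (LINT u:{h..M}|lborel. 0)"
  proof (intro set_lebesgue_integral_cong allI impI)
    fix u assume u: "u \<in> {h..M}"
    have "(LINT v:{-M..M}|lborel. E2 (u, v)) = F2 (Complex u M) - F2 (Complex u (- M))"
    proof (rule set_integral_FTC)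
      fix x show "((\<lambda>v. F2 (Complex u v)) has_real_derivative E2 (u, x)) (at x within {-M..M})"
        using der(2)[of u x] u h by (auto simp: E2_def max_def intro: has_field_derivative_at_within)
    next
      show "continuous_on {-M..M} (\<lambda>x. E2 (u, x))"
        by (rule continuous_on_compose2[OF cE(2)]) (auto intro!: continuous_intros)
    qed (use h in auto)
    moreover have "Complex u M \<notin> K" "Complex u (- M) \<notin> K" using M[of "Complex u M"] M[of "Complex u (- M)"] by auto
    ultimately show "(LINT v:{-M..M}|lborel. E2 (u, v)) = 0" by (simp add: F2_def off_K)
  qed simp
  also have "(LINT u:{h..M}|lborel. LINT v:{-M..M}|lborel. E1 (u, v)) = (LINT v:{-M..M}|lborel. LINT u:{h..M}|lborel. E1 (u, v))"
    by (rule bdd_meas_integral_fst(2)[OF bE(1)])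
  also have "\<dots> \<le> (LINT v:{-M..M}|lborel. c * (h / (h\<^sup>2 + v\<^sup>2)) - reg (Complex h v))"
  proof (rule set_integral_mono)
    show "set_integrable lborel {-M..M} (\<lambda>v. LINT u:{h..M}|lborel. E1 (u, v))"
      using bdd_meas_integral_fst(1)[OF bdd_meas_swap[OF bE(1)]] by simp
    have "continuous_on {-M..M} (\<lambda>v. reg (Complex h v))"
      by (rule continuous_on_Complex_compose[OF reg_continuous]) (intro continuous_intros)+
    then show "set_integrable lborel {-M..M} (\<lambda>v. c * (h / (h\<^sup>2 + v\<^sup>2)) - reg (Complex h v))"
      by (intro borel_integrable_atLeastAtMost' continuous_intros) (use h in \<open>auto simp: sum_power2_eq_zero_iff\<close>)
    fix v assume "v \<in> {-M..M}"
    have "(LINT u:{h..M}|lborel. E1 (u, v)) = F1 (Complex M v) - F1 (Complex h v)"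
    proof (rule set_integral_FTC)
      fix x assume "h \<le> x" "x \<le> M"
      then show "((\<lambda>u. F1 (Complex u v)) has_real_derivative E1 (x, v)) (at x within {h..M})"
        using der(1)[of x v] h by (auto simp: E1_def max_def intro: has_field_derivative_at_within)
    next
      show "continuous_on {h..M} (\<lambda>x. E1 (x, v))"
        by (rule continuous_on_compose2[OF cE(1)]) (auto intro!: continuous_intros)
    qed (use h in auto)
    also have "F1 (Complex M v) = 0" using M[of "Complex M v"] off_K h by (auto simp: F1_def)
    also have "0 - F1 (Complex h v) \<le> c * (h / (h\<^sup>2 + v\<^sup>2)) - reg (Complex h v)"
    proof (cases "Complex h v \<in> D")
      case True
      have "logd (Complex h v) = 1 / Complex h v + regd (Complex h v)"
        using h by (intro logd_eq True) (auto simp: complex_eq_iff)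
      then have "F1 (Complex h v) = pot P L (Complex h v) * (h / (h\<^sup>2 + v\<^sup>2)) + reg (Complex h v)"
        by (simp add: F1_def reg_def Re_divide algebra_simps)
      moreover have "- c * (h / (h\<^sup>2 + v\<^sup>2)) \<le> pot P L (Complex h v) * (h / (h\<^sup>2 + v\<^sup>2))"
        using h c by (intro mult_right_mono) auto
      ultimately show ?thesis by simp
    next
      case False
      then have "pot P L (Complex h v) = 0" using K off_K by blast
      then show ?thesis using c h by (simp add: F1_def reg_def)
    qed
    finally show "(LINT u:{h..M}|lborel. E1 (u, v)) \<le> c * (h / (h\<^sup>2 + v\<^sup>2)) - reg (Complex h v)" .
  qed
  also have "\<dots> = (LINT v:{-M..M}|lborel. c * (h / (h\<^sup>2 + v\<^sup>2))) - (LINT v:{-M..M}|lborel. reg (Complex h v))"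
  proof (rule set_integral_diff(2))
    have "continuous_on {-M..M} (\<lambda>v. reg (Complex h v))"
      by (rule continuous_on_Complex_compose[OF reg_continuous]) (intro continuous_intros)+
    then show "set_integrable lborel {-M..M} (\<lambda>v. reg (Complex h v))" by (rule borel_integrable_atLeastAtMost')
    show "set_integrable lborel {-M..M} (\<lambda>v. c * (h / (h\<^sup>2 + v\<^sup>2)))"
      by (intro borel_integrable_atLeastAtMost' continuous_intros) (use h in \<open>auto simp: sum_power2_eq_zero_iff\<close>)
  qed
  also have "(LINT v:{-M..M}|lborel. c * (h / (h\<^sup>2 + v\<^sup>2))) = c * arctan (M / h) - c * arctan (- M / h)"
  proof (rule set_integral_FTC)
    fix x
    have "((\<lambda>v. arctan (v / h)) has_real_derivative inverse (1 + (x / h)\<^sup>2) * (1 / h)) (at x within {-M..M})"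
      using h by (auto intro!: derivative_eq_intros)
    moreover have "inverse (1 + (x / h)\<^sup>2) * (1 / h) = h / (h\<^sup>2 + x\<^sup>2)"
    proof -
      have "1 + (x / h)\<^sup>2 = (h\<^sup>2 + x\<^sup>2) / h\<^sup>2" using h by (simp add: power_divide add_divide_distrib)
      then show ?thesis using h by (simp add: power2_eq_square)
    qed
    ultimately show "((\<lambda>v. c * arctan (v / h)) has_real_derivative c * (h / (h\<^sup>2 + x\<^sup>2))) (at x within {-M..M})"
      using DERIV_cmult by fastforce
  next
    show "continuous_on {-M..M} (\<lambda>v. c * (h / (h\<^sup>2 + v\<^sup>2)))"
      by (intro continuous_intros) (use h in \<open>auto simp: sum_power2_eq_zero_iff\<close>)
  qed (use h in auto)
  also have "\<dots> \<le> pi * c"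
  proof -
    have "c * arctan (M / h) \<le> c * (pi / 2)" using arctan_ubound[of "M / h"] c by (intro mult_left_mono) auto
    moreover have "c * (- (pi / 2)) \<le> c * arctan (- M / h)" using arctan_lbound[of "- M / h"] c by (intro mult_left_mono) auto
    ultimately show ?thesis by (simp add: algebra_simps)
  qed
  finally show ?thesis by simp
qed

end

subsection \<open>Points reached by graphs over the real axis\<close>

text \<open>Points over positive abscissae that lie on a curve of the kind the theorem asks for;
  negative abscissae are handled by reflection. Any vertical segment inside this set comes with such
  a curve over its abscissa.\<close>

definition reach :: "complex set \<Rightarrow> complex set" where
  "reach D = {w. 0 < Re w \<and> (\<exists>\<gamma>. continuous_on {0..Re w} \<gamma> \<and> \<gamma> 0 = 0 \<and> \<gamma> (Re w) = Im w \<and>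
      (\<forall>u\<in>{0..Re w}. Complex u (\<gamma> u) \<in> D))}"

lemma reachE:
  assumes "Complex u y \<in> reach D"
  obtains \<gamma> where "0 < u" "continuous_on {0..u} \<gamma>" "\<gamma> 0 = 0" "\<gamma> u = y" "\<And>t. t \<in> {0..u} \<Longrightarrow> Complex t (\<gamma> t) \<in> D"
  using assms by (auto simp: reach_def)

lemma reachI:
  assumes "0 < u" "continuous_on {0..u} \<gamma>" "\<gamma> 0 = 0" "\<gamma> u = y" "\<And>t. t \<in> {0..u} \<Longrightarrow> Complex t (\<gamma> t) \<in> D"
  shows "Complex u y \<in> reach D"
  using assms by (auto simp: reach_def)

lemma reach_subset: "reach D \<subseteq> D"
proof
  fix w assume "w \<in> reach D"
  then obtain \<gamma> where "0 < Re w" "\<gamma> (Re w) = Im w" "\<forall>u\<in>{0..Re w}. Complex u (\<gamma> u) \<in> D" by (auto simp: reach_def)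
  then have "Complex (Re w) (\<gamma> (Re w)) \<in> D" by (metis atLeastAtMost_iff less_imp_le order_refl)
  then have "Complex (Re w) (Im w) \<in> D" using \<open>\<gamma> (Re w) = Im w\<close> by simp
  then show "w \<in> D" by simp
qed

lemma dist_Complex_le: "dist (Complex a b) (Complex c d) \<le> \<bar>a - c\<bar> + \<bar>b - d\<bar>"
  using cmod_le[of "Complex a b - Complex c d"] by (simp add: dist_norm)

text \<open>The graph is kept up to \<open>u - r\<close> and then sheared linearly so that it ends
  at height \<open>y'\<close>. For small \<open>r\<close> the sheared piece stays within
  \<open>e\<close> of the vertical segment, and by compactness the segment has an
  \<open>e\<close>-neighbourhood inside \<open>D\<close>.\<close>

lemma reach_leaf:
  assumes D: "open D" and w: "Complex u y \<in> reach D" and seg: "\<And>t. t \<in> closed_segment y y' \<Longrightarrow> Complex u t \<in> D"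
  shows "Complex u y' \<in> reach D"
proof -
  obtain \<gamma> where \<gamma>: "0 < u" "continuous_on {0..u} \<gamma>" "\<gamma> 0 = 0" "\<gamma> u = y" "\<And>t. t \<in> {0..u} \<Longrightarrow> Complex t (\<gamma> t) \<in> D"
    using reachE[OF w] by metis
  have "compact ((\<lambda>t. Complex u t) ` closed_segment y y')"
    unfolding Complex_eq by (intro compact_continuous_image continuous_intros compact_segment)
  then obtain e where e: "e > 0" "(\<Union>x\<in>(\<lambda>t. Complex u t) ` closed_segment y y'. ball x e) \<subseteq> D"
    using compact_subset_open_imp_ball_epsilon_subset[OF _ D] seg by blast
  obtain s where s: "s > 0" "\<And>t. t \<in> {0..u} \<Longrightarrow> dist t u < s \<Longrightarrow> dist (\<gamma> t) (\<gamma> u) < e / 2"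
    using \<gamma>(1,2) e(1) unfolding continuous_on_iff by (metis atLeastAtMost_iff half_gt_zero less_imp_le order_refl)
  define r where "r = min (s / 2) (min (e / 4) (u / 2))"
  have r: "0 < r" "r < s" "r < e / 2" "r < u" using s(1) e(1) \<gamma>(1) by (auto simp: r_def min_def)
  define l where "l = (\<lambda>t. max 0 ((t - (u - r)) / r))"
  show ?thesis
  proof (rule reachI[where \<gamma>="\<lambda>t. \<gamma> t + (y' - y) * l t"])
    show "continuous_on {0..u} (\<lambda>t. \<gamma> t + (y' - y) * l t)"
      unfolding l_def using r by (intro continuous_intros \<gamma>) auto
    have "(0 - (u - r)) / r \<le> 0" using r by (intro divide_nonpos_pos) auto
    then have "l 0 = 0" by (simp add: l_def)
    moreover have "l u = 1" using r by (simp add: l_def)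
    ultimately show "\<gamma> 0 + (y' - y) * l 0 = 0" "\<gamma> u + (y' - y) * l u = y'"
      using \<gamma>(3,4) by simp_all
    fix t assume t: "t \<in> {0..u}"
    show "Complex t (\<gamma> t + (y' - y) * l t) \<in> D"
    proof (cases "t \<le> u - r")
      case True
      then have "(t - (u - r)) / r \<le> 0" using r by (intro divide_nonpos_pos) auto
      then have "l t = 0" by (simp add: l_def)
      then show ?thesis using \<gamma>(5)[OF t] by simp
    next
      case False
      then have l: "0 \<le> l t" "l t \<le> 1" using r t by (auto simp: l_def max_def field_simps)
      have "dist (\<gamma> t) (\<gamma> u) < e / 2" using False r t by (intro s) (auto simp: dist_real_def)
      then have "\<bar>\<gamma> t - y\<bar> < e / 2" using \<gamma>(4) by (simp add: dist_real_def)
      define p where "p = y + l t * (y' - y)"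
      have "p \<in> closed_segment y y'" unfolding p_def using l
        by (auto simp: in_segment intro!: exI[of _ "l t"] simp: algebra_simps)
      moreover have "dist (Complex t (\<gamma> t + (y' - y) * l t)) (Complex u p) < e"
      proof -
        have "\<bar>t - u\<bar> < e / 2" using False r t by auto
        moreover have "\<gamma> t + (y' - y) * l t - p = \<gamma> t - y" by (simp add: p_def algebra_simps)
        ultimately show ?thesis
          using dist_Complex_le[of t "\<gamma> t + (y' - y) * l t" u p] \<open>\<bar>\<gamma> t - y\<bar> < e / 2\<close> by linarith
      qed
      ultimately have "Complex u p \<in> (\<lambda>t. Complex u t) ` closed_segment y y'"
        "Complex t (\<gamma> t + (y' - y) * l t) \<in> ball (Complex u p) e" by (auto simp: dist_commute)
      then show ?thesis using e(2) by blast
    qed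
  qed (use \<gamma> in auto)
qed

lemma reach_right:
  assumes w: "Complex u y \<in> reach D" and le: "u \<le> u'" and seg: "\<And>t. t \<in> {u..u'} \<Longrightarrow> Complex t y \<in> D"
  shows "Complex u' y \<in> reach D"
proof -
  obtain \<gamma> where \<gamma>: "0 < u" "continuous_on {0..u} \<gamma>" "\<gamma> 0 = 0" "\<gamma> u = y" "\<And>t. t \<in> {0..u} \<Longrightarrow> Complex t (\<gamma> t) \<in> D"
    using reachE[OF w] by metis
  show ?thesis
  proof (rule reachI[where \<gamma>="\<lambda>t. \<gamma> (min t u)"])
    show "continuous_on {0..u'} (\<lambda>t. \<gamma> (min t u))"
      by (rule continuous_on_compose2[OF \<gamma>(2)]) (use \<gamma>(1) in \<open>auto intro!: continuous_intros\<close>)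
    show "Complex t (\<gamma> (min t u)) \<in> D" if "t \<in> {0..u'}" for t
      using that \<gamma>(4,5) seg[of t] by (cases "t \<le> u") (auto simp: min_def)
  qed (use \<gamma> le in \<open>auto simp: min_def\<close>)
qed

lemma reach_prefix:
  assumes "continuous_on {0..u} \<gamma>" "\<gamma> 0 = 0" "\<And>t. t \<in> {0..u} \<Longrightarrow> Complex t (\<gamma> t) \<in> D" "0 < s" "s \<le> u"
  shows "Complex s (\<gamma> s) \<in> reach D"
  by (rule reachI[where \<gamma>=\<gamma>]) (use assms in \<open>auto intro: continuous_on_subset\<close>)

text \<open>A nearby point further to the right is reached by a vertical move followed by a
  horizontal one. For one further to the left the given graph is stopped earlier, and its end point,
  close to \<open>y\<close> by continuity, is joined to the new point vertically.\<close>

lemma open_reach: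
  assumes D: "open D" shows "open (reach D)"
  unfolding open_contains_ball
proof
  fix w0 assume w0: "w0 \<in> reach D"
  define u y where "u = Re w0" and "y = Im w0"
  have w0': "Complex u y \<in> reach D" using w0 by (simp add: u_def y_def)
  then obtain \<gamma> where \<gamma>: "0 < u" "continuous_on {0..u} \<gamma>" "\<gamma> 0 = 0" "\<gamma> u = y" "\<And>t. t \<in> {0..u} \<Longrightarrow> Complex t (\<gamma> t) \<in> D"
    using reachE by metis
  have "Complex u y \<in> D" using w0' reach_subset by auto
  then obtain e where e: "e > 0" "ball (Complex u y) e \<subseteq> D" using D open_contains_ball by blast
  have inD: "Complex a b \<in> D" if "\<bar>a - u\<bar> + \<bar>b - y\<bar> < e" for a b
    using dist_Complex_le[of a b u y] that e(2) by (force simp: dist_commute)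
  obtain s where s: "s > 0" "\<And>t. t \<in> {0..u} \<Longrightarrow> dist t u < s \<Longrightarrow> dist (\<gamma> t) (\<gamma> u) < e / 2"
    using \<gamma>(1,2) e(1) unfolding continuous_on_iff by (metis atLeastAtMost_iff half_gt_zero less_imp_le order_refl)
  define r where "r = min (e / 2) (min s u)"
  have r: "0 < r" "r \<le> e / 2" "r \<le> s" "r \<le> u" using e s \<gamma> by (auto simp: r_def)
  have "ball w0 r \<subseteq> reach D"
  proof
    fix w assume "w \<in> ball w0 r"
    then have n: "cmod (w - w0) < r" by (simp add: dist_norm norm_minus_commute)
    define a b where "a = Re w" and "b = Im w"
    have ab: "\<bar>a - u\<bar> < r" "\<bar>b - y\<bar> < r"
      using abs_Re_le_cmod[of "w - w0"] abs_Im_le_cmod[of "w - w0"] n by (auto simp: a_def b_def u_def y_def)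
    have seg: "\<bar>t - y\<bar> < e / 2" if "t \<in> closed_segment p b" "\<bar>p - y\<bar> < e / 2" for t p
      proof -
      have "p \<le> t \<and> t \<le> b \<or> b \<le> t \<and> t \<le> p" using that(1) by (auto simp: closed_segment_eq_real_ivl split: if_splits)
      then show ?thesis using that(2) ab r by linarith
    qed
    have "Complex a b \<in> reach D"
    proof (cases "u \<le> a")
      case True
      have "Complex u b \<in> reach D"
      proof (rule reach_leaf[OF D w0'])
        fix t assume "t \<in> closed_segment y b"
        from seg[OF this] show "Complex u t \<in> D" using e(1) by (intro inD) auto
      qed
      then show ?thesis
        by (rule reach_right[OF _ True]) (use ab r in \<open>auto intro!: inD\<close>)
    next
      case False
      have a0: "0 < a" using ab r by auto
      have "Complex a (\<gamma> a) \<in> reach D" by (rule reach_prefix[OF \<gamma>(2,3,5)]) (use a0 False in auto)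
      moreover have "dist (\<gamma> a) (\<gamma> u) < e / 2" using a0 False ab r by (intro s) (auto simp: dist_real_def)
      then have "\<bar>\<gamma> a - y\<bar> < e / 2" using \<gamma>(4) by (simp add: dist_real_def)
      ultimately show ?thesis
      proof (elim reach_leaf[OF D])
        fix t assume "t \<in> closed_segment (\<gamma> a) b"
        from seg[OF this \<open>\<bar>\<gamma> a - y\<bar> < e / 2\<close>] show "Complex a t \<in> D" using ab r by (intro inD) linarith
      qed
    qed
    then show "w \<in> reach D" by (simp add: a_def b_def)
  qed
  then show "\<exists>e>0. ball w0 e \<subseteq> reach D" using r(1) by blast
qed

lemma reach_near:
  assumes "\<And>z. cmod z < d \<Longrightarrow> z \<in> D" "cmod w < d" "0 < Re w" shows "w \<in> reach D"
proof -
  have "Complex (Re w) (Im w) \<in> reach D"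
  proof (rule reachI[where \<gamma>="\<lambda>t. t * (Im w / Re w)"])
    fix t assume t: "t \<in> {0..Re w}"
    have "Complex t (t * (Im w / Re w)) = of_real (t / Re w) * w" using assms(3) by (simp add: complex_eq_iff)
    then have "cmod (Complex t (t * (Im w / Re w))) = \<bar>t / Re w\<bar> * cmod w" by (metis norm_mult norm_of_real)
    also have "\<bar>t / Re w\<bar> = t / Re w" using t assms(3) by simp
    also have "t / Re w * cmod w \<le> 1 * cmod w" using t assms(3) by (intro mult_right_mono) (auto simp: divide_le_eq_1)
    finally show "Complex t (t * (Im w / Re w)) \<in> D" using assms by simp
  qed (use assms in \<open>auto intro!: continuous_intros\<close>)
  then show ?thesis by simp
qed

section \<open>The two energy bounds in one half plane\<close>

context disc_chart
begin

text \<open>The energy density of the potential with slope \<open>p\<close> is the integrand of the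
  upper bound for the slope \<open>(p t)\<^sup>2\<close>, hence the second profile with
  antiderivative \<open>P2\<close>. The assumption \<open>P (- L) \<le> P2 t\<close> lets both
  bounds use the constant \<open>- P (- L)\<close>.\<close>

lemma half_estimate:
  assumes short: "\<And>u a b. (\<And>t. t \<in> {a..b} \<Longrightarrow> Complex u t \<in> reach D) \<Longrightarrow> b - a \<le> pi / 2"
    and p: "continuous_on UNIV p" "\<And>t. t \<le> - L \<Longrightarrow> p t = 0" "\<And>t. - e \<le> t \<Longrightarrow> p t = 0"
    and P: "\<And>t. (P has_real_derivative p t) (at t)" "\<And>t. - e \<le> t \<Longrightarrow> P t = 0" "\<And>t. P t \<le> 0"
    and P2: "\<And>t. (P2 has_real_derivative (p t)\<^sup>2) (at t)" "\<And>t. - e \<le> t \<Longrightarrow> P2 t = 0" "\<And>t. P (- L) \<le> P2 t"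
    and Le: "0 < e" "e < L"
    and phi: "continuous_on UNIV phi" "\<And>t. - k \<le> t \<Longrightarrow> phi t = 1"
    and Q: "\<And>t. (Q has_real_derivative (phi t)\<^sup>2) (at t)" "Q 0 = 0" "\<And>t. t \<le> 0 \<Longrightarrow> - c' \<le> Q t \<and> Q t \<le> 0" "0 \<le> c'"
    and cut: "\<And>w. w \<in> D \<Longrightarrow> 0 < Re w \<Longrightarrow> \<bar>Im w\<bar> \<le> pi / 4 \<Longrightarrow> exp (- L) < cmod (g w) \<Longrightarrow> - k \<le> psi (Re w) (Im w)"
    and r: "0 < r" "\<And>u v. r \<le> u \<Longrightarrow> \<bar>v\<bar> \<le> pi / 4 \<Longrightarrow> - k \<le> psi u v"
    and d: "0 < d" "d \<le> pi / 4" "\<And>w. cmod w < d \<Longrightarrow> w \<in> D \<and> cmod (g w) < exp (- L)"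
    and M: "1 \<le> M" "\<And>w. w \<in> D \<Longrightarrow> cmod (g w) \<le> exp (- e) \<Longrightarrow> \<bar>Re w\<bar> < M \<and> \<bar>Im w\<bar> < M"
    and h: "0 < h" "h < M" "h \<le> d / 2"
    and B: "B \<in> sets borel" "\<And>u v. (u, v) \<in> B \<Longrightarrow> Complex u v \<in> reach D \<and> - k \<le> psi u v"
  shows "4 * (- P (- L)) * arctan (sin (d / 2) / sinh (2 * h)) - pi * c' - 4 * pi * r
       + (LINT u:{h..M}|lborel. LINT v:{- (pi / 4)..pi / 4}|lborel. indicator B (u, v) * (pot_u p (Complex u v) - psi_u u v)\<^sup>2)
     \<le> pi * (- P (- L)) - (LINT v:{-M..M}|lborel. pot P2 L (Complex h v) * Re (regd (Complex h v)))"
proof -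
  interpret a: profile D g p P L e by unfold_locales (fact p P Le)+
  interpret b: profile D g "\<lambda>t. (p t)\<^sup>2" P2 L e
    by unfold_locales (use p P2 Le in \<open>auto intro!: continuous_intros\<close>)
  have posc: "P (- L) \<le> 0" by (rule P(3))
  have pot_pos: "pot P L w \<le> 0" "P (- L) \<le> pot P2 L w" for w
    using P(3) P2(3) posc by (auto simp: pot_def)
  have K: "w \<in> a.K \<Longrightarrow> \<bar>Re w\<bar> < M \<and> \<bar>Im w\<bar> < M" for w
    using M(2)[of w] by (simp add: a.K_def)
  have K2: "w \<in> b.K \<Longrightarrow> \<bar>Re w\<bar> < M \<and> \<bar>Im w\<bar> < M" for w
    using M(2)[of w] by (simp add: b.K_def)
  interpret rh: right_half D "reach D" a.K "pot P L" "pot_u p" "pot_v p" phi Q M d h r "- P (- L)" c' k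
  proof unfold_locales
    show "w \<in> reach D" if "cmod w < d" "0 < Re w" for w
      by (rule reach_near[of d]) (use d that in auto)
    show "pot P L w = - (- P (- L))" if "cmod w < d" for w using a.small_g(1)[of w] d(3)[OF that] by simp
    show "- k \<le> psi u v" if "Complex u v \<in> reach D" "\<bar>v\<bar> \<le> pi / 4" "pot_u p (Complex u v) \<noteq> 0 \<or> pot_v p (Complex u v) \<noteq> 0" for u v
    proof -
      have w: "Complex u v \<in> D" "0 < u" using that(1) reach_subset by (auto simp: reach_def)
      have "\<not> cmod (g (Complex u v)) < exp (- L)" using a.small_g(2,3)[OF w(1)] that(3) by auto
      \<comment> \<open>On the level \<open>exp (- L)\<close> itself \<open>p\<close> already
        vanishes, so the strict inequality in \<open>cut\<close> is enough.\<close>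
      moreover have "cmod (g (Complex u v)) \<noteq> exp (- L)"
      proof
        assume "cmod (g (Complex u v)) = exp (- L)"
        then have "ln (cmod (g (Complex u v))) = - L" by simp
        then have "p (ln (cmod (g (Complex u v)))) = 0" using p(2)[of "- L"] by simp
        then have "pot_u p (Complex u v) = 0" "pot_v p (Complex u v) = 0" by (simp_all add: pot_u_def pot_v_def)
        then show False using that(3) by simp
      qed
      ultimately show ?thesis using cut[of "Complex u v"] w that(2) by simp
    qed
    show "Complex u y' \<in> reach D" if "Complex u y \<in> reach D" "\<And>t. t \<in> closed_segment y y' \<Longrightarrow> Complex u t \<in> D" for u y y'
      by (rule reach_leaf[OF D(1)]) fact+
    show "Complex u' y \<in> reach D" if "Complex u y \<in> reach D" "u \<le> u'" "\<And>t. t \<in> {u..u'} \<Longrightarrow> Complex t y \<in> D" for u u' y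
      by (rule reach_right) fact+
  qed (fact D(1) open_reach[OF D(1)] reach_subset short a.pot_derivative a.pot_continuous a.K K a.off_K pot_pos d phi Q r h M
      | use posc in simp)+
  have "(pot_u p w)\<^sup>2 + (pot_v p w)\<^sup>2 = pot_u (\<lambda>t. (p t)\<^sup>2) w * Re (logd w) - pot_v (\<lambda>t. (p t)\<^sup>2) w * Im (logd w)" for w
    by (cases "w \<in> D") (simp_all add: pot_u_def pot_v_def power2_eq_square)
  then have "(LINT u:{h..M}|lborel. LINT v:{-M..M}|lborel. (pot_u p (Complex u v))\<^sup>2 + (pot_v p (Complex u v))\<^sup>2)
     = (LINT u:{h..M}|lborel. LINT v:{-M..M}|lborel. pot_u (\<lambda>t. (p t)\<^sup>2) (Complex u v) * Re (logd (Complex u v))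
          - pot_v (\<lambda>t. (p t)\<^sup>2) (Complex u v) * Im (logd (Complex u v)))"
    by simp
  also have "\<dots> \<le> pi * (- P (- L)) - (LINT v:{-M..M}|lborel. b.reg (Complex h v))"
    by (rule b.energy_upper_bound[OF K2 h(1,2)]) (use pot_pos posc in auto)
  finally show ?thesis
    using rh.energy_lower_bound[OF B] by (simp add: b.reg_def)
qed

end

subsection \<open>Both halves together\<close>

lemma nonneg_derivative_mono:
  fixes F f :: "real \<Rightarrow> real"
  assumes "\<And>t. (F has_real_derivative f t) (at t)" "a \<le> b" "\<And>t. a \<le> t \<Longrightarrow> t \<le> b \<Longrightarrow> 0 \<le> f t"
  shows "F a \<le> F b"
  by (rule DERIV_nonneg_imp_nondecreasing[OF assms(2)]) (use assms in blast)

text \<open>A trapezoid of height 1 with ramps of length \<open>e\<close>. Its antiderivative rises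
  by at least the length \<open>L - 3 * e\<close> of the top side, and since the square of
  \<open>p\<close> is at most \<open>p\<close>, the antiderivative of the square does not fall below
  \<open>P (- L)\<close>.\<close>

lemma pole_profile:
  assumes e: "0 < e" "3 * e < L"
  obtains p P P2 :: "real \<Rightarrow> real" where "continuous_on UNIV p"
    "\<And>t. t \<le> - L \<Longrightarrow> p t = 0" "\<And>t. - e \<le> t \<Longrightarrow> p t = 0" "\<And>t. - L + e \<le> t \<Longrightarrow> t \<le> - 2 * e \<Longrightarrow> p t = 1"
    "\<And>t. (P has_real_derivative p t) (at t)" "\<And>t. - e \<le> t \<Longrightarrow> P t = 0" "\<And>t. P t \<le> 0"
    "\<And>t. (P2 has_real_derivative (p t)\<^sup>2) (at t)" "\<And>t. - e \<le> t \<Longrightarrow> P2 t = 0" "\<And>t. P (- L) \<le> P2 t"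
    "L - 3 * e \<le> - P (- L)"
proof -
  define p where "p = (\<lambda>t. max 0 (min 1 (min ((t + L) / e) ((- e - t) / e))))"
  have clip: "max 0 (min 1 (min x y)) = 0" if "x \<le> 0 \<or> y \<le> 0" for x y :: real
    using that unfolding max_def min_def by auto
  have p01: "0 \<le> p t" "p t \<le> 1" for t by (auto simp: p_def)
  have p_sq: "(p t)\<^sup>2 \<le> p t" for t using p01[of t] by (simp add: power2_eq_square mult_left_le_one_le)
  have c: "continuous_on UNIV p" unfolding p_def by (intro continuous_intros) (use e in auto)
  have z1: "p t = 0" if "t \<le> - L" for t
  proof -
    have "(t + L) / e \<le> 0" using that e by (intro divide_nonpos_pos) auto
    then show ?thesis unfolding p_def by (intro clip disjI1)
  qed
  have z2: "p t = 0" if "- e \<le> t" for t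
  proof -
    have "(- e - t) / e \<le> 0" using that e by (intro divide_nonpos_pos) auto
    then show ?thesis unfolding p_def by (intro clip disjI2)
  qed
  have one: "p t = 1" if "- L + e \<le> t" "t \<le> - 2 * e" for t
  proof -
    have "1 \<le> (t + L) / e" "1 \<le> (- e - t) / e" using that e by (auto simp: field_simps)
    then show ?thesis by (auto simp: p_def max_def min_def)
  qed
  have c2: "continuous_on UNIV (\<lambda>t. (p t)\<^sup>2)" by (intro continuous_intros c)
  obtain P where P: "\<And>t. (P has_real_derivative p t) (at t)" "P (- e) = 0"
    using antiderivative_exists[OF c z1] by metis
  obtain P2 where P2: "\<And>t. (P2 has_real_derivative (p t)\<^sup>2) (at t)" "P2 (- e) = 0"
    using antiderivative_exists[OF c2, of "- L" "- e"] z1 by (metis zero_power2)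
  have mono: "P a \<le> P b" if "a \<le> b" for a b by (rule nonneg_derivative_mono[OF P(1) that p01(1)])
  have neg: "((\<lambda>t. - P t) has_real_derivative - p t) (at t)" "((\<lambda>t. - P2 t) has_real_derivative - (p t)\<^sup>2) (at t)" for t
    using DERIV_minus P(1) P2(1) by blast+
  have P0: "P t = 0" if "- e \<le> t" for t
    using mono[OF that] nonneg_derivative_mono[OF neg(1) that] z2 P(2) by force
  have P20: "P2 t = 0" if "- e \<le> t" for t
    using nonneg_derivative_mono[OF P2(1) that] nonneg_derivative_mono[OF neg(2) that] z2 P2(2) by force
  have Pm: "P t \<le> 0" for t using mono[of t "- e"] P0[of t] P(2) by linarith
  have PL: "P (- L) \<le> P t" for t
  proof (cases "- L \<le> t")
    case False
    then show ?thesis using nonneg_derivative_mono[OF neg(1), of t "- L"] z1 by force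
  qed (rule mono)
  have "P t \<le> P2 t" for t
  proof (cases "- e \<le> t")
    case False
    have "P t - P2 t \<le> P (- e) - P2 (- e)"
      by (rule nonneg_derivative_mono[where F="\<lambda>t. P t - P2 t" and f="\<lambda>t. p t - (p t)\<^sup>2"])
        (use False p_sq in \<open>auto intro!: DERIV_diff P P2\<close>)
    then show ?thesis using P(2) P2(2) by simp
  qed (simp add: P0 P20)
  then have P2L: "P (- L) \<le> P2 t" for t using PL[of t] by (meson order_trans)
  have "P (- L + e) - (- L + e) \<le> P (- 2 * e) - (- 2 * e)"
  proof (rule nonneg_derivative_mono[where F="\<lambda>t. P t - t" and f="\<lambda>t. p t - 1"])
    show "((\<lambda>t. P t - t) has_real_derivative p t - 1) (at t)" for t by (intro DERIV_diff P DERIV_ident)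
  qed (use e one in auto)
  moreover have "P (- L) \<le> P (- L + e)" using e by (intro mono) simp
  ultimately have "L - 3 * e \<le> - P (- L)" using Pm[of "- 2 * e"] by linarith
  from that[OF c z1 z2 one P(1) P0 Pm P2(1) P20 P2L this] show thesis .
qed

text \<open>A ramp of length \<open>e\<close> below \<open>- k\<close>, so the depth that bounds the
  strip energy exceeds \<open>k\<close> by no more than \<open>e\<close>.\<close>

lemma cutoff_profile:
  assumes e: "0 < e" "0 \<le> k"
  obtains phi Q :: "real \<Rightarrow> real" where "continuous_on UNIV phi" "\<And>t. - k \<le> t \<Longrightarrow> phi t = 1"
    "\<And>t. (Q has_real_derivative (phi t)\<^sup>2) (at t)" "Q 0 = 0" "\<And>t. t \<le> 0 \<Longrightarrow> - (k + e) \<le> Q t \<and> Q t \<le> 0"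
proof -
  define phi where "phi = (\<lambda>t. max 0 (min 1 ((t + k + e) / e)))"
  have c: "continuous_on UNIV phi" unfolding phi_def by (intro continuous_intros) (use e in auto)
  have z: "phi t = 0" if "t \<le> - (k + e)" for t
  proof -
    have "(t + k + e) / e \<le> 0" using that e by (intro divide_nonpos_pos) auto
    then show ?thesis by (auto simp: phi_def max_def min_def)
  qed
  have one: "phi t = 1" if "- k \<le> t" for t
  proof -
    have "1 \<le> (t + k + e) / e" using that e by (auto simp: field_simps)
    then show ?thesis by (auto simp: phi_def max_def min_def)
  qed
  have sq: "(phi t)\<^sup>2 \<le> 1" for t by (simp add: phi_def power_le_one)
  have c2: "continuous_on UNIV (\<lambda>t. (phi t)\<^sup>2)" by (intro continuous_intros c)
  obtain Q where Q: "\<And>t. (Q has_real_derivative (phi t)\<^sup>2) (at t)" "Q 0 = 0"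
    using antiderivative_exists[OF c2, of "- (k + e)" 0] z by (metis zero_power2)
  have neg: "((\<lambda>t. - Q t) has_real_derivative - (phi t)\<^sup>2) (at t)" for t using DERIV_minus Q(1) by blast
  have mono: "Q a \<le> Q b" if "a \<le> b" for a b by (rule nonneg_derivative_mono[OF Q(1) that]) simp
  have low: "- (k + e) \<le> Q t" if "- (k + e) \<le> t" "t \<le> 0" for t
  proof -
    have "t - Q t \<le> 0 - Q 0"
    proof (rule nonneg_derivative_mono[where F="\<lambda>t. t - Q t" and f="\<lambda>t. 1 - (phi t)\<^sup>2"])
      show "((\<lambda>t. t - Q t) has_real_derivative 1 - (phi t)\<^sup>2) (at t)" for t by (intro DERIV_diff Q DERIV_ident)
    qed (use that sq in auto)
    then show ?thesis using that Q(2) by linarith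
  qed
  have "- (k + e) \<le> Q t \<and> Q t \<le> 0" if "t \<le> 0" for t
  proof (cases "- (k + e) \<le> t")
    case False
    then have "- Q t \<le> - Q (- (k + e))" by (intro nonneg_derivative_mono[OF neg]) (use z in auto)
    then show ?thesis using low[of "- (k + e)"] mono[OF that] Q(2) e by linarith
  qed (use low mono[OF that] Q(2) that in auto)
  from that[OF c one Q this] show thesis .
qed

section \<open>Reflection in the imaginary axis\<close>

definition mirror :: "complex \<Rightarrow> complex" where "mirror w = - cnj w"

lemma mirror_simps [simp]:
  "mirror (mirror w) = w" "cmod (mirror w) = cmod w" "Re (mirror w) = - Re w" "Im (mirror w) = Im w" "mirror 0 = 0"
  "mirror (Complex u v) = Complex (- u) v" "mirror w = 0 \<longleftrightarrow> w = 0"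
  by (auto simp: mirror_def complex_eq_iff)

lemma mirror_has_derivative:
  assumes "(g has_field_derivative g') (at (mirror w))"
  shows "((\<lambda>w. mirror (g (mirror w))) has_field_derivative cnj g') (at w)"
proof -
  have "((\<lambda>w. g (- w)) has_field_derivative g' * (-1)) (at (cnj w))"
    by (rule DERIV_chain2[of g]) (use assms in \<open>auto simp: mirror_def intro!: derivative_eq_intros\<close>)
  from has_field_derivative_cnj_cnj[OF this]
  have "(cnj \<circ> (\<lambda>w. g (- w)) \<circ> cnj has_field_derivative - cnj g') (at w)" by simp
  from DERIV_minus[OF this] show ?thesis by (simp add: mirror_def o_def)
qed

context disc_chart
begin

text \<open>Conjugating \<open>g\<close> on both sides by the reflection gives a holomorphic
  function again, so right half plane estimates for it speak about the left half plane of the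
  original domain.\<close>

lemma disc_chart_mirror: "disc_chart (mirror -` D) (\<lambda>w. mirror (g (mirror w)))"
proof
  have cm: "continuous_on A mirror" for A unfolding mirror_def by (intro continuous_intros)
  show "open (mirror -` D)" by (rule open_vimage[OF D(1) cm])
  have der: "((\<lambda>w. mirror (g (mirror w))) has_field_derivative cnj (deriv g (mirror w))) (at w)" if "mirror w \<in> D" for w
    by (rule mirror_has_derivative) (use that hol D in \<open>auto intro: holomorphic_derivI\<close>)
  then show "(\<lambda>w. mirror (g (mirror w))) holomorphic_on mirror -` D"
    unfolding holomorphic_on_def field_differentiable_def by (auto intro: has_field_derivative_at_within)
  show "deriv (\<lambda>w. mirror (g (mirror w))) 0 = 1" using DERIV_imp_deriv[OF der[of 0]] D dg by simp
  show "compact {w \<in> mirror -` D. cmod (mirror (g (mirror w))) \<le> s}" if "s < 1" for s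
  proof -
    have "{w \<in> mirror -` D. cmod (mirror (g (mirror w))) \<le> s} = mirror ` {w \<in> D. cmod (g w) \<le> s}"
      by (auto simp: image_iff) (metis mirror_simps(1,2))
    then show ?thesis using compact_continuous_image[OF cm cpt[OF that]] by simp
  qed
qed (use D zero in auto)

lemma mirror_logd:
  assumes "mirror w \<in> D"
  shows "disc_chart.logd (\<lambda>w. mirror (g (mirror w))) w = mirror (logd (mirror w))"
proof -
  interpret m: disc_chart "mirror -` D" "\<lambda>w. mirror (g (mirror w))" by (rule disc_chart_mirror)
  have "((\<lambda>w. mirror (g (mirror w))) has_field_derivative cnj (deriv g (mirror w))) (at w)"
    by (rule mirror_has_derivative) (use assms hol D in \<open>auto intro: holomorphic_derivI\<close>)
  then show ?thesis by (simp add: m.logd_def logd_def DERIV_imp_deriv) (simp add: mirror_def)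
qed

lemma mirror_regd:
  assumes "mirror w \<in> D" "w \<noteq> 0"
  shows "disc_chart.regd (\<lambda>w. mirror (g (mirror w))) w = mirror (regd (mirror w))"
proof -
  interpret m: disc_chart "mirror -` D" "\<lambda>w. mirror (g (mirror w))" by (rule disc_chart_mirror)
  have "1 / w + m.regd w = mirror (1 / mirror w + regd (mirror w))"
    using m.logd_eq[of w] logd_eq[of "mirror w"] mirror_logd[OF assms(1)] assms by simp
  also have "\<dots> = 1 / w + mirror (regd (mirror w))" by (simp add: mirror_def)
  finally show ?thesis by simp
qed

end

lemma set_integral_Icc_indicator:
  fixes a b c d k :: real
  assumes "a \<le> c" "c \<le> d" "d \<le> b"
  shows "(LINT x:{a..b}|lborel. k * indicator {c..d} x) = k * (d - c)"
proof -
  have "(\<lambda>x. indicator {a..b} x *\<^sub>R (k * indicator {c..d} x)) = (\<lambda>x. k * (indicator {c..d} x :: real))"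
    using assms by (auto simp: indicator_def)
  then show ?thesis using assms(2) by (simp only: set_lebesgue_integral_def) simp
qed

text \<open>This allows the edge integrals to be followed onto the imaginary axis.\<close>

lemma continuous_on_line_integral:
  fixes F :: "complex \<Rightarrow> real"
  assumes "continuous_on UNIV F"
  shows "continuous_on UNIV (\<lambda>h. LINT v:{a..b}|lborel. F (Complex h v))"
proof -
  have "continuous_on (UNIV \<times> cbox a b) (\<lambda>(h, v). F (Complex h v))"
    unfolding case_prod_beta by (rule continuous_on_Complex_compose[OF assms]) (intro continuous_intros)+
  from integral_continuous_on_param[OF this]
  have "continuous_on UNIV (\<lambda>h. integral {a..b} (\<lambda>v. F (Complex h v)))" by simp
  moreover have "(LINT v:{a..b}|lborel. F (Complex h v)) = integral {a..b} (\<lambda>v. F (Complex h v))" for h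
  proof (rule set_borel_integral_eq_integral)
    have "continuous_on {a..b} (\<lambda>v. F (Complex h v))"
      by (rule continuous_on_Complex_compose[OF assms]) (intro continuous_intros)+
    then show "set_integrable lborel {a..b} (\<lambda>v. F (Complex h v))" by (rule borel_integrable_atLeastAtMost')
  qed
  ultimately show ?thesis by simp
qed

context disc_chart
begin

text \<open>With \<open>c = - P (- L)\<close>, adding both halves sets \<open>8 * c * A h\<close>
  against \<open>2 * pi * c\<close>. As \<open>h\<close> tends to 0, \<open>A h\<close> tends to
  \<open>pi / 2\<close> and the edge integrals \<open>J h\<close> and \<open>J (- h)\<close> cancel.
  There remain \<open>2 * pi * (c' - c)\<close>, the gap between the two truncation depths, and the
  loss \<open>8 * pi * r\<close> near the axis.\<close>

lemma two_sided_estimate: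
  assumes short: "\<And>u a b. (\<And>t. t \<in> {a..b} \<Longrightarrow> Complex u t \<in> reach D) \<Longrightarrow> b - a \<le> pi / 2"
    and short': "\<And>u a b. (\<And>t. t \<in> {a..b} \<Longrightarrow> Complex u t \<in> reach (mirror -` D)) \<Longrightarrow> b - a \<le> pi / 2"
    and p: "continuous_on UNIV p" "\<And>t. t \<le> - L \<Longrightarrow> p t = 0" "\<And>t. - e \<le> t \<Longrightarrow> p t = 0"
    and P: "\<And>t. (P has_real_derivative p t) (at t)" "\<And>t. - e \<le> t \<Longrightarrow> P t = 0" "\<And>t. P t \<le> 0"
    and P2: "\<And>t. (P2 has_real_derivative (p t)\<^sup>2) (at t)" "\<And>t. - e \<le> t \<Longrightarrow> P2 t = 0" "\<And>t. P (- L) \<le> P2 t"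
    and Le: "0 < e" "e < L"
    and phi: "continuous_on UNIV phi" "\<And>t. - k \<le> t \<Longrightarrow> phi t = 1"
    and Q: "\<And>t. (Q has_real_derivative (phi t)\<^sup>2) (at t)" "Q 0 = 0" "\<And>t. t \<le> 0 \<Longrightarrow> - c' \<le> Q t \<and> Q t \<le> 0" "0 \<le> c'"
    and cut: "\<And>w. w \<in> D \<Longrightarrow> Re w \<noteq> 0 \<Longrightarrow> \<bar>Im w\<bar> \<le> pi / 4 \<Longrightarrow> exp (- L) < cmod (g w) \<Longrightarrow> - k \<le> psi (Re w) (Im w)"
    and r: "0 < r" "\<And>u v. r \<le> u \<Longrightarrow> \<bar>v\<bar> \<le> pi / 4 \<Longrightarrow> - k \<le> psi u v"
    and d: "0 < d" "d \<le> pi / 4" "\<And>w. cmod w < d \<Longrightarrow> w \<in> D \<and> cmod (g w) < exp (- L)"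
    and M: "1 \<le> M" "\<And>w. w \<in> D \<Longrightarrow> cmod (g w) \<le> exp (- e) \<Longrightarrow> \<bar>Re w\<bar> < M \<and> \<bar>Im w\<bar> < M"
    and box: "0 < u1" "u1 \<le> u2" "u2 \<le> M" "- (pi / 4) \<le> v1" "v1 \<le> v2" "v2 \<le> pi / 4"
    and in_box: "\<And>u v. u \<in> {u1..u2} \<Longrightarrow> v \<in> {v1..v2} \<Longrightarrow>
      Complex u v \<in> reach D \<and> - k \<le> psi u v \<and> \<kappa> \<le> (pot_u p (Complex u v) - psi_u u v)\<^sup>2"
  shows "\<kappa> * ((u2 - u1) * (v2 - v1)) \<le> 2 * pi * (c' + P (- L)) + 8 * pi * r"
proof -
  interpret a: profile D g p P L e by unfold_locales (fact p P Le)+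
  interpret b: profile D g "\<lambda>t. (p t)\<^sup>2" P2 L e
    by unfold_locales (use p P2 Le in \<open>auto intro!: continuous_intros\<close>)
  interpret m: disc_chart "mirror -` D" "\<lambda>w. mirror (g (mirror w))" by (rule disc_chart_mirror)
  define J where "J = (\<lambda>h. LINT v:{-M..M}|lborel. b.reg (Complex h v))"
  define A where "A = (\<lambda>h. arctan (sin (d / 2) / sinh (2 * h)))"
  define c where "c = - P (- L)"
  define B where "B = {u1..u2} \<times> {v1..v2}"
  define F where "F = (\<lambda>q. indicator B q * (pot_u p (Complex (fst q) (snd q)) - psi_u (fst q) (snd q))\<^sup>2)"
  have Bm: "B \<in> sets borel" unfolding B_def by (intro borel_closed closed_Times) auto
  have cut1: "- k \<le> psi (Re w) (Im w)"
    if "w \<in> D" "0 < Re w" "\<bar>Im w\<bar> \<le> pi / 4" "exp (- L) < cmod (g w)" for w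
    using cut[of w] that by simp
  have inB: "Complex u v \<in> reach D \<and> - k \<le> psi u v" if "(u, v) \<in> B" for u v
    using that in_box unfolding B_def by blast
  have ineq: "\<kappa> * ((u2 - u1) * (v2 - v1)) \<le> 2 * pi * c + 2 * pi * c' + 8 * pi * r - 8 * c * A h - J h + J (- h)"
    if h: "0 < h" "h < M" "h \<le> d / 2" "h \<le> u1" for h
  proof -
    have "4 * (- P (- L)) * A h - pi * c' - 4 * pi * r
       + (LINT u:{h..M}|lborel. LINT v:{- (pi / 4)..pi / 4}|lborel. indicator B (u, v) * (pot_u p (Complex u v) - psi_u u v)\<^sup>2)
     \<le> pi * (- P (- L)) - (LINT v:{-M..M}|lborel. pot P2 L (Complex h v) * Re (regd (Complex h v)))"
      unfolding A_def
      by (rule half_estimate[OF short p P P2 Le phi Q cut1 r d M h(1-3) Bm inB])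
    moreover have "(LINT u:{h..M}|lborel. LINT v:{- (pi / 4)..pi / 4}|lborel. \<kappa> * indicator B (u, v))
      \<le> (LINT u:{h..M}|lborel. LINT v:{- (pi / 4)..pi / 4}|lborel. F (u, v))"
    proof (rule bdd_meas_iterated_mono[where F="\<lambda>q. \<kappa> * indicator B q"])
      show "bdd_meas F {h..M} {- (pi / 4)..pi / 4}"
        unfolding F_def by (intro bdd_meas_intros Bm bdd_meas_complex a.pot_continuous bdd_meas_strip h)
      show "\<kappa> * indicator B (u, v) \<le> F (u, v)" for u v
        using in_box[of u v] by (auto simp: F_def B_def indicator_def)
    qed (intro bdd_meas_intros Bm)
    moreover have "(LINT v:{- (pi / 4)..pi / 4}|lborel. \<kappa> * indicator B (u, v)) = (\<kappa> * (v2 - v1)) * indicator {u1..u2} u" for u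
    proof -
      have "(\<lambda>v. \<kappa> * indicator B (u, v)) = (\<lambda>v. (\<kappa> * indicator {u1..u2} u) * indicator {v1..v2} v)"
        by (auto simp: B_def indicator_def)
      then show ?thesis using set_integral_Icc_indicator[OF box(4-6)] by simp
    qed
    then have "(LINT u:{h..M}|lborel. LINT v:{- (pi / 4)..pi / 4}|lborel. \<kappa> * indicator B (u, v)) = \<kappa> * (v2 - v1) * (u2 - u1)"
      by (simp only: set_integral_Icc_indicator[OF h(4) box(2,3)])
    \<comment> \<open>In the reflected half the deviation is discarded by taking the empty set for
      \<open>B\<close>.\<close>
    moreover have "4 * (- P (- L)) * A h - pi * c' - 4 * pi * r
       + (LINT u:{h..M}|lborel. LINT v:{- (pi / 4)..pi / 4}|lborel. indicator {} (u, v) * (m.pot_u p (Complex u v) - psi_u u v)\<^sup>2)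
     \<le> pi * (- P (- L)) - (LINT v:{-M..M}|lborel. m.pot P2 L (Complex h v) * Re (m.regd (Complex h v)))"
      unfolding A_def
    proof (rule m.half_estimate[OF short' p P P2 Le phi Q _ r d(1,2) _ M(1) _ h(1-3)])
      show "- k \<le> psi (Re w) (Im w)" if "w \<in> mirror -` D" "0 < Re w" "\<bar>Im w\<bar> \<le> pi / 4"
        "exp (- L) < cmod (mirror (g (mirror w)))" for w
        using cut[of "mirror w"] that by (simp add: psi_def)
      show "w \<in> mirror -` D \<and> cmod (mirror (g (mirror w))) < exp (- L)" if "cmod w < d" for w
        using d(3)[of "mirror w"] that by simp
      show "\<bar>Re w\<bar> < M \<and> \<bar>Im w\<bar> < M" if "w \<in> mirror -` D" "cmod (mirror (g (mirror w))) \<le> exp (- e)" for w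
        using M(2)[of "mirror w"] that by simp
    qed simp_all
    moreover have "(LINT v:{-M..M}|lborel. m.pot P2 L (Complex h v) * Re (m.regd (Complex h v))) = - J (- h)"
    proof -
      \<comment> \<open>Reflection reverses the sign of the real part of \<open>regd\<close>; this
        is the sign that makes the two edge integrals cancel.\<close>
      have "m.pot P2 L (Complex h v) * Re (m.regd (Complex h v)) = - b.reg (Complex (- h) v)" for v
      proof (cases "Complex (- h) v \<in> D")
        case True
        then have "m.regd (Complex h v) = mirror (regd (Complex (- h) v))"
          using mirror_regd[of "Complex h v"] h by (simp add: complex_eq_iff)
        then show ?thesis by (simp add: m.pot_def pot_def b.reg_def)
      qed (simp add: m.pot_def pot_def b.reg_def)
      then show ?thesis by (simp add: J_def set_lebesgue_integral_def)
    qed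
    ultimately show ?thesis
      unfolding F_def J_def b.reg_def by (simp add: c_def algebra_simps)
  qed
  have "((\<lambda>h. 2 * pi * c + 2 * pi * c' + 8 * pi * r - 8 * c * A h - J h + J (- h)) \<longlongrightarrow>
      2 * pi * c + 2 * pi * c' + 8 * pi * r - 8 * c * (pi / 2) - J 0 + J 0) (at_right 0)"
  proof (intro tendsto_intros)
    have "filterlim (\<lambda>h. sin (d / 2) / sinh (2 * h)) at_top (at_right 0)"
    proof (rule LIM_at_top_divide)
      show "((\<lambda>h. sin (d / 2)) \<longlongrightarrow> sin (d / 2)) (at_right (0::real))" by simp
      show "0 < sin (d / 2)" using d pi_gt_zero by (intro sin_gt_zero) auto
      have "isCont (\<lambda>h::real. sinh (2 * h)) 0" by (intro continuous_intros)
      then have "((\<lambda>h::real. sinh (2 * h)) \<longlongrightarrow> sinh (2 * 0)) (at 0)" by (simp add: isCont_def)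
      then show "((\<lambda>h::real. sinh (2 * h)) \<longlongrightarrow> 0) (at_right 0)" by (simp add: filterlim_at_split)
      show "\<forall>\<^sub>F h in at_right 0. 0 < sinh (2 * h :: real)"
        unfolding eventually_at_right_field by (intro exI[of _ 1]) auto
    qed
    then show "(A \<longlongrightarrow> pi / 2) (at_right 0)" unfolding A_def by (rule filterlim_compose[OF tendsto_arctan_at_top])
    have J: "continuous_on UNIV J" unfolding J_def by (rule continuous_on_line_integral[OF b.reg_continuous])
    then have "isCont J 0" "isCont (\<lambda>h. J (- h)) 0"
      by (auto simp: continuous_on_eq_continuous_at intro!: continuous_on_interior[of UNIV] continuous_on_compose2[OF J] continuous_intros)
    then show "(J \<longlongrightarrow> J 0) (at_right 0)" "((\<lambda>h. J (- h)) \<longlongrightarrow> J 0) (at_right 0)"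
      by (simp_all add: isCont_def filterlim_at_split)
  qed
  moreover have "\<forall>\<^sub>F h in at_right 0. \<kappa> * ((u2 - u1) * (v2 - v1)) \<le> 2 * pi * c + 2 * pi * c' + 8 * pi * r - 8 * c * A h - J h + J (- h)"
    unfolding eventually_at_right_field
    using ineq M(1) d(1) box(1) by (intro exI[of _ "min (1 / 2) (min (d / 2) u1)"]) auto
  ultimately have "\<kappa> * ((u2 - u1) * (v2 - v1)) \<le> 2 * pi * c + 2 * pi * c' + 8 * pi * r - 8 * c * (pi / 2) - J 0 + J 0"
    by (rule tendsto_lowerbound) simp
  then show ?thesis by (simp add: c_def algebra_simps)
qed

end

subsection \<open>Comparison with the hyperbolic tangent\<close>

lemma cmod_sinh_cosh_squared:
  fixes w :: complex
  shows "(cmod (sinh w))\<^sup>2 = (cosh (2 * Re w) - cos (2 * Im w)) / 2" "(cmod (cosh w))\<^sup>2 = (cosh (2 * Re w) + cos (2 * Im w)) / 2"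
proof -
  have "(cmod (sinh w))\<^sup>2 = (cmod (sin (\<i> * w)))\<^sup>2" by (simp add: sinh_conv_sin norm_mult)
  also have "\<dots> = (cosh (2 * Re w) - cos (2 * Im w)) / 2"
    by (simp add: norm_sin_squared cosh_field_def exp_minus field_simps)
  finally show "(cmod (sinh w))\<^sup>2 = (cosh (2 * Re w) - cos (2 * Im w)) / 2" .
  have "(cmod (cosh w))\<^sup>2 = (cos (Im w))\<^sup>2 + (sinh (Re w))\<^sup>2"
    by (simp add: cosh_conv_cos norm_cos_squared sinh_field_def exp_minus power_divide)
  also have "\<dots> = (cosh (2 * Re w) + cos (2 * Im w)) / 2"
    by (simp only: cosh_double_cosh cosh_square_eq cos_double_cos) (simp add: field_simps)
  finally show "(cmod (cosh w))\<^sup>2 = (cosh (2 * Re w) + cos (2 * Im w)) / 2" .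
qed

lemma psi_eq_ln_tanh:
  assumes "u \<noteq> 0"
  shows "psi u v = ln (cmod (sinh (Complex u v)) / cmod (cosh (Complex u v)))" "sinh (Complex u v) \<noteq> 0" "cosh (Complex u v) \<noteq> 0"
proof -
  define x where "x = cos (2 * v) / cosh (2 * u)"
  define w where "w = Complex u v"
  have x: "\<bar>x\<bar> < 1" using cos_div_cosh_bounds[OF assms] by (simp add: x_def)
  have C: "cosh (2 * u) > 0" by simp
  have cs: "cos (2 * v) = x * cosh (2 * u)" using C by (simp add: x_def)
  have s2: "(cmod (sinh w))\<^sup>2 = cosh (2 * u) / 2 * (1 - x)" and c2: "(cmod (cosh w))\<^sup>2 = cosh (2 * u) / 2 * (1 + x)"
    unfolding cmod_sinh_cosh_squared w_def complex.sel cs by (simp_all add: algebra_simps)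
  have pos: "0 < (cmod (sinh w))\<^sup>2" "0 < (cmod (cosh w))\<^sup>2"
    unfolding s2 c2 using x C by (intro mult_pos_pos; simp add: abs_less_iff)+
  then show nz: "sinh (Complex u v) \<noteq> 0" "cosh (Complex u v) \<noteq> 0" by (auto simp: w_def)
  have "(1 + x) / (1 - x) = (cmod (cosh w))\<^sup>2 / (cmod (sinh w))\<^sup>2"
    unfolding s2 c2 using C x by simp
  also have "\<dots> = inverse ((cmod (sinh w) / cmod (cosh w))\<^sup>2)" by (simp add: power_divide)
  finally have "ln ((1 + x) / (1 - x)) = - (2 * ln (cmod (sinh w) / cmod (cosh w)))"
    using nz by (simp add: ln_inverse ln_realpow w_def)
  then show "psi u v = ln (cmod (sinh (Complex u v)) / cmod (cosh (Complex u v)))"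
    by (simp add: psi_def artanh_def x_def[symmetric] w_def[symmetric])
qed

lemma psi_u_eq:
  assumes "u \<noteq> 0"
  shows "psi_u u v = Re (2 / sinh (2 * Complex u v))"
proof -
  have sh: "sinh (Complex a b) = Complex (sinh a * cos b) (cosh a * sin b)" for a b
  proof -
    have "sinh (\<i> * of_real b) = \<i> * of_real (sin b)"
      using sin_conv_sinh[of "of_real b"] by (simp add: sin_of_real)
    moreover have "cosh (\<i> * of_real b) = of_real (cos b)"
      using cos_conv_cosh[of "of_real b"] by (simp add: cos_of_real)
    moreover have "sinh (of_real a :: complex) = of_real (sinh a)" "cosh (of_real a :: complex) = of_real (cosh a)"
      by (simp_all add: sinh_field_def cosh_field_def flip: exp_of_real)
    ultimately show ?thesis by (simp add: Complex_eq sinh_add complex_eq_iff)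
  qed
  define N where "N = (sinh (2 * u) * cos (2 * v))\<^sup>2 + (cosh (2 * u) * sin (2 * v))\<^sup>2"
  have "N = strip_den u v"
    unfolding N_def strip_den_def power_mult_distrib cosh_square_eq cos_squared_eq by (simp add: algebra_simps)
  have "2 * Complex u v = Complex (2 * u) (2 * v)" by (simp add: complex_eq_iff)
  then have "Re (2 / sinh (2 * Complex u v)) = 2 * (sinh (2 * u) * cos (2 * v)) / N"
    by (simp add: sh Re_divide N_def)
  then show ?thesis using \<open>N = strip_den u v\<close> by (simp add: psi_u_def)
qed

lemma artanh_real_mono:
  assumes "- 1 < x" "x \<le> y" "y < (1::real)" shows "artanh x \<le> artanh y"
proof -
  have "(1 + x) / (1 - x) \<le> (1 + y) / (1 - y)" using assms by (intro frac_le) auto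
  moreover have "0 < (1 + x) / (1 - x)" using assms by simp
  ultimately show ?thesis by (simp add: artanh_def)
qed

text \<open>The quotient inside \<open>artanh\<close> stays below some \<open>q < 1\<close>: either
  \<open>cosh (2 * u)\<close> is bounded away from 1, or \<open>cos (2 * v)\<close> is.\<close>

lemma psi_bounded_off_pole:
  assumes \<delta>: "0 < \<delta>" "\<delta> \<le> pi / 4"
  obtains k where "\<And>u v. u \<noteq> 0 \<Longrightarrow> \<bar>v\<bar> \<le> pi / 4 \<Longrightarrow> \<delta> \<le> \<bar>u\<bar> \<or> \<delta> \<le> \<bar>v\<bar> \<Longrightarrow> - k \<le> psi u v"
proof
  define q where "q = max (1 / cosh (2 * \<delta>)) (cos (2 * \<delta>))"
  have "1\<^sup>2 < (cosh (2 * \<delta>))\<^sup>2" using \<delta> by (simp add: cosh_square_eq)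
  then have "1 < cosh (2 * \<delta>)" by (rule power2_less_imp_less) simp
  moreover have "cos (2 * \<delta>) < cos 0" using \<delta> pi_gt_zero by (intro cos_monotone_0_pi) auto
  ultimately have q: "q < 1" by (simp add: q_def)
  fix u v :: real assume uv: "u \<noteq> 0" "\<bar>v\<bar> \<le> pi / 4" and far: "\<delta> \<le> \<bar>u\<bar> \<or> \<delta> \<le> \<bar>v\<bar>"
  have c: "0 \<le> cos (2 * v)" by (rule cos_double_nonneg) fact
  have "cos (2 * v) / cosh (2 * u) \<le> q"
  proof (cases "\<delta> \<le> \<bar>u\<bar>")
    case True
    have "cosh (2 * \<delta>) \<le> cosh (2 * \<bar>u\<bar>)" using True \<delta> by (simp add: cosh_real_nonneg_le_iff)
    then have "cosh (2 * \<delta>) \<le> cosh (2 * u)" by (cases "0 \<le> u") auto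
    then have "cos (2 * v) / cosh (2 * u) \<le> 1 / cosh (2 * \<delta>)" by (intro frac_le) auto
    then show ?thesis by (simp add: q_def)
  next
    case False
    then have "\<delta> \<le> \<bar>v\<bar>" using far by simp
    then have "cos (2 * \<bar>v\<bar>) \<le> cos (2 * \<delta>)" using \<delta> uv pi_gt_zero by (intro cos_monotone_0_pi_le) auto
    then have "cos (2 * v) \<le> cos (2 * \<delta>)" by (cases "0 \<le> v") auto
    moreover have "cos (2 * v) / cosh (2 * u) \<le> cos (2 * v) / 1" using c by (intro divide_left_mono) (auto simp: cosh_real_ge_1)
    ultimately show ?thesis by (simp add: q_def)
  qed
  moreover have "- 1 < cos (2 * v) / cosh (2 * u)" using cos_div_cosh_bounds[OF uv(1), of "2 * v"] by linarith
  ultimately show "- artanh q \<le> psi u v" unfolding psi_def using artanh_real_mono q by simp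
qed

context disc_chart
begin

text \<open>\<open>g\<close> and tanh both vanish at 0 with derivative 1, so the quotient of their
  moduli tends to 1. This places the truncation of \<open>g\<close> and the cut of the strip
  potential at the same depth, up to \<open>\<epsilon>\<close>.\<close>

lemma ln_g_le_psi_near:
  assumes "0 < \<epsilon>"
  obtains \<delta> where "0 < \<delta>" "\<And>w. w \<in> D \<Longrightarrow> cmod w < \<delta> \<Longrightarrow> Re w \<noteq> 0 \<Longrightarrow> ln (cmod (g w)) - \<epsilon> \<le> psi (Re w) (Im w)"
proof -
  have "(g has_field_derivative 1) (at 0)"
    using holomorphic_derivI[OF hol D] dg by simp
  then have "((\<lambda>w. g w / w) \<longlongrightarrow> 1) (at 0)" by (simp add: has_field_derivative_iff g0)
  moreover have "((sinh :: complex \<Rightarrow> complex) has_field_derivative 1) (at 0)"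
    by (auto intro!: derivative_eq_intros)
  then have "((\<lambda>w::complex. sinh w / w) \<longlongrightarrow> 1) (at 0)" by (simp add: has_field_derivative_iff)
  moreover have "((cosh :: complex \<Rightarrow> complex) \<longlongrightarrow> cosh 0) (at 0)" using isCont_cosh[of "0::complex"] by (simp add: isCont_def)
  ultimately have "((\<lambda>w. cmod (g w / w * cosh w / (sinh w / w))) \<longlongrightarrow> cmod (1 * cosh 0 / 1)) (at 0)"
    by (intro tendsto_intros) auto
  then have "\<forall>\<^sub>F w in at 0. cmod (g w / w * cosh w / (sinh w / w)) < exp \<epsilon>"
    by (rule order_tendstoD) (use assms in simp)
  then obtain \<delta> where \<delta>: "\<delta> > 0" "\<And>w. w \<noteq> 0 \<Longrightarrow> cmod w < \<delta> \<Longrightarrow> cmod (g w / w * cosh w / (sinh w / w)) < exp \<epsilon>"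
    unfolding eventually_at by (auto simp: dist_norm)
  show thesis
  proof (rule that[OF \<delta>(1)])
    fix w assume w: "w \<in> D" "cmod w < \<delta>" "Re w \<noteq> 0"
    then have w0: "w \<noteq> 0" by auto
    then have gw: "g w \<noteq> 0" using zero w by simp
    note ps = psi_eq_ln_tanh[OF w(3), of "Im w", unfolded complex_surj]
    have "cmod (g w) / (cmod (sinh w) / cmod (cosh w)) < exp \<epsilon>"
      using \<delta>(2)[OF w0 w(2)] w0 ps(2,3) by (simp add: norm_mult norm_divide)
    then have "ln (cmod (g w) / (cmod (sinh w) / cmod (cosh w))) < \<epsilon>"
      using gw ps(2,3) by (metis divide_pos_pos exp_gt_zero ln_exp ln_less_cancel_iff zero_less_norm_iff)
    then show "ln (cmod (g w)) - \<epsilon> \<le> psi (Re w) (Im w)"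
      using gw ps(2,3) by (simp add: ps(1) ln_div ln_mult)
  qed
qed

text \<open>If the two derivatives differed at a point, their squared difference would exceed some
  \<open>\<kappa>\<close> on a square of side \<open>2 * s\<close>, placed where the truncated
  potential has its true derivative, while the two-sided estimate bounds \<open>\<kappa>\<close>
  times its area by a multiple of an arbitrary \<open>\<epsilon>\<close>.\<close>

lemma logd_eq_strip:
  assumes short: "\<And>u a b. (\<And>t. t \<in> {a..b} \<Longrightarrow> Complex u t \<in> reach D) \<Longrightarrow> b - a \<le> pi / 2"
    and short': "\<And>u a b. (\<And>t. t \<in> {a..b} \<Longrightarrow> Complex u t \<in> reach (mirror -` D)) \<Longrightarrow> b - a \<le> pi / 2"
  obtains \<eta> where "0 < \<eta>" "\<And>w. cmod w < \<eta> \<Longrightarrow> w \<in> D"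
    "\<And>w. cmod w < \<eta> \<Longrightarrow> 0 < Re w \<Longrightarrow> Re (logd w) = Re (2 / sinh (2 * w))"
proof -
  have small: "\<exists>d>0. \<forall>w. cmod w < d \<longrightarrow> w \<in> D \<and> cmod (g w) < s" if "0 < s" for s
  proof -
    have "open (D \<inter> (\<lambda>z. cmod (g z)) -` {..<s})"
      by (intro continuous_open_preimage D continuous_on_norm cont_g) simp
    moreover have "0 \<in> D \<inter> (\<lambda>z. cmod (g z)) -` {..<s}" using D g0 that by simp
    ultimately obtain d where "d > 0" "ball 0 d \<subseteq> D \<inter> (\<lambda>z. cmod (g z)) -` {..<s}"
      using open_contains_ball by blast
    then show ?thesis by (intro exI[of _ d]) (auto simp: subset_iff)
  qed
  \<comment> \<open>As \<open>\<epsilon>\<close> will be at most 1/2, the bound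
    \<open>exp (- 1)\<close> keeps \<open>ln (cmod (g w))\<close> below
    \<open>- 2 * \<epsilon>\<close>, where the upper ramp of the profile ends.\<close>
  obtain \<eta>1 where \<eta>1: "0 < \<eta>1" "\<And>w. cmod w < \<eta>1 \<Longrightarrow> w \<in> D \<and> cmod (g w) < exp (- 1)"
    using small[of "exp (- 1)"] by auto
  define \<eta> where "\<eta> = min \<eta>1 (1 / 2)"
  have \<eta>: "0 < \<eta>" "\<eta> \<le> 1 / 2" "\<And>w. cmod w < \<eta> \<Longrightarrow> w \<in> D" "\<And>w. cmod w < \<eta> \<Longrightarrow> cmod (g w) < exp (- 1)"
    using \<eta>1 by (auto simp: \<eta>_def)
  have "Re (logd w0) = Re (2 / sinh (2 * w0))" if w0: "cmod w0 < \<eta>" "0 < Re w0" for w0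
  proof (rule ccontr)
    assume ne: "Re (logd w0) \<noteq> Re (2 / sinh (2 * w0))"
    define S where "S = ball 0 \<eta> \<inter> {w. 0 < Re w}"
    define H where "H = (\<lambda>w. (Re (logd w) - psi_u (Re w) (Im w))\<^sup>2)"
    have S: "open S" "w0 \<in> S" unfolding S_def using w0 by (auto intro: open_halfspace_Re_gt)
    have "continuous_on S logd"
      by (rule holomorphic_on_imp_continuous_on, rule holomorphic_on_subset[OF logd_holomorphic]) (auto simp: S_def \<eta>)
    then have cH: "continuous_on S H"
      unfolding H_def by (intro continuous_intros) (auto simp: S_def)
    define \<kappa> where "\<kappa> = H w0 / 2"
    have \<kappa>: "0 < \<kappa>" "\<kappa> < H w0"
      using ne psi_u_eq[of "Re w0" "Im w0"] w0 by (auto simp: \<kappa>_def H_def)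
    have "open (S \<inter> H -` {\<kappa><..})" by (rule continuous_open_preimage[OF cH S(1) open_greaterThan])
    then obtain s1 where s1: "0 < s1" "ball w0 s1 \<subseteq> S \<inter> H -` {\<kappa><..}"
      using S(2) \<kappa>(2) open_contains_ball by blast
    define s where "s = s1 / 3"
    have s: "0 < s" using s1 by (simp add: s_def)
    define u1 u2 v1 v2 where "u1 = Re w0 - s" and "u2 = Re w0 + s" and "v1 = Im w0 - s" and "v2 = Im w0 + s"
    have box: "Complex u v \<in> S \<and> \<kappa> < H (Complex u v)" if "u \<in> {u1..u2}" "v \<in> {v1..v2}" for u v
    proof -
      have "dist (Complex u v) (Complex (Re w0) (Im w0)) \<le> \<bar>u - Re w0\<bar> + \<bar>v - Im w0\<bar>" by (rule dist_Complex_le)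
      moreover have "\<bar>u - Re w0\<bar> \<le> s" "\<bar>v - Im w0\<bar> \<le> s" using that by (auto simp: u1_def u2_def v1_def v2_def abs_le_iff)
      ultimately have "dist (Complex u v) w0 < s1" using s by (simp add: s_def)
      then have "Complex u v \<in> ball w0 s1" by (simp add: dist_commute)
      then show ?thesis using s1(2) by blast
    qed
    have SD: "w \<in> D" "cmod (g w) < exp (- 1)" "0 < Re w" "\<bar>Im w\<bar> < 1 / 2" "g w \<noteq> 0" if "w \<in> S" for w
    proof -
      have w: "cmod w < \<eta>" "0 < Re w" using that by (auto simp: S_def)
      show "w \<in> D" "cmod (g w) < exp (- 1)" "0 < Re w" using w \<eta> by auto
      show "\<bar>Im w\<bar> < 1 / 2" using abs_Im_le_cmod[of w] w \<eta> by linarith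
      show "g w \<noteq> 0" using zero[of w] \<eta>(3)[OF w(1)] w by auto
    qed
    have mem: "u1 \<in> {u1..u2}" "u2 \<in> {u1..u2}" "v1 \<in> {v1..v2}" "v2 \<in> {v1..v2}" using s by (auto simp: u1_def u2_def v1_def v2_def)
    have u1: "0 < u1" "-(1/2) < v1" "v2 < 1 / 2"
      using SD(3,4)[OF conjunct1[OF box[OF mem(1,3)]]] SD(3,4)[OF conjunct1[OF box[OF mem(1,4)]]] by auto
    have q: "1 / 2 \<le> pi / 4" using pi_gt3 by simp
    define X where "X = (\<lambda>q. Complex (fst q) (snd q)) ` ({u1..u2} \<times> {v1..v2})"
    have X: "compact X" unfolding X_def Complex_eq
      by (intro compact_continuous_image continuous_intros compact_Times compact_Icc)
    have XS: "X \<subseteq> S" using box by (auto simp: X_def)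
    have "continuous_on X (\<lambda>w. ln (cmod (g w)))"
      using XS SD by (intro continuous_intros continuous_on_subset[OF cont_g]) auto
    from compact_imp_bounded[OF compact_continuous_image[OF this X]]
    obtain m where m: "\<And>w. w \<in> X \<Longrightarrow> \<bar>ln (cmod (g w))\<bar> \<le> m" by (auto simp: bounded_iff)
    obtain k1 where k1: "\<And>u v. u \<noteq> 0 \<Longrightarrow> \<bar>v\<bar> \<le> pi / 4 \<Longrightarrow> min u1 (1 / 2) \<le> \<bar>u\<bar> \<or> min u1 (1 / 2) \<le> \<bar>v\<bar> \<Longrightarrow> - k1 \<le> psi u v"
    proof -
      have "0 < min u1 (1 / 2)" "min u1 (1 / 2) \<le> pi / 4" using u1(1) q by auto
      then show ?thesis using psi_bounded_off_pole that by metis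
    qed
    \<comment> \<open>The final bound will be \<open>18 * pi * \<epsilon>\<close>, so 20 in the
      denominator gives a strict contradiction.\<close>
    define \<epsilon> where "\<epsilon> = min (1 / 2) (\<kappa> * (2 * s * (2 * s)) / (20 * pi))"
    have \<epsilon>: "0 < \<epsilon>" "\<epsilon> \<le> 1 / 2" "20 * pi * \<epsilon> \<le> \<kappa> * (2 * s * (2 * s))"
    proof -
      show "0 < \<epsilon>" "\<epsilon> \<le> 1 / 2" using \<kappa> s by (simp_all add: \<epsilon>_def)
      have "\<epsilon> \<le> \<kappa> * (2 * s * (2 * s)) / (20 * pi)" by (simp add: \<epsilon>_def)
      then show "20 * pi * \<epsilon> \<le> \<kappa> * (2 * s * (2 * s))" by (simp add: field_simps)
    qed
    obtain \<delta> where \<delta>: "0 < \<delta>" "\<And>w. w \<in> D \<Longrightarrow> cmod w < \<delta> \<Longrightarrow> Re w \<noteq> 0 \<Longrightarrow> ln (cmod (g w)) - \<epsilon> \<le> psi (Re w) (Im w)"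
      using ln_g_le_psi_near[OF \<epsilon>(1)] by metis
    obtain k2 where k2: "\<And>u v. u \<noteq> 0 \<Longrightarrow> \<bar>v\<bar> \<le> pi / 4 \<Longrightarrow> min (\<delta> / 2) \<epsilon> \<le> \<bar>u\<bar> \<or> min (\<delta> / 2) \<epsilon> \<le> \<bar>v\<bar> \<Longrightarrow> - k2 \<le> psi u v"
    proof -
      have "0 < min (\<delta> / 2) \<epsilon>" "min (\<delta> / 2) \<epsilon> \<le> pi / 4" using \<delta>(1) \<epsilon>(1,2) q by auto
      then show ?thesis using psi_bounded_off_pole that by metis
    qed
    \<comment> \<open>\<open>m + 1\<close> puts the values of \<open>ln (cmod (g w))\<close> on the
      square above the lower ramp of the profile, \<open>k1\<close> and \<open>k2\<close> keep the
      square and the region off the pole above the cut, and 2 exceeds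
      \<open>3 * \<epsilon>\<close>.\<close>
    define L where "L = Max {2, m + 1, k1, k2}"
    have L: "2 \<le> L" "m + 1 \<le> L" "k1 \<le> L" "k2 \<le> L" by (simp_all add: L_def)
    \<comment> \<open>The extra \<open>\<epsilon>\<close> absorbs the difference between
      \<open>ln (cmod (g w))\<close> and the strip potential near the pole.\<close>
    define k where "k = L + \<epsilon>"
    have k: "0 \<le> k" "k1 \<le> k" "k2 \<le> k" using L \<epsilon> by (auto simp: k_def)
    obtain d1 where d1: "0 < d1" "\<And>w. cmod w < d1 \<Longrightarrow> w \<in> D \<and> cmod (g w) < exp (- L)"
      using small[of "exp (- L)"] by auto
    define d where "d = min d1 (1 / 2)"
    have d: "0 < d" "d \<le> pi / 4" "\<And>w. cmod w < d \<Longrightarrow> w \<in> D \<and> cmod (g w) < exp (- L)"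
      using d1 q by (auto simp: d_def)
    have "bounded {w \<in> D. cmod (g w) \<le> exp (- \<epsilon>)}" using cpt[of "exp (- \<epsilon>)"] \<epsilon>(1) by (auto intro: compact_imp_bounded)
    then obtain M1 where M1: "\<And>w. w \<in> D \<Longrightarrow> cmod (g w) \<le> exp (- \<epsilon>) \<Longrightarrow> cmod w \<le> M1" by (auto simp: bounded_iff)
    define M where "M = max (M1 + 1) (max 1 u2)"
    have M: "1 \<le> M" "u2 \<le> M" "\<And>w. w \<in> D \<Longrightarrow> cmod (g w) \<le> exp (- \<epsilon>) \<Longrightarrow> \<bar>Re w\<bar> < M \<and> \<bar>Im w\<bar> < M"
    proof -
      show "1 \<le> M" "u2 \<le> M" by (auto simp: M_def)
      fix w assume "w \<in> D" "cmod (g w) \<le> exp (- \<epsilon>)"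
      then have "cmod w \<le> M1" by (rule M1)
      moreover have "M1 < M" by (simp add: M_def)
      ultimately show "\<bar>Re w\<bar> < M \<and> \<bar>Im w\<bar> < M" using abs_Re_le_cmod[of w] abs_Im_le_cmod[of w] by linarith
    qed
    have Le: "3 * \<epsilon> < L" "\<epsilon> < L" using L \<epsilon> by auto
    obtain p P P2 :: "real \<Rightarrow> real" where p: "continuous_on UNIV p" "\<And>t. t \<le> - L \<Longrightarrow> p t = 0" "\<And>t. - \<epsilon> \<le> t \<Longrightarrow> p t = 0"
      and p1: "\<And>t. - L + \<epsilon> \<le> t \<Longrightarrow> t \<le> - 2 * \<epsilon> \<Longrightarrow> p t = 1"
      and P: "\<And>t. (P has_real_derivative p t) (at t)" "\<And>t. - \<epsilon> \<le> t \<Longrightarrow> P t = 0" "\<And>t. P t \<le> 0"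
      and P2: "\<And>t. (P2 has_real_derivative (p t)\<^sup>2) (at t)" "\<And>t. - \<epsilon> \<le> t \<Longrightarrow> P2 t = 0" "\<And>t. P (- L) \<le> P2 t"
      and PL: "L - 3 * \<epsilon> \<le> - P (- L)"
      using pole_profile[OF \<epsilon>(1) Le(1)] by metis
    obtain phi Q :: "real \<Rightarrow> real" where phi: "continuous_on UNIV phi" "\<And>t. - k \<le> t \<Longrightarrow> phi t = 1"
      and Q: "\<And>t. (Q has_real_derivative (phi t)\<^sup>2) (at t)" "Q 0 = 0" "\<And>t. t \<le> 0 \<Longrightarrow> - (k + \<epsilon>) \<le> Q t \<and> Q t \<le> 0"
      using cutoff_profile[OF \<epsilon>(1) k(1)] by metis
    have c': "0 \<le> k + \<epsilon>" using k \<epsilon> by simp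
    have cut: "- k \<le> psi (Re w) (Im w)"
      if w: "w \<in> D" "Re w \<noteq> 0" "\<bar>Im w\<bar> \<le> pi / 4" "exp (- L) < cmod (g w)" for w
    proof (cases "cmod w < \<delta>")
      case True
      have "- L < ln (cmod (g w))" using w(4) by (metis exp_gt_zero less_trans ln_exp ln_less_cancel_iff)
      then show ?thesis using \<delta>(2)[OF w(1) True w(2)] by (simp add: k_def)
    next
      case False
      then have "\<delta> / 2 \<le> \<bar>Re w\<bar> \<or> \<delta> / 2 \<le> \<bar>Im w\<bar>" using cmod_le[of w] by linarith
      then have "- k2 \<le> psi (Re w) (Im w)" by (intro k2 w) auto
      then show ?thesis using k by linarith
    qed
    have r: "- k \<le> psi u v" if "\<epsilon> \<le> u" "\<bar>v\<bar> \<le> pi / 4" for u v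
    proof -
      have "- k2 \<le> psi u v" using that \<epsilon>(1) by (intro k2) auto
      then show ?thesis using k by linarith
    qed
    have inb: "Complex u v \<in> reach D \<and> - k \<le> psi u v \<and> \<kappa> \<le> (pot_u p (Complex u v) - psi_u u v)\<^sup>2"
      if uv: "u \<in> {u1..u2}" "v \<in> {v1..v2}" for u v
    proof (intro conjI)
      have w: "Complex u v \<in> S" "\<kappa> < H (Complex u v)" using box[OF uv] by auto
      show "Complex u v \<in> reach D"
        by (rule reach_near[of \<eta>]) (use w(1) \<eta>(3) in \<open>auto simp: S_def\<close>)
      have "- k1 \<le> psi u v"
      proof (rule k1)
        show "\<bar>v\<bar> \<le> pi / 4" using SD(4)[OF w(1)] q by simp
        show "u \<noteq> 0" "min u1 (1 / 2) \<le> \<bar>u\<bar> \<or> min u1 (1 / 2) \<le> \<bar>v\<bar>" using uv u1 by auto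
      qed
      then show "- k \<le> psi u v" using k by linarith
      have "\<bar>ln (cmod (g (Complex u v)))\<bar> \<le> m" by (rule m) (use uv in \<open>auto simp: X_def intro!: image_eqI[of _ _ "(u, v)"]\<close>)
      moreover have "ln (cmod (g (Complex u v))) < - 1"
        using SD(2,5)[OF w(1)] by (metis exp_gt_zero ln_exp ln_less_cancel_iff zero_less_norm_iff)
      ultimately have "p (ln (cmod (g (Complex u v)))) = 1" using L \<epsilon> by (intro p1) (auto simp: abs_le_iff)
      then have "pot_u p (Complex u v) = Re (logd (Complex u v))" using SD(1)[OF w(1)] by (simp add: pot_u_def)
      then show "\<kappa> \<le> (pot_u p (Complex u v) - psi_u u v)\<^sup>2" using w(2) by (simp add: H_def)
    qed
    have bx: "u1 \<le> u2" "- (pi / 4) \<le> v1" "v1 \<le> v2" "v2 \<le> pi / 4" using mem u1 q by auto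
    have "\<kappa> * ((u2 - u1) * (v2 - v1)) \<le> 2 * pi * (k + \<epsilon> + P (- L)) + 8 * pi * \<epsilon>"
      by (rule two_sided_estimate[OF short short' p P P2 \<epsilon>(1) Le(2) phi Q c' cut \<epsilon>(1) r d M(1,3) u1(1) bx(1) M(2) bx(2-4) inb])
    \<comment> \<open>The large parameter cancels here: \<open>k + \<epsilon>\<close> is
      \<open>L + 2 * \<epsilon>\<close>, and \<open>P (- L)\<close> is at most
      \<open>3 * \<epsilon> - L\<close>.\<close>
    also have "\<dots> \<le> 2 * pi * (5 * \<epsilon>) + 8 * pi * \<epsilon>"
      using PL by (intro add_right_mono mult_left_mono) (auto simp: k_def)
    also have "\<dots> < 20 * pi * \<epsilon>" using \<epsilon>(1) by (simp add: field_simps)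
    finally show False using \<epsilon>(3) by (simp add: u1_def u2_def v1_def v2_def)
  qed
  then show thesis using that[of \<eta>] \<eta> by blast
qed

end

subsection \<open>Rigidity\<close>

text \<open>By the open mapping theorem, as the imaginary axis contains no nonempty open
  set.\<close>

lemma holomorphic_Re_zero_constant:
  assumes "F holomorphic_on S" "open S" "connected S" "\<And>w. w \<in> S \<Longrightarrow> Re (F w) = 0"
  shows "F constant_on S"
proof (rule ccontr)
  assume n: "\<not> F constant_on S"
  then obtain w where w: "w \<in> S" by (auto simp: constant_on_def)
  have "open (F ` S)" using open_mapping_thm[OF assms(1-3) assms(2) order_refl n] .
  then obtain e where e: "e > 0" "ball (F w) e \<subseteq> F ` S" using w open_contains_ball by blast
  have "F w + of_real (e / 2) \<in> ball (F w) e" using e(1) by (simp add: dist_norm)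
  then obtain z where "z \<in> S" "F w + of_real (e / 2) = F z" using e(2) by blast
  then have "Re (F w + of_real (e / 2)) = 0" using assms(4) by metis
  then show False using assms(4)[OF w] e(1) by simp
qed

lemma cosh_sinh_imaginary:
  "cosh (Complex 0 v) = of_real (cos v)" "sinh (Complex 0 v) = \<i> * of_real (sin v)"
  using cos_conv_cosh[of "of_real v"] sin_conv_sinh[of "of_real v"]
  by (simp_all add: Complex_eq cos_of_real sin_of_real)

text \<open>Let \<open>b1\<close> be the first point where \<open>tan v\<close> reaches
  \<open>exp (\<mu> * v)\<close>; it lies beyond \<open>pi / 4\<close>. At the complementary angle
  \<open>a1 = pi / 2 - b1 < b1\<close> one has
  \<open>tan a1 * exp (\<mu> * a1) \<le> exp (\<mu> * (a1 - b1)) < 1\<close>, which leaves room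
  beyond \<open>a1\<close>.\<close>

lemma tan_exp_extents:
  fixes \<mu> :: real
  assumes "0 < \<mu>"
  obtains a b where "0 \<le> a" "a < pi / 2" "0 \<le> b" "b < pi / 2" "pi / 2 < a + b"
    "\<And>v. 0 \<le> v \<Longrightarrow> v \<le> a \<Longrightarrow> tan v * exp (\<mu> * v) < 1" "\<And>v. 0 \<le> v \<Longrightarrow> v \<le> b \<Longrightarrow> tan v * exp (- \<mu> * v) < 1"
proof -
  \<comment> \<open>The tangent of this angle is \<open>exp (\<mu> * (pi / 2))\<close>, at least
    \<open>exp (\<mu> * v1)\<close>; so the set \<open>A\<close> below is not empty.\<close>
  define v1 where "v1 = arctan (exp (\<mu> * (pi / 2)))"
  have v1: "0 \<le> v1" "v1 < pi / 2" using arctan_ubound by (auto simp: v1_def)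
  have cosp: "0 < cos v" if "0 \<le> v" "v < pi / 2" for v using that by (intro cos_gt_zero_pi) auto
  have cont: "continuous_on {0..v1} (\<lambda>v. tan v * exp (- \<mu> * v))"
    using cosp v1 by (intro continuous_intros) force
  define A where "A = {v \<in> {0..v1}. 1 \<le> tan v * exp (- \<mu> * v)}"
  have "A = {0..v1} \<inter> (\<lambda>v. tan v * exp (- \<mu> * v)) -` {1..}" by (auto simp: A_def)
  moreover have "closed ({0..v1} \<inter> (\<lambda>v. tan v * exp (- \<mu> * v)) -` {1..})"
    by (intro continuous_closed_preimage cont) auto
  moreover have "bounded A" by (rule bounded_subset[of "{0..v1}"]) (auto simp: A_def)
  ultimately have A: "compact A" by (simp add: compact_eq_bounded_closed)
  have "v1 \<in> A"
  proof -
    have "exp (\<mu> * v1) \<le> exp (\<mu> * (pi / 2))" using v1 assms by simp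
    then have "1 \<le> exp (\<mu> * (pi / 2)) * exp (- \<mu> * v1)" by (simp add: exp_minus field_simps)
    then show ?thesis using v1(1) by (simp add: A_def v1_def tan_arctan)
  qed
  then obtain b1 where b1: "b1 \<in> A" "\<And>v. v \<in> A \<Longrightarrow> b1 \<le> v"
    using compact_attains_inf[OF A] by (metis empty_iff)
  have b1': "0 \<le> b1" "b1 < pi / 2" "b1 \<le> v1" "1 \<le> tan b1 * exp (- \<mu> * b1)" using b1(1) v1 by (auto simp: A_def)
  have below: "tan v * exp (- \<mu> * v) < 1" if "0 \<le> v" "v < b1" for v
    using b1(2)[of v] that b1' by (force simp: A_def)
  have "exp (\<mu> * b1) \<le> tan b1" using b1'(4) by (simp add: exp_minus field_simps)
  have quarter: "pi / 4 < b1"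
  proof (rule ccontr)
    assume "\<not> pi / 4 < b1"
    then have "tan b1 \<le> tan (pi / 4)" using b1' pi_gt_zero by (intro tan_mono_le) linarith+
    then have "\<mu> * b1 \<le> 0" using \<open>exp (\<mu> * b1) \<le> tan b1\<close> by (metis exp_le_one_iff order_trans tan_45)
    then have "b1 = 0" using assms b1' by (simp add: mult_le_0_iff)
    then show False using \<open>exp (\<mu> * b1) \<le> tan b1\<close> by simp
  qed
  define a1 where "a1 = pi / 2 - b1"
  have a1: "0 < a1" "a1 < pi / 2" using b1' quarter pi_gt_zero by (auto simp: a1_def)
  have "tan a1 * exp (\<mu> * a1) < 1"
  proof -
    have "tan a1 = inverse (tan b1)" using tan_cot[of b1] by (simp add: a1_def)
    also have "\<dots> \<le> inverse (exp (\<mu> * b1))" using \<open>exp (\<mu> * b1) \<le> tan b1\<close> by (intro le_imp_inverse_le) auto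
    finally have "tan a1 * exp (\<mu> * a1) \<le> exp (- (\<mu> * b1)) * exp (\<mu> * a1)" by (intro mult_right_mono) (auto simp: exp_minus)
    also have "\<dots> = exp (\<mu> * (a1 - b1))" by (simp add: algebra_simps flip: exp_add)
    also have "\<dots> < 1" using assms quarter by (simp add: a1_def mult_less_0_iff)
    finally show ?thesis .
  qed
  moreover have "isCont (\<lambda>v. tan v * exp (\<mu> * v)) a1" using cosp[of a1] a1 by (intro continuous_intros) auto
  ultimately have "\<forall>\<^sub>F v in at a1. tan v * exp (\<mu> * v) < 1" by (intro order_tendstoD) (auto simp: isCont_def)
  then obtain \<delta> where \<delta>: "0 < \<delta>" "\<And>v. v \<noteq> a1 \<Longrightarrow> \<bar>v - a1\<bar> < \<delta> \<Longrightarrow> tan v * exp (\<mu> * v) < 1"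
    unfolding eventually_at by (auto simp: dist_real_def)
  \<comment> \<open>One extent gains \<open>\<tau>\<close> and the other gives up
    \<open>\<tau> / 2\<close>, so their sum exceeds \<open>pi / 2\<close>.\<close>
  define \<tau> where "\<tau> = min (\<delta> / 2) (min (b1 / 2) ((pi / 2 - a1) / 2))"
  have \<tau>: "0 < \<tau>" "\<tau> < \<delta>" "\<tau> / 2 < b1" "a1 + \<tau> < pi / 2"
  proof -
    define x where "x = pi / 2 - a1"
    have "0 < x" using a1(2) by (simp add: x_def)
    have \<tau>': "\<tau> = min (\<delta> / 2) (min (b1 / 2) (x / 2))" by (simp add: \<tau>_def x_def)
    have "0 < b1" using quarter pi_gt_zero by linarith
    then show "0 < \<tau>" "\<tau> < \<delta>" "\<tau> / 2 < b1" using \<delta>(1) \<open>0 < x\<close> unfolding \<tau>' by linarith+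
    have "\<tau> < x" using \<open>0 < x\<close> unfolding \<tau>' by linarith
    then show "a1 + \<tau> < pi / 2" by (simp add: x_def)
  qed
  show thesis
  proof (rule that[of "a1 + \<tau>" "b1 - \<tau> / 2"])
    show "tan v * exp (\<mu> * v) < 1" if "0 \<le> v" "v \<le> a1 + \<tau>" for v
    proof -
      have "tan v \<le> tan (a1 + \<tau>)" using that \<tau> pi_gt_zero by (intro tan_mono_le) auto
      moreover have "0 \<le> tan v"
        using tan_mono_le[of 0 v] that \<tau> pi_gt_zero by simp
      moreover have "exp (\<mu> * v) \<le> exp (\<mu> * (a1 + \<tau>))" using that assms by simp
      ultimately have "tan v * exp (\<mu> * v) \<le> tan (a1 + \<tau>) * exp (\<mu> * (a1 + \<tau>))" by (intro mult_mono) auto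
      also have "\<dots> < 1" using \<tau> by (intro \<delta>(2)) auto
      finally show ?thesis .
    qed
    show "tan v * exp (- \<mu> * v) < 1" if "0 \<le> v" "v \<le> b1 - \<tau> / 2" for v
      using that \<tau> by (intro below) auto
  qed (use \<tau> a1 b1' in \<open>auto simp: a1_def\<close>)
qed

context disc_chart
begin

text \<open>The sign \<open>s\<close> selects the direction on the imaginary axis.\<close>

lemma imaginary_segment_in:
  assumes eq: "\<And>v. Complex 0 v \<in> D \<Longrightarrow> cmod (g (Complex 0 v)) * \<bar>cos v\<bar> = \<bar>sin v\<bar> * exp (- \<mu> * v)"
    and b: "0 \<le> b" "b < pi / 2" and s: "s = 1 \<or> s = (-1::real)"
    and lt: "\<And>v. 0 \<le> v \<Longrightarrow> v \<le> b \<Longrightarrow> tan v * exp (- (s * \<mu>) * v) < 1"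
    and v: "v \<in> {0..b}"
  shows "Complex 0 (s * v) \<in> D"
proof -
  have cosp: "0 < cos x" if "0 \<le> x" "x \<le> b" for x using that b by (intro cos_gt_zero_pi) auto
  have "continuous_on {0..b} (\<lambda>v. tan v * exp (- (s * \<mu>) * v))"
    using cosp by (intro continuous_intros) force
  then obtain m where m: "m \<in> {0..b}" "\<And>x. x \<in> {0..b} \<Longrightarrow> tan x * exp (- (s * \<mu>) * x) \<le> tan m * exp (- (s * \<mu>) * m)"
    using continuous_attains_sup[of "{0..b}" "\<lambda>v. tan v * exp (- (s * \<mu>) * v)"] b(1) by fastforce
  define K where "K = {w \<in> D. cmod (g w) \<le> tan m * exp (- (s * \<mu>) * m)}"
  have K: "closed K" unfolding K_def using lt m(1) by (intro compact_imp_closed cpt) auto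
  define T where "T = {0..b} \<inter> (\<lambda>x. Complex 0 (s * x)) -` D"
  have c: "continuous_on {0..b} (\<lambda>x. Complex 0 (s * x))" unfolding Complex_eq by (intro continuous_intros)
  \<comment> \<open>The part of the segment inside \<open>D\<close> is relatively open. It is also
    closed: there the modulus of \<open>g\<close> is given by the explicit profile, whose maximum is
    below 1, so \<open>D\<close> may be replaced by the compact set \<open>K\<close>.\<close>
  have "T = {0..b} \<inter> (\<lambda>x. Complex 0 (s * x)) -` K"
  proof -
    have "Complex 0 (s * x) \<in> K" if x: "x \<in> {0..b}" "Complex 0 (s * x) \<in> D" for x
    proof -
      have "cos (s * x) = cos x" "\<bar>sin (s * x)\<bar> = \<bar>sin x\<bar>" using s by auto
      then have "cmod (g (Complex 0 (s * x))) * cos x = sin x * exp (- (s * \<mu>) * x)"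
        using eq[OF x(2)] cosp[of x] x(1) b sin_ge_zero[of x] by (simp add: mult_ac)
      then have "cmod (g (Complex 0 (s * x))) = tan x * exp (- (s * \<mu>) * x)"
        using cosp[of x] x(1) by (simp add: tan_def field_simps)
      then show ?thesis using m(2)[OF x(1)] x(2) by (simp add: K_def)
    qed
    then show ?thesis by (auto simp: T_def K_def)
  qed
  then have "closedin (top_of_set {0..b}) T" using continuous_closedin_preimage[OF c K] by simp
  moreover have "openin (top_of_set {0..b}) T" unfolding T_def by (rule continuous_openin_preimage_gen[OF c D(1)])
  moreover have "0 \<in> T" using D b by (simp add: T_def flip: zero_complex.code)
  ultimately have "T = {0..b}" using connected_clopen[of "{0..b}"] connected_Icc by blast
  then have "v \<in> T" using v by simp
  then show ?thesis by (simp add: T_def)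
qed

lemma strip_rigidity:
  assumes conn: "connected D"
    and short: "\<And>u a b. (\<And>t. t \<in> {a..b} \<Longrightarrow> Complex u t \<in> reach D) \<Longrightarrow> b - a \<le> pi / 2"
    and short': "\<And>u a b. (\<And>t. t \<in> {a..b} \<Longrightarrow> Complex u t \<in> reach (mirror -` D)) \<Longrightarrow> b - a \<le> pi / 2"
    and short0: "\<And>a b. (\<And>t. t \<in> {a..b} \<Longrightarrow> Complex 0 t \<in> D) \<Longrightarrow> b - a \<le> pi / 2"
    and w: "w \<in> D"
  shows "g w * cosh w = sinh w"
proof -
  have "\<exists>\<eta>>0. (\<forall>w. cmod w < \<eta> \<longrightarrow> w \<in> D) \<and> (\<forall>w. cmod w < \<eta> \<longrightarrow> 0 < Re w \<longrightarrow> Re (logd w) = Re (2 / sinh (2 * w)))"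
    by (rule logd_eq_strip) (fact short short' | blast)+
  then obtain \<eta> where \<eta>: "0 < \<eta>" "\<And>w. cmod w < \<eta> \<Longrightarrow> w \<in> D"
    "\<And>w. cmod w < \<eta> \<Longrightarrow> 0 < Re w \<Longrightarrow> Re (logd w) = Re (2 / sinh (2 * w))"
    by metis
  define S where "S = ball 0 \<eta> \<inter> {w. 0 < Re w}"
  have S: "open S" "convex S" unfolding S_def
    by (auto intro!: open_Int convex_Int convex_halfspace_Re_gt open_halfspace_Re_gt)
  have Sne: "of_real (\<eta> / 2) \<in> S" using \<eta>(1) by (simp add: S_def)
  have SD: "S \<subseteq> D - {0}" using \<eta>(2) by (auto simp: S_def)
  have nz: "sinh w \<noteq> 0" "cosh w \<noteq> 0" if "w \<in> S" for w
    using psi_eq_ln_tanh(2,3)[of "Re w" "Im w"] that by (auto simp: S_def)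
  have dbl: "sinh (2 * w) = 2 * sinh w * cosh w" for w :: complex by (rule sinh_double)
  define F where "F = (\<lambda>w. logd w - 2 / sinh (2 * w))"
  have hs: "sinh holomorphic_on A" "cosh holomorphic_on A" for A :: "complex set"
    unfolding sinh_field_def cosh_field_def by (intro holomorphic_intros; simp)+
  have "(\<lambda>w::complex. sinh (2 * w)) holomorphic_on S" unfolding dbl by (intro holomorphic_intros hs)
  then have "F holomorphic_on S"
    unfolding F_def using nz by (intro holomorphic_intros holomorphic_on_subset[OF logd_holomorphic SD]) (auto simp: dbl)
  moreover have "Re (F w) = 0" if "w \<in> S" for w using \<eta>(3)[of w] that by (auto simp: F_def S_def)
  ultimately have "F constant_on S" using holomorphic_Re_zero_constant S convex_connected by blast
  then obtain C where C: "\<And>w. w \<in> S \<Longrightarrow> F w = C" by (auto simp: constant_on_def)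
  have "Re C = 0" using C[OF Sne] \<open>\<And>w. w \<in> S \<Longrightarrow> Re (F w) = 0\<close>[OF Sne] by simp
  then obtain \<mu> where \<mu>: "C = \<i> * of_real \<mu>" by (metis complex_eq mult.commute add_0 of_real_0)
  define H where "H = (\<lambda>w. g w * cosh w / (sinh w * exp (C * w)))"
  have "\<exists>k. \<forall>w\<in>S. H w = k"
  proof (rule has_field_derivative_zero_constant[OF S(2)])
    fix w assume wS: "w \<in> S"
    have gd: "(g has_field_derivative deriv g w) (at w)" using hol D wS SD by (auto intro: holomorphic_derivI)
    have gnz: "g w \<noteq> 0" using wS SD zero by auto
    have "deriv g w / g w - 2 / (2 * sinh w * cosh w) = C" using C[OF wS] by (simp add: F_def logd_def dbl)
    then have dg': "deriv g w = g w * (C + 1 / (sinh w * cosh w))" using gnz nz[OF wS] by (simp add: field_simps)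
    have pyth: "cosh w * cosh w = 1 + sinh w * sinh w" using cosh_square_eq[of w] by (simp add: power2_eq_square)
    have "((\<lambda>w. g w * cosh w) has_field_derivative deriv g w * cosh w + g w * sinh w) (at w)"
      by (auto intro!: derivative_eq_intros gd)
    moreover have "deriv g w * cosh w + g w * sinh w = g w * (C * cosh w * sinh w + 1 + sinh w * sinh w) / sinh w"
      unfolding dg' using nz[OF wS] by (simp add: field_simps)
    moreover have "((\<lambda>w. sinh w * exp (C * w)) has_field_derivative exp (C * w) * (cosh w + C * sinh w)) (at w)"
      by (auto intro!: derivative_eq_intros simp: algebra_simps)
    ultimately have "(H has_field_derivative (g w * (C * cosh w * sinh w + cosh w * cosh w) / sinh w * (sinh w * exp (C * w))
        - g w * cosh w * (exp (C * w) * (cosh w + C * sinh w))) / (sinh w * exp (C * w) * (sinh w * exp (C * w)))) (at w)"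
      unfolding H_def pyth using nz[OF wS] by (intro DERIV_divide) (auto simp: add.assoc)
    moreover have "g w * (C * cosh w * sinh w + cosh w * cosh w) / sinh w * (sinh w * exp (C * w))
        - g w * cosh w * (exp (C * w) * (cosh w + C * sinh w)) = 0"
    proof -
      have "x / sinh w * (sinh w * y) = x * y" for x y using nz[OF wS] by simp
      then show ?thesis by (simp only:) (simp add: algebra_simps)
    qed
    ultimately have "(H has_field_derivative 0) (at w)" by simp
    then show "(H has_field_derivative 0) (at w within S)" by (rule has_field_derivative_at_within)
  qed
  then obtain k where k: "\<And>w. w \<in> S \<Longrightarrow> H w = k" by blast
  \<comment> \<open>Without denominators both sides are holomorphic on all of \<open>D\<close>,
    zeros of \<open>sinh\<close> and \<open>cosh\<close> included, so the identity continues from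
    the half disc.\<close>
  have gk: "g w * cosh w = k * (sinh w * exp (C * w))" if "w \<in> D" for w
  proof (rule analytic_continuation_open[where s=S and s'=D and f="\<lambda>w. g w * cosh w"
      and g="\<lambda>w. k * (sinh w * exp (C * w))"])
    show "(\<lambda>w. g w * cosh w) holomorphic_on D" "(\<lambda>w. k * (sinh w * exp (C * w))) holomorphic_on D"
      by (intro holomorphic_intros hs hol)+
    show "g z * cosh z = k * (sinh z * exp (C * z))" if "z \<in> S" for z
      using k[OF that] nz[OF that] by (auto simp: H_def field_simps)
  qed (use S SD Sne D conn that in auto)
  have "k = 1"
  proof -
    have gd: "(g has_field_derivative 1) (at 0)" using holomorphic_derivI[OF hol D] dg by simp
    have "((\<lambda>w. g w * cosh w) has_field_derivative 1) (at 0)"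
      by (auto intro!: derivative_eq_intros gd simp: g0)
    then have "((\<lambda>w. k * (sinh w * exp (C * w))) has_field_derivative 1) (at 0)"
      by (rule has_field_derivative_transform_within_open[OF _ D]) (rule gk)
    moreover have "((\<lambda>w. k * (sinh w * exp (C * w))) has_field_derivative k) (at 0)"
      by (auto intro!: derivative_eq_intros)
    ultimately show ?thesis using DERIV_unique by blast
  qed
  have im: "cmod (g (Complex 0 v)) * \<bar>cos v\<bar> = \<bar>sin v\<bar> * exp (- \<mu> * v)" if "Complex 0 v \<in> D" for v
  proof -
    have "C * Complex 0 v = of_real (- \<mu> * v)" by (simp add: \<mu> complex_eq_iff)
    then have "cmod (exp (C * Complex 0 v)) = exp (- \<mu> * v)" by simp
    moreover have "cmod (g (Complex 0 v) * cosh (Complex 0 v)) = cmod (sinh (Complex 0 v)) * cmod (exp (C * Complex 0 v))"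
      using gk[OF that] \<open>k = 1\<close> by (simp add: norm_mult)
    ultimately show ?thesis by (simp add: cosh_sinh_imaginary norm_mult)
  qed
  have no: False if ab: "0 \<le> a" "a < pi / 2" "0 \<le> b" "b < pi / 2" "pi / 2 < a + b"
    "\<And>v. 0 \<le> v \<Longrightarrow> v \<le> a \<Longrightarrow> tan v * exp (\<mu> * v) < 1" "\<And>v. 0 \<le> v \<Longrightarrow> v \<le> b \<Longrightarrow> tan v * exp (- \<mu> * v) < 1" for a b
  proof -
    have up: "Complex 0 t \<in> D" if "t \<in> {0..b}" for t
      using imaginary_segment_in[OF im ab(3,4), of 1 t] ab(7) that by simp
    have down: "Complex 0 (- t) \<in> D" if "t \<in> {0..a}" for t
      using imaginary_segment_in[OF im ab(1,2), of "-1" t] ab(6) that by simp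
    have "Complex 0 t \<in> D" if "t \<in> {- a..b}" for t
      using up[of t] down[of "- t"] that by (cases "0 \<le> t") auto
    from short0[of "- a" b, OF this] show False using ab(5) by simp
  qed
  have "\<mu> = 0"
  proof (rule ccontr)
    assume "\<mu> \<noteq> 0"
    then consider "0 < \<mu>" | "0 < - \<mu>" by linarith
    then show False
    proof cases
      case 1
      then show False using tan_exp_extents no by metis
    next
      case 2
      obtain a b where "0 \<le> a" "a < pi / 2" "0 \<le> b" "b < pi / 2" "pi / 2 < a + b"
        "\<And>v. 0 \<le> v \<Longrightarrow> v \<le> a \<Longrightarrow> tan v * exp (- \<mu> * v) < 1" "\<And>v. 0 \<le> v \<Longrightarrow> v \<le> b \<Longrightarrow> tan v * exp (- (- \<mu>) * v) < 1"
        using tan_exp_extents[OF 2] by blast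
      \<comment> \<open>For negative \<open>\<mu>\<close> the upward and the downward extent change
        places.\<close>
      then show False using no[of b a] by (simp add: add.commute)
    qed
  qed
  then show ?thesis using gk[OF w] \<open>k = 1\<close> \<mu> by simp
qed

end

text \<open>The fraction avoids the branch cut on the disc, so twice \<open>f\<close> minus the
  principal logarithm is holomorphic there and has exponential 1. Its derivative is therefore 0, and
  its value at 0 is 0.\<close>

lemma eq_half_Ln_if_exp_eq:
  assumes f: "f holomorphic_on ball 0 1" "f 0 = 0"
    and ex: "\<And>z. z \<in> ball 0 1 \<Longrightarrow> exp (2 * f z) = (1 + z) / (1 - z)"
    and z: "z \<in> ball 0 1"
  shows "f z = Ln ((1 + z) / (1 - z)) / 2"
proof -
  have ne: "(1 + z) / (1 - z) \<notin> \<real>\<^sub>\<le>\<^sub>0 \<and> 1 + z \<noteq> 0 \<and> 1 - z \<noteq> 0" if "z \<in> ball 0 1" for z :: complex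
  proof (intro conjI)
    have n: "cmod z < 1" using that by simp
    show nz: "1 + z \<noteq> 0" "1 - z \<noteq> 0" using n by (auto simp: add_eq_0_iff)
    show "(1 + z) / (1 - z) \<notin> \<real>\<^sub>\<le>\<^sub>0"
    proof
      assume "(1 + z) / (1 - z) \<in> \<real>\<^sub>\<le>\<^sub>0"
      then obtain t where t: "t \<le> 0" "(1 + z) / (1 - z) = of_real t" by (auto elim: nonpos_Reals_cases)
      then have "1 + z = of_real t * (1 - z)" using nz by (simp add: field_simps)
      then have "z * of_real (1 + t) = of_real (t - 1)" by (simp add: algebra_simps)
      then have "cmod z * \<bar>1 + t\<bar> = \<bar>t - 1\<bar>" by (metis norm_mult norm_of_real)
      moreover have "cmod z * \<bar>1 + t\<bar> \<le> 1 * \<bar>1 + t\<bar>" using n by (intro mult_right_mono) auto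
      ultimately have "\<bar>t - 1\<bar> \<le> \<bar>1 + t\<bar>" by simp
      then have "t = 0" using t(1) by linarith
      then show False using t(2) nz by simp
    qed
  qed
  define h where "h = (\<lambda>z. 2 * f z - Ln ((1 + z) / (1 - z)))"
  have hh: "h holomorphic_on ball 0 1" unfolding h_def using ne by (intro holomorphic_intros f) auto
  have e1: "exp (h z) = 1" if "z \<in> ball 0 1" for z using ex[OF that] ne[OF that] by (simp add: h_def exp_diff)
  have "\<exists>c. \<forall>z\<in>ball 0 1. h z = c"
  proof (rule has_field_derivative_zero_constant)
    fix z :: complex assume zb: "z \<in> ball 0 1"
    have hd: "(h has_field_derivative deriv h z) (at z)" using hh zb by (auto intro: holomorphic_derivI)
    have "((\<lambda>z. exp (h z)) has_field_derivative exp (h z) * deriv h z) (at z)"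
      by (auto intro!: derivative_eq_intros hd)
    moreover have "((\<lambda>z. exp (h z)) has_field_derivative 0) (at z)"
      by (rule has_field_derivative_transform_within_open[of "\<lambda>_. 1" 0 z "ball 0 1"]) (use e1 zb in auto)
    ultimately have "exp (h z) * deriv h z = 0" by (rule DERIV_unique)
    then show "(h has_field_derivative 0) (at z within ball 0 1)"
      using hd by (auto intro: has_field_derivative_at_within)
  qed simp
  then have "h z = h 0" using z by (metis centre_in_ball zero_less_one)
  then have "2 * f z = Ln ((1 + z) / (1 - z))" using f(2) by (simp add: h_def)
  then show ?thesis by (metis nonzero_mult_div_cancel_left zero_neq_numeral)
qed

theorem mainTheorem1:
  fixes f :: "complex \<Rightarrow> complex"
  assumes "schlicht_S f"
    and "\<not> (\<forall>z\<in>ball 0 1. f z = Ln ((1 + z) / (1 - z)) / 2)"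
  shows "\<exists>u0 a b. b - a > pi / 2
           \<and> (\<forall>t\<in>{a..b}. Complex u0 t \<in> f ` ball 0 1)
           \<and> (\<exists>v :: real \<Rightarrow> real. continuous_on {min 0 u0 .. max 0 u0} v \<and> v 0 = 0
                 \<and> (\<forall>u\<in>{min 0 u0 .. max 0 u0}. Complex u (v u) \<in> f ` ball 0 1))"
proof (rule ccontr)
  assume neg: "\<not> ?thesis"
  have f: "f holomorphic_on ball 0 1" "inj_on f (ball 0 1)" "f 0 = 0" "deriv f 0 = 1"
    using assms(1) by (auto simp: schlicht_S_def)
  define D where "D = f ` ball 0 1"
  obtain g where g: "g holomorphic_on D" "\<And>z. z \<in> ball 0 1 \<Longrightarrow> deriv f z * deriv g (f z) = 1"
    "\<And>z. z \<in> ball 0 1 \<Longrightarrow> g (f z) = z"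
    unfolding D_def using holomorphic_has_inverse[OF f(1) open_ball f(2)] by metis
  have D: "open D" unfolding D_def by (rule open_mapping_thm3[OF f(1) open_ball f(2)])
  have cf: "continuous_on (ball 0 1) f" using f(1) by (rule holomorphic_on_imp_continuous_on)
  have D0: "0 \<in> D" unfolding D_def by (rule image_eqI[of _ _ 0]) (use f in auto)
  have g0: "g 0 = 0" using g(3)[of 0] f(3) by simp
  interpret disc_chart D g
  proof
    show "g w = 0 \<longleftrightarrow> w = 0" if "w \<in> D" for w
      using that g(3) f(3) g0 unfolding D_def by auto
    show "deriv g 0 = 1" using g(2)[of 0] f by simp
    show "compact {w \<in> D. cmod (g w) \<le> s}" if "s < 1" for s
    proof -
      have "{w \<in> D. cmod (g w) \<le> s} = f ` cball 0 s" using g(3) that by (force simp: D_def)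
      moreover have "compact (f ` cball 0 s)"
        using that by (intro compact_continuous_image continuous_on_subset[OF cf]) auto
      ultimately show ?thesis by simp
    qed
  qed (use D D0 g in auto)
  \<comment> \<open>The negated claim in usable form: once a graph in \<open>D\<close> reaches the
    abscissa \<open>u\<close>, all segments in \<open>D\<close> over \<open>u\<close> are short.
    Both parts of the theorem are denied together, so the contradiction yields one segment that
    serves both.\<close>
  have len: "b - a \<le> pi / 2"
    if "\<And>t. t \<in> {a..b} \<Longrightarrow> Complex u t \<in> D" "continuous_on {min 0 u..max 0 u} v" "v 0 = 0"
      "\<And>x. x \<in> {min 0 u..max 0 u} \<Longrightarrow> Complex x (v x) \<in> D" for u a b and v :: "real \<Rightarrow> real"
  proof (rule ccontr)
    assume "\<not> b - a \<le> pi / 2"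
    then have "pi / 2 < b - a \<and> (\<forall>t\<in>{a..b}. Complex u t \<in> f ` ball 0 1) \<and>
        (\<exists>v :: real \<Rightarrow> real. continuous_on {min 0 u .. max 0 u} v \<and> v 0 = 0
          \<and> (\<forall>x\<in>{min 0 u .. max 0 u}. Complex x (v x) \<in> f ` ball 0 1))"
      using that unfolding D_def by (intro conjI exI[of _ v]) auto
    then show False using neg by blast
  qed
  have "g w * cosh w = sinh w" if "w \<in> D" for w
  proof (rule strip_rigidity)
    show "connected D" unfolding D_def by (rule connected_continuous_image[OF cf]) simp
    show "b - a \<le> pi / 2" if seg: "\<And>t. t \<in> {a..b} \<Longrightarrow> Complex u t \<in> reach D" for u a b
    proof (cases "a \<le> b")
      case True
      then have "Complex u a \<in> reach D" using seg by simp
      then obtain \<gamma> where \<gamma>: "0 < u" "continuous_on {0..u} \<gamma>" "\<gamma> 0 = 0" "\<And>t. t \<in> {0..u} \<Longrightarrow> Complex t (\<gamma> t) \<in> D"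
        using reachE by metis
      show ?thesis by (rule len[of a b u \<gamma>]) (use seg reach_subset \<gamma> in auto)
    qed (use pi_gt_zero in linarith)
    show "b - a \<le> pi / 2" if seg: "\<And>t. t \<in> {a..b} \<Longrightarrow> Complex u t \<in> reach (mirror -` D)" for u a b
    proof (cases "a \<le> b")
      case True
      then have "Complex u a \<in> reach (mirror -` D)" using seg by simp
      then obtain \<gamma> where \<gamma>: "0 < u" "continuous_on {0..u} \<gamma>" "\<gamma> 0 = 0" "\<And>t. t \<in> {0..u} \<Longrightarrow> Complex t (\<gamma> t) \<in> mirror -` D"
        using reachE by metis
      show ?thesis
      proof (rule len[of a b "- u" "\<lambda>t. \<gamma> (- t)"])
        show "Complex (- u) t \<in> D" if "t \<in> {a..b}" for t using seg[OF that] reach_subset by force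
        show "Complex t (\<gamma> (- t)) \<in> D" if "t \<in> {min 0 (- u)..max 0 (- u)}" for t using \<gamma>(4)[of "- t"] \<gamma>(1) that by auto
        show "continuous_on {min 0 (- u)..max 0 (- u)} (\<lambda>t. \<gamma> (- t))"
          by (rule continuous_on_compose2[OF \<gamma>(2)]) (use \<gamma>(1) in \<open>auto intro!: continuous_intros\<close>)
      qed (use \<gamma> in simp)
    qed (use pi_gt_zero in linarith)
    \<comment> \<open>Over the abscissa 0 the curve shrinks to the origin, so every segment of the
      imaginary axis inside \<open>D\<close> is covered by the negated claim.\<close>
    show "b - a \<le> pi / 2" if "\<And>t. t \<in> {a..b} \<Longrightarrow> Complex 0 t \<in> D" for a b
      by (rule len[of a b 0 "\<lambda>_. 0"]) (use that D0 in \<open>auto simp flip: zero_complex.code\<close>)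
  qed fact
  then have "exp (2 * f z) = (1 + z) / (1 - z)" if z: "z \<in> ball 0 1" for z
  proof -
    have "z * cosh (f z) = sinh (f z)" using \<open>\<And>w. w \<in> D \<Longrightarrow> g w * cosh w = sinh w\<close>[of "f z"] g(3)[OF z] z by (auto simp: D_def)
    moreover have "exp (f z) = cosh (f z) + sinh (f z)" "exp (- f z) = cosh (f z) - sinh (f z)"
      by (simp_all add: cosh_plus_sinh cosh_minus_sinh)
    ultimately have e: "exp (f z) = cosh (f z) * (1 + z)" "exp (- f z) = cosh (f z) * (1 - z)" by (simp_all add: algebra_simps)
    then have nz: "cosh (f z) \<noteq> 0" "1 - z \<noteq> 0" by (metis exp_not_eq_zero mult_eq_0_iff)+
    have "exp (2 * f z) = exp (f z) / exp (- f z)" by (simp add: flip: exp_diff)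
    then show ?thesis unfolding e using nz by simp
  qed
  then have "\<forall>z\<in>ball 0 1. f z = Ln ((1 + z) / (1 - z)) / 2"
    using eq_half_Ln_if_exp_eq[OF f(1,3)] by blast
  then show False using assms(2) by simp
qed

end
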